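(* Let $k \ge 3$ be a fixed integer. If $G=(V,E)$ is a graph with $n$ vertices, $m$ edges and no isolated vertices, and $w : E \rightarrow \mathbb{R}$ is a weight function, then a maximum weight cycle of length $k$ in $G$, if one exists, can be found with high probability by a randomized algorithm in $O(m^{2-1/\lceil k/2 \rceil})$ time, and deterministically in $O(m^{2-1/\lceil k/2 \rceil}\log n)$ time.
   Context: The weight of a subgraph is the sum of the weights of its edges. Computation is in the addition-comparison model: real numbers may only be added and compared. *)

theory Defs
  imports "HOL-Probability.Probability" "HOL-Library.Landau_Symbols"
begin

section \<open>Weighted graphs and cycles\<close>

definition simple_graph :: "'v set \<Rightarrow> 'v set set \<Rightarrow> bool" where
  "simple_graph V E \<longleftrightarrow>
     finite V \<and> (\<forall>e\<in>E. \<exists>u v. u \<in> V \<and> v \<in> V \<and> u \<noteq> v \<and> e = {u, v})"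

definition no_isolated_vertices :: "'v set \<Rightarrow> 'v set set \<Rightarrow> bool" where
  "no_isolated_vertices V E \<longleftrightarrow> (\<forall>v\<in>V. \<exists>e\<in>E. v \<in> e)"

text \<open>A cycle is given by its cyclic vertex sequence; for length at least 3 the
  edges listed below are pairwise distinct.\<close>

definition cycle_edges :: "'v list \<Rightarrow> 'v set set" where
  "cycle_edges vs = (\<lambda>i. {vs ! i, vs ! (Suc i mod length vs)}) ` {..<length vs}"

definition is_cycle :: "'v set set \<Rightarrow> nat \<Rightarrow> 'v list \<Rightarrow> bool" where
  "is_cycle E k vs \<longleftrightarrow> length vs = k \<and> distinct vs \<and> cycle_edges vs \<subseteq> E"

definition weight :: "('v set \<Rightarrow> real) \<Rightarrow> 'v set set \<Rightarrow> real" where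
  "weight w F = (\<Sum>e\<in>F. w e)"

definition is_max_weight_cycle ::
    "'v set set \<Rightarrow> ('v set \<Rightarrow> real) \<Rightarrow> nat \<Rightarrow> 'v list \<Rightarrow> bool" where
  "is_max_weight_cycle E w k vs \<longleftrightarrow>
     is_cycle E k vs \<and>
     (\<forall>us. is_cycle E k us \<longrightarrow> weight w (cycle_edges us) \<le> weight w (cycle_edges vs))"

section \<open>Addition-comparison random access machines\<close>

text \<open>
  The machine is a word RAM with structured control flow, extended by a separate
  store of real numbers.  Words are natural numbers below a bound \<open>W\<close>, and word
  arithmetic is modulo \<open>W\<close>.  Reals can only be moved, added and compared; there is
  no conversion between words and reals.  Registers and arrays are named by
  numbers that are fixed in the program text, so each program uses finitely many
  of them, while array indices are computed.
\<close>

datatype word_op = WAdd | WSub | WMul | WDiv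

datatype test =
    WLess nat nat
  | WEq nat nat
  | RLess nat nat

datatype com =
    Skip
  | WConst nat nat            (* register, constant *)
  | WOp word_op nat nat nat   (* target, left, right operand *)
  | WGet nat nat nat          (* target, array, index register *)
  | WPut nat nat nat          (* array, index register, source *)
  | RMove nat nat             (* target, source *)
  | RAdd nat nat nat          (* target, left, right operand *)
  | RGet nat nat nat          (* real target, array, index word register *)
  | RPut nat nat nat          (* array, index word register, real source *)
  | Random nat nat            (* target, register holding the largest value *)
  | Seq com com
  | IfThenElse test com com
  | While test com

record ram_state =
  wreg :: "nat \<Rightarrow> nat"
  warr :: "nat \<Rightarrow> nat \<Rightarrow> nat"
  rreg :: "nat \<Rightarrow> real"
  rarr :: "nat \<Rightarrow> nat \<Rightarrow> real"

text \<open>Subtraction of words is truncated at 0, and division by 0 yields 0.\<close>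

fun word_op_val :: "word_op \<Rightarrow> nat \<Rightarrow> nat \<Rightarrow> nat" where
  "word_op_val WAdd a b = a + b"
| "word_op_val WSub a b = a - b"
| "word_op_val WMul a b = a * b"
| "word_op_val WDiv a b = a div b"

fun test_val :: "test \<Rightarrow> ram_state \<Rightarrow> bool" where
  "test_val (WLess x y) s \<longleftrightarrow> wreg s x < wreg s y"
| "test_val (WEq x y) s \<longleftrightarrow> wreg s x = wreg s y"
| "test_val (RLess x y) s \<longleftrightarrow> rreg s x < rreg s y"

definition set_wreg :: "nat \<Rightarrow> nat \<Rightarrow> ram_state \<Rightarrow> ram_state" where
  "set_wreg x a s = s\<lparr>wreg := (wreg s)(x := a)\<rparr>"

definition set_warr :: "nat \<Rightarrow> nat \<Rightarrow> nat \<Rightarrow> ram_state \<Rightarrow> ram_state" where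
  "set_warr A i a s = s\<lparr>warr := (warr s)(A := (warr s A)(i := a))\<rparr>"

definition set_rreg :: "nat \<Rightarrow> real \<Rightarrow> ram_state \<Rightarrow> ram_state" where
  "set_rreg x r s = s\<lparr>rreg := (rreg s)(x := r)\<rparr>"

definition set_rarr :: "nat \<Rightarrow> nat \<Rightarrow> real \<Rightarrow> ram_state \<Rightarrow> ram_state" where
  "set_rarr A i r s = s\<lparr>rarr := (rarr s)(A := (rarr s A)(i := r))\<rparr>"

text \<open>A configuration consists of the stack of commands still to be executed and the
  current state; a configuration with an empty stack is halted and stays
  unchanged.\<close>

type_synonym config = "com list \<times> ram_state"

definition halted :: "config \<Rightarrow> bool" where
  "halted cf \<longleftrightarrow> fst cf = []"

fun step :: "nat \<Rightarrow> config \<Rightarrow> config pmf" where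
  "step W ([], s) = return_pmf ([], s)"
| "step W (Skip # K, s) = return_pmf (K, s)"
| "step W (WConst x c # K, s) = return_pmf (K, set_wreg x (c mod W) s)"
| "step W (WOp f x y z # K, s) =
     return_pmf (K, set_wreg x (word_op_val f (wreg s y) (wreg s z) mod W) s)"
| "step W (WGet x A y # K, s) = return_pmf (K, set_wreg x (warr s A (wreg s y)) s)"
| "step W (WPut A x y # K, s) = return_pmf (K, set_warr A (wreg s x) (wreg s y) s)"
| "step W (RMove x y # K, s) = return_pmf (K, set_rreg x (rreg s y) s)"
| "step W (RAdd x y z # K, s) = return_pmf (K, set_rreg x (rreg s y + rreg s z) s)"
| "step W (RGet x A y # K, s) = return_pmf (K, set_rreg x (rarr s A (wreg s y)) s)"
| "step W (RPut A x y # K, s) = return_pmf (K, set_rarr A (wreg s x) (rreg s y) s)"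
| "step W (Random x y # K, s) =
     map_pmf (\<lambda>a. (K, set_wreg x a s)) (pmf_of_set {0..wreg s y})"
| "step W (Seq p q # K, s) = return_pmf (p # q # K, s)"
| "step W (IfThenElse b p q # K, s) =
     return_pmf ((if test_val b s then p else q) # K, s)"
| "step W (While b p # K, s) =
     return_pmf (if test_val b s then p # While b p # K else K, s)"

text \<open>The distribution of the configuration reached after a number of unit-cost steps.\<close>

primrec run :: "nat \<Rightarrow> nat \<Rightarrow> config \<Rightarrow> config pmf" where
  "run W 0 cf = return_pmf cf"
| "run W (Suc t) cf = bind_pmf (step W cf) (run W t)"

primrec deterministic :: "com \<Rightarrow> bool" where
  "deterministic Skip \<longleftrightarrow> True"
| "deterministic (WConst x c) \<longleftrightarrow> True"
| "deterministic (WOp f x y z) \<longleftrightarrow> True"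
| "deterministic (WGet x A y) \<longleftrightarrow> True"
| "deterministic (WPut A x y) \<longleftrightarrow> True"
| "deterministic (RMove x y) \<longleftrightarrow> True"
| "deterministic (RAdd x y z) \<longleftrightarrow> True"
| "deterministic (RGet x A y) \<longleftrightarrow> True"
| "deterministic (RPut A x y) \<longleftrightarrow> True"
| "deterministic (Random x y) \<longleftrightarrow> False"
| "deterministic (Seq p q) \<longleftrightarrow> deterministic p \<and> deterministic q"
| "deterministic (IfThenElse b p q) \<longleftrightarrow> deterministic p \<and> deterministic q"
| "deterministic (While b p) \<longleftrightarrow> deterministic p"

section \<open>The maximum weight cycle problem on the machine\<close>

text \<open>The graph has vertices \<open>0, \<dots>, n - 1\<close> and is presented by a list of its edges, in
  arbitrary order, each with an arbitrarily chosen orientation.\<close>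

definition lists_edges :: "(nat \<times> nat) list \<Rightarrow> nat set set \<Rightarrow> bool" where
  "lists_edges es E \<longleftrightarrow>
     distinct (map (\<lambda>(u, v). {u, v}) es) \<and> set (map (\<lambda>(u, v). {u, v}) es) = E"

text \<open>Initially word registers 0 and 1 hold the numbers of vertices and of edges, word
  arrays 0 and 1 hold the endpoints of the edges, and real array 0 holds their
  weights.  Everything else is 0.\<close>

definition input_state ::
    "nat \<Rightarrow> (nat \<times> nat) list \<Rightarrow> (nat set \<Rightarrow> real) \<Rightarrow> ram_state" where
  "input_state n es w =
     \<lparr>wreg = (\<lambda>_. 0)(0 := n, 1 := length es),
      warr = (\<lambda>A i. if i < length es \<and> A = 0 then fst (es ! i)
                     else if i < length es \<and> A = 1 then snd (es ! i) else 0),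
      rreg = (\<lambda>_. 0),
      rarr = (\<lambda>A i. if i < length es \<and> A = 0 then w {fst (es ! i), snd (es ! i)} else 0)\<rparr>"

text \<open>On termination word register 0 tells whether a cycle has been found, and if so, the
  first \<open>k\<close> cells of word array 2 hold its vertices in cyclic order.\<close>

definition correct_output ::
    "nat \<Rightarrow> nat set set \<Rightarrow> (nat set \<Rightarrow> real) \<Rightarrow> ram_state \<Rightarrow> bool" where
  "correct_output k E w s \<longleftrightarrow>
     (if \<exists>vs. is_cycle E k vs
      then wreg s 0 = 1 \<and> is_max_weight_cycle E w k (map (warr s 2) [0..<k])
      else wreg s 0 = 0)"

text \<open>Program \<open>p\<close>, on words of \<open>O(log (n + m))\<close> bits (the constant being \<open>d\<close>), halts on
  every graph with \<open>n\<close> vertices, \<open>m\<close> edges and no isolated vertices, for every outcome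
  of its random choices, after at most \<open>T n m\<close> steps, and its answer is correct with
  probability at least \<open>q n\<close>.\<close>

definition finds_max_weight_cycle ::
    "nat \<Rightarrow> com \<Rightarrow> nat \<Rightarrow> (nat \<Rightarrow> nat \<Rightarrow> nat) \<Rightarrow> (nat \<Rightarrow> real) \<Rightarrow> bool" where
  "finds_max_weight_cycle k p d T q \<longleftrightarrow>
     (\<forall>n E w es.
        simple_graph {..<n} E \<longrightarrow> no_isolated_vertices {..<n} E \<longrightarrow> lists_edges es E \<longrightarrow>
        (let W = (n + card E + 2) ^ d;
             final = run W (T n (card E)) ([p], input_state n es w)
         in (\<forall>cf\<in>set_pmf final. halted cf) \<and>
            measure_pmf.prob final {cf. correct_output k E w (snd cf)} \<ge> q n))"

end

theory Submission
  imports Defs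
begin

text \<open>
  One deterministic algorithm meets both bounds.  Let \<open>r = \<lceil>k / 2\<rceil>\<close>.  Every cycle has a vertex
  \<open>u\<close> of maximum degree \<open>d\<close>, and it consists of a path of length \<open>r\<close> and a path of length
  \<open>k - r\<close>, both from \<open>u\<close> to some vertex \<open>x\<close> and both inside the vertices of degree at most \<open>d\<close>.
  So for every \<open>u\<close> one grows the layers of vertices reached from \<open>u\<close> by such walks of length at
  most \<open>r\<close>.  At every reached vertex only a bounded number of paths is stored, a
  representative family in the sense of Monien: for every small set \<open>Y\<close>, the heaviest stored
  path avoiding \<open>Y\<close> is as heavy as any path avoiding \<open>Y\<close>.  Such families can be computed layer by
  layer, and pairs of stored paths suffice to find the heaviest cycle through \<open>u\<close>.

  The work for \<open>u\<close> is bounded by a constant times \<open>min (2 m) (d\<^sup>r)\<close>, because a layer has at most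
  \<open>2 m\<close> outgoing half-edges and each step multiplies the size of a layer by at most \<open>d\<close>.
  This is at most \<open>(2 m)\<close> to the power \<open>1 - 1 / r\<close>, times \<open>d\<close>, and the degrees sum up to \<open>2 m\<close>.
\<close>

section \<open>Total correctness with time bounds\<close>

text \<open>The bound on the work for \<open>u\<close> is an interpolation: a number that is at most
  \<open>2 m\<close> and at most \<open>d\<close> to the power \<open>r\<close> is at most the
  product of the first to the power \<open>1 - 1 / r\<close> and the second to the power
  \<open>1 / r\<close>, and the latter factor is \<open>d\<close>. The exponent thus comes from the
  longer of the two paths, which is why the cycle is cut as evenly as possible. The obstacle is
  disjointness: a walk found by search need not be a path, nor avoid the other half of the cycle,
  and storing all paths is too expensive. The size of a representative family depends on
  \<open>k\<close> only. Hence its positions can be named in the program text, loops over positions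
  are unrolled, and treating a layer costs a constant factor more than searching it. Neither random
  choices nor a logarithm arise, so one program of success probability 1 serves both halves of the
  theorem. On the machine, clearing arrays of length \<open>n\<close> for every \<open>u\<close>
  would take order \<open>n * n\<close> steps, too many for sparse graphs; time stamps replace
  clearing.\<close>

primrec seqs :: "com list \<Rightarrow> com" where
  "seqs [] = Skip"
| "seqs (c # cs) = Seq c (seqs cs)"

text \<open>The rest \<open>K\<close> of the stack is universally quantified so that triples compose
  under \<open>Seq\<close> and \<open>While\<close>. Asking for a point mass makes the triple speak
  of one definite final state; \<open>B\<close> only bounds the exact number \<open>t\<close> of
  steps.\<close>

definition hoare :: "nat \<Rightarrow> com \<Rightarrow> ram_state \<Rightarrow> nat \<Rightarrow> (ram_state \<Rightarrow> bool) \<Rightarrow> bool" where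
  "hoare W p s B Q \<longleftrightarrow>
     (\<exists>t\<le>B. \<exists>s'. (\<forall>K. run W t (p # K, s) = return_pmf (K, s')) \<and> Q s')"

lemma run_add: "run W (a + b) cf = bind_pmf (run W a cf) (run W b)"
proof (induction a arbitrary: cf)
  case (Suc a)
  have "run W (a + b) = (\<lambda>cf. bind_pmf (run W a cf) (run W b))" by (rule ext) (rule Suc)
  then show ?case by (simp add: bind_assoc_pmf)
qed (simp add: bind_return_pmf)

lemma run_halted: "run W t ([], s) = return_pmf ([], s)"
  by (induction t) (simp_all add: bind_return_pmf)

lemma hoare_conseq:
  "hoare W p s B Q \<Longrightarrow> B \<le> B' \<Longrightarrow> (\<And>s'. Q s' \<Longrightarrow> Q' s') \<Longrightarrow> hoare W p s B' Q'"
  unfolding hoare_def by (meson le_trans)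

lemma hoare_step:
  assumes "\<And>K. step W (p # K, s) = return_pmf (K, s')" "Q s'" "1 \<le> B"
  shows "hoare W p s B Q"
  unfolding hoare_def by (rule exI[of _ 1]) (use assms in \<open>auto simp: bind_return_pmf\<close>)

lemma hoare_Seq:
  assumes "hoare W p s Ba R" "\<And>s'. R s' \<Longrightarrow> hoare W q s' Bb Q" "Ba + Bb + 1 \<le> B"
  shows "hoare W (Seq p q) s B Q"
proof -
  obtain t s' where t: "t \<le> Ba" "\<And>K. run W t (p # K, s) = return_pmf (K, s')" "R s'"
    using assms(1) unfolding hoare_def by blast
  obtain t' s'' where t': "t' \<le> Bb" "\<And>K. run W t' (q # K, s') = return_pmf (K, s'')" "Q s''"
    using assms(2)[OF t(3)] unfolding hoare_def by blast
  have "run W (Suc (t + t')) (Seq p q # K, s) = return_pmf (K, s'')" for K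
    by (simp add: bind_return_pmf run_add t t')
  then show ?thesis unfolding hoare_def using t(1) t'(1,3) assms(3)
    by (intro exI[of _ "Suc (t + t')"]) auto
qed

lemma hoare_If:
  assumes "test_val b s \<Longrightarrow> hoare W p s B Q" "\<not> test_val b s \<Longrightarrow> hoare W q s B Q" "B + 1 \<le> B'"
  shows "hoare W (IfThenElse b p q) s B' Q"
proof -
  have "hoare W (if test_val b s then p else q) s B Q" using assms by simp
  then obtain t s' where t: "t \<le> B"
    "\<And>K. run W t ((if test_val b s then p else q) # K, s) = return_pmf (K, s')" "Q s'"
    unfolding hoare_def by blast
  have "run W (Suc t) (IfThenElse b p q # K, s) = return_pmf (K, s')" for K
    by (simp add: bind_return_pmf t)
  then show ?thesis unfolding hoare_def using t assms(3) by (intro exI[of _ "Suc t"]) auto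
qed

lemma hoare_While_False: "\<not> test_val b s \<Longrightarrow> Q s \<Longrightarrow> 1 \<le> B \<Longrightarrow> hoare W (While b p) s B Q"
  by (rule hoare_step) auto

lemma hoare_While_True:
  assumes "test_val b s" "hoare W p s Ba R" "\<And>s'. R s' \<Longrightarrow> hoare W (While b p) s' Bb Q"
    and "Ba + Bb + 1 \<le> B"
  shows "hoare W (While b p) s B Q"
proof -
  obtain t s' where t: "t \<le> Ba" "\<And>K. run W t (p # K, s) = return_pmf (K, s')" "R s'"
    using assms(2) unfolding hoare_def by blast
  obtain t' s'' where t': "t' \<le> Bb"
      "\<And>K. run W t' (While b p # K, s') = return_pmf (K, s'')" "Q s''"
    using assms(3)[OF t(3)] unfolding hoare_def by blast
  have "run W (Suc (t + t')) (While b p # K, s) = return_pmf (K, s'')" for K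
    by (simp add: bind_return_pmf run_add t t' assms(1))
  then show ?thesis unfolding hoare_def using t(1) t'(1,3) assms(4)
    by (intro exI[of _ "Suc (t + t')"]) auto
qed

text \<open>The ghost list \<open>xs\<close> fixes the iterations in advance, one per element, so
  termination needs no measure, and the cost \<open>c\<close> may depend on the element; this is
  what charges a vertex by its degree. The invariant sees the finished prefix and the remaining
  suffix.\<close>

lemma hoare_While_list:
  assumes step: "\<And>ys z zs s. xs = ys @ z # zs \<Longrightarrow> I ys (z # zs) s \<Longrightarrow>
      test_val b s \<and> hoare W p s (c z) (I (ys @ [z]) zs)"
    and stop: "\<And>s. I xs [] s \<Longrightarrow> \<not> test_val b s"
    and init: "I [] xs s" and B: "(\<Sum>x\<leftarrow>xs. c x + 1) + 1 \<le> B"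
  shows "hoare W (While b p) s B (I xs [])"
proof -
  have "xs = ys @ zs \<Longrightarrow> I ys zs s \<Longrightarrow>
      hoare W (While b p) s ((\<Sum>x\<leftarrow>zs. c x + 1) + 1) (I xs [])" for ys zs s
  proof (induction zs arbitrary: ys s)
    case Nil
    then show ?case by (auto intro!: hoare_While_False stop)
  next
    case (Cons z zs)
    from step[OF Cons.prems] have "test_val b s" "hoare W p s (c z) (I (ys @ [z]) zs)" by auto
    then show ?case by (rule hoare_While_True) (use Cons in auto)
  qed
  from this[of "[]", OF _ init] B show ?thesis
    by (auto intro: hoare_conseq)
qed

text \<open>Counterpart of \<open>hoare_While_list\<close> for loops unrolled into the program text,
  as used for the positions of a family and for the layers.\<close>

lemma hoare_seqs:
  assumes step: "\<And>ys z zs s. xs = ys @ z # zs \<Longrightarrow> I ys s \<Longrightarrow> hoare W (f z) s (c z) (I (ys @ [z]))"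
    and init: "I [] s" and B: "(\<Sum>x\<leftarrow>xs. c x + 1) + 1 \<le> B"
  shows "hoare W (seqs (map f xs)) s B (I xs)"
proof -
  have "xs = ys @ zs \<Longrightarrow> I ys s \<Longrightarrow> hoare W (seqs (map f zs)) s ((\<Sum>x\<leftarrow>zs. c x + 1) + 1) (I xs)"
    for ys zs s
  proof (induction zs arbitrary: ys s)
    case Nil
    then show ?case by (auto intro!: hoare_step)
  next
    case (Cons z zs)
    have "hoare W (f z) s (c z) (I (ys @ [z]))" by (rule step) (use Cons in auto)
    then show ?case unfolding list.map seqs.simps
      by (rule hoare_Seq[where Bb = "(\<Sum>x\<leftarrow>zs. c x + 1) + 1"]) (use Cons in auto)
  qed
  from this[of "[]", OF _ init] B show ?thesis
    by (auto intro: hoare_conseq)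
qed

section \<open>Frames: what a command leaves unchanged\<close>

datatype loc = WR nat | WA nat | RR nat | RA nat

definition agree :: "loc set \<Rightarrow> ram_state \<Rightarrow> ram_state \<Rightarrow> bool" where
  "agree X s s' \<longleftrightarrow>
     (\<forall>a. WR a \<in> X \<longrightarrow> wreg s' a = wreg s a) \<and> (\<forall>a. WA a \<in> X \<longrightarrow> warr s' a = warr s a) \<and>
     (\<forall>a. RR a \<in> X \<longrightarrow> rreg s' a = rreg s a) \<and> (\<forall>a. RA a \<in> X \<longrightarrow> rarr s' a = rarr s a)"

lemma agree_refl[simp]: "agree X s s"
  by (simp add: agree_def)

lemma agree_trans: "agree X s s' \<Longrightarrow> agree Y s' s'' \<Longrightarrow> Z \<subseteq> X \<inter> Y \<Longrightarrow> agree Z s s''"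
  unfolding agree_def by (simp add: subset_iff)

lemma agree_mono: "agree X s s' \<Longrightarrow> Y \<subseteq> X \<Longrightarrow> agree Y s s'"
  unfolding agree_def by blast

primrec mods :: "com \<Rightarrow> loc set" where
  "mods Skip = {}"
| "mods (WConst x c) = {WR x}"
| "mods (WOp f x y z) = {WR x}"
| "mods (WGet x A y) = {WR x}"
| "mods (WPut A x y) = {WA A}"
| "mods (RMove x y) = {RR x}"
| "mods (RAdd x y z) = {RR x}"
| "mods (RGet x A y) = {RR x}"
| "mods (RPut A x y) = {RA A}"
| "mods (Random x y) = {WR x}"
| "mods (Seq p q) = mods p \<union> mods q"
| "mods (IfThenElse b p q) = mods p \<union> mods q"
| "mods (While b p) = mods p"

lemma mods_seqs[simp]: "mods (seqs cs) = (\<Union>c\<in>set cs. mods c)"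
  by (induction cs) auto

lemma deterministic_seqs[simp]: "deterministic (seqs cs) \<longleftrightarrow> (\<forall>c\<in>set cs. deterministic c)"
  by (induction cs) auto

text \<open>Unfolding \<open>Seq\<close> or \<open>While\<close> lengthens the stack, but only by
  subcommands, so the set of modifiable locations never grows; the induction in
  \<open>run_frame\<close> needs exactly this.\<close>

lemma step_frame:
  assumes "(K', s') \<in> set_pmf (step W (K, s))"
  shows "\<Union> (mods ` set K') \<subseteq> \<Union> (mods ` set K) \<and> agree (- \<Union> (mods ` set K)) s s'"
proof (cases K)
  case (Cons c K0)
  then show ?thesis using assms
    by (cases c)
      (auto simp: agree_def set_wreg_def set_warr_def set_rreg_def set_rarr_def split: if_splits)
qed (use assms in auto)

lemma run_frame:
  "(K', s') \<in> set_pmf (run W t (K, s)) \<Longrightarrow> agree (- \<Union> (mods ` set K)) s s'"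
proof (induction t arbitrary: K s)
  case (Suc t)
  then obtain K1 s1 where 1: "(K1, s1) \<in> set_pmf (step W (K, s))"
    "(K', s') \<in> set_pmf (run W t (K1, s1))" by auto
  show ?case
    by (rule agree_trans[OF conjunct2[OF step_frame[OF 1(1)]] Suc.IH[OF 1(2)]])
      (use conjunct1[OF step_frame[OF 1(1)]] in blast)
qed simp

text \<open>With the empty continuation the final state lies in the support of a run of
  \<open>p\<close> alone, so \<open>run_frame\<close> applies.\<close>

lemma hoare_frame:
  assumes "hoare W p s B Q"
  shows "hoare W p s B (\<lambda>s'. Q s' \<and> agree (- mods p) s s')"
proof -
  obtain t s' where t: "t \<le> B" "\<And>K. run W t (p # K, s) = return_pmf (K, s')" "Q s'"
    using assms unfolding hoare_def by blast
  have "agree (- mods p) s s'" using run_frame[of "[]" s' W t "[p]" s] t by simp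
  with t show ?thesis unfolding hoare_def by blast
qed

section \<open>Loop-free code as a state transformer\<close>

primrec loopfree :: "com \<Rightarrow> bool" where
  "loopfree Skip \<longleftrightarrow> True"
| "loopfree (WConst x c) \<longleftrightarrow> True"
| "loopfree (WOp f x y z) \<longleftrightarrow> True"
| "loopfree (WGet x A y) \<longleftrightarrow> True"
| "loopfree (WPut A x y) \<longleftrightarrow> True"
| "loopfree (RMove x y) \<longleftrightarrow> True"
| "loopfree (RAdd x y z) \<longleftrightarrow> True"
| "loopfree (RGet x A y) \<longleftrightarrow> True"
| "loopfree (RPut A x y) \<longleftrightarrow> True"
| "loopfree (Random x y) \<longleftrightarrow> False"
| "loopfree (Seq p q) \<longleftrightarrow> loopfree p \<and> loopfree q"
| "loopfree (IfThenElse b p q) \<longleftrightarrow> loopfree p \<and> loopfree q"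
| "loopfree (While b p) \<longleftrightarrow> False"

primrec sem :: "nat \<Rightarrow> com \<Rightarrow> ram_state \<Rightarrow> ram_state" where
  "sem W Skip s = s"
| "sem W (WConst x c) s = set_wreg x (c mod W) s"
| "sem W (WOp f x y z) s = set_wreg x (word_op_val f (wreg s y) (wreg s z) mod W) s"
| "sem W (WGet x A y) s = set_wreg x (warr s A (wreg s y)) s"
| "sem W (WPut A x y) s = set_warr A (wreg s x) (wreg s y) s"
| "sem W (RMove x y) s = set_rreg x (rreg s y) s"
| "sem W (RAdd x y z) s = set_rreg x (rreg s y + rreg s z) s"
| "sem W (RGet x A y) s = set_rreg x (rarr s A (wreg s y)) s"
| "sem W (RPut A x y) s = set_rarr A (wreg s x) (rreg s y) s"
| "sem W (Random x y) s = s"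
| "sem W (Seq p q) s = sem W q (sem W p s)"
| "sem W (IfThenElse b p q) s = (if test_val b s then sem W p s else sem W q s)"
| "sem W (While b p) s = s"

text \<open>Both branches of a conditional are added up: only an upper bound that is constant for a
  fixed program text is wanted.\<close>

primrec csize :: "com \<Rightarrow> nat" where
  "csize Skip = 1"
| "csize (WConst x c) = 1"
| "csize (WOp f x y z) = 1"
| "csize (WGet x A y) = 1"
| "csize (WPut A x y) = 1"
| "csize (RMove x y) = 1"
| "csize (RAdd x y z) = 1"
| "csize (RGet x A y) = 1"
| "csize (RPut A x y) = 1"
| "csize (Random x y) = 1"
| "csize (Seq p q) = csize p + csize q + 1"
| "csize (IfThenElse b p q) = csize p + csize q + 1"
| "csize (While b p) = csize p"

lemma loopfree_seqs[simp]: "loopfree (seqs cs) \<longleftrightarrow> (\<forall>c\<in>set cs. loopfree c)"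
  by (induction cs) auto

lemma sem_seqs_append[simp]: "sem W (seqs (cs @ ds)) s = sem W (seqs ds) (sem W (seqs cs) s)"
  by (induction cs arbitrary: s) auto

lemma hoare_loopfree:
  assumes "loopfree p" "Q (sem W p s)" "csize p \<le> B"
  shows "hoare W p s B Q"
proof -
  have "loopfree p \<Longrightarrow> hoare W p s (csize p) (\<lambda>s'. s' = sem W p s)"
  proof (induction p arbitrary: s)
    case (Seq p q)
    show ?case by (rule hoare_Seq[OF Seq.IH(1)]) (use Seq in auto)
  next
    case (IfThenElse b p q)
    from IfThenElse.prems have *: "loopfree p" "loopfree q" by auto
    show ?case
      by (rule hoare_If[where B = "csize p + csize q"])
        ((rule hoare_conseq[OF IfThenElse.IH(1)[OF *(1)]] hoare_conseq[OF IfThenElse.IH(2)[OF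
            *(2)]];
          simp)+, simp)
  qed (auto intro!: hoare_step)
  from this[OF assms(1)] assms(2,3) show ?thesis by (auto intro: hoare_conseq)
qed

lemma sem_frame:
  assumes "loopfree p"
  shows "agree (- mods p) s (sem W p s)"
  using hoare_frame[OF hoare_loopfree[of p "\<lambda>s'. s' = sem W p s" W s "csize p"]] assms
  unfolding hoare_def by auto

section \<open>Cycles, paths and representative families\<close>

lemma inj_on_cycle_edge:
  assumes "distinct vs" "length vs = k" "k \<ge> 3"
  shows "inj_on (\<lambda>i. {vs ! i, vs ! (Suc i mod k)}) {..<k}"
proof (rule inj_onI)
  fix i j assume ij: "i \<in> {..<k}" "j \<in> {..<k}"
    "{vs ! i, vs ! (Suc i mod k)} = {vs ! j, vs ! (Suc j mod k)}"
  have eq: "vs ! a = vs ! b \<longleftrightarrow> a = b" if "a < k" "b < k" for a b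
    using that assms by (simp add: nth_eq_iff_index_eq)
  have k: "Suc i mod k < k" "Suc j mod k < k" using assms by auto
  show "i = j"
  proof (rule ccontr)
    assume ne: "i \<noteq> j"
    \<comment> \<open>Two different positions with the same edge are cyclic successors of each
      other; then two steps around the cycle lead back to the start, which \<open>k \<ge> 3\<close>
      excludes.\<close>
    then have ij': "i = Suc j mod k" "j = Suc i mod k"
      using ij(3) unfolding doubleton_eq_iff
      using eq[of i j] eq[of i "Suc j mod k"] eq[of "Suc i mod k" j] ij(1,2) k by auto
    have S: "Suc a mod k = (if Suc a = k then 0 else Suc a)" if "a < k" for a using that by auto
    have "i = (if Suc j = k then 0 else Suc j)" "j = (if Suc i = k then 0 else Suc i)"
      using ij' S ij(1,2) by (metis lessThan_iff)+
    then show False using assms(3) by presburger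
  qed
qed

lemma weight_cycle:
  assumes "is_cycle E k vs" "k \<ge> 3"
  shows "weight w (cycle_edges vs) = (\<Sum>i<k. w {vs ! i, vs ! (Suc i mod k)})"
  using assms inj_on_cycle_edge[of vs k] unfolding is_cycle_def weight_def cycle_edges_def
  by (auto simp: sum.reindex)

lemma is_cycle_iff:
  "is_cycle E k vs \<longleftrightarrow>
     length vs = k \<and> distinct vs \<and> (\<forall>i<k. {vs ! i, vs ! (Suc i mod k)} \<in> E)"
  unfolding is_cycle_def cycle_edges_def by auto

text \<open>Rotation only permutes the index set, by adding \<open>j\<close> modulo
  \<open>k\<close>. It is needed because the pass for \<open>u\<close> looks for cycles that start
  at \<open>u\<close>.\<close>

lemma cycle_edges_rotate:
  assumes "length vs = k" "k > 0"
  shows "cycle_edges (rotate j vs) = cycle_edges vs"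
proof -
  have nth_rot: "rotate j vs ! i = vs ! ((j + i) mod k)" if "i < k" for i
    using that assms by (simp add: nth_rotate)
  then have *: "cycle_edges (rotate j vs) =
      (\<lambda>i. {vs ! ((j + i) mod k), vs ! (Suc ((j + i) mod k) mod k)}) ` {..<k}"
    unfolding cycle_edges_def length_rotate assms(1)
    using assms(2) by (intro image_cong refl) (simp add: mod_Suc_eq mod_add_right_eq)
  have "(\<lambda>i. (j + i) mod k) ` {..<k} = {..<k}"
  proof (intro equalityI subsetI)
    fix a assume "a \<in> {..<k}"
    \<comment> \<open>The preimage of \<open>a\<close> is \<open>a - j\<close> modulo
      \<open>k\<close>, written as \<open>a + (k - j mod k)\<close> so that the subtraction of
      naturals does not truncate.\<close>
    have "j mod k + (k - j mod k) = k" using assms by simp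
    then have "j + (a + (k - j mod k)) = a + k * (j div k + 1)"
      using mult_div_mod_eq[of k j] by (simp only: distrib_left mult_1_right)
    then have "a = (j + (a + (k - j mod k)) mod k) mod k"
      using \<open>a \<in> {..<k}\<close> by (simp only: mod_add_right_eq mod_mult_self2) simp
    then show "a \<in> (\<lambda>i. (j + i) mod k) ` {..<k}" using assms
      by (intro image_eqI[of _ _ "(a + (k - j mod k)) mod k"]) (assumption, simp)
  qed (use assms in auto)
  then have "cycle_edges vs =
      (\<lambda>i. {vs ! i, vs ! (Suc i mod k)}) ` (\<lambda>i. (j + i) mod k) ` {..<k}"
    unfolding cycle_edges_def using assms by simp
  then show ?thesis unfolding * image_image by simp
qed

lemma is_cycle_rotate:
  assumes "is_cycle E k vs" "k > 0"
  shows "is_cycle E k (rotate j vs)"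
  using assms cycle_edges_rotate[of vs k j] unfolding is_cycle_def by auto

section \<open>Heaviest candidates and the tree of representatives\<close>

definition ismax :: "('a \<times> real) set \<Rightarrow> ('a \<times> real) option \<Rightarrow> bool" where
  "ismax C c = (case c of None \<Rightarrow> C = {} | Some c \<Rightarrow> c \<in> C \<and> (\<forall>c'\<in>C. snd c' \<le> snd c))"

lemma ismaxE:
  assumes "ismax C N" "c \<in> C"
  obtains c' where "N = Some c'" "c' \<in> C" "snd c \<le> snd c'"
  using assms by (cases N) (auto simp: ismax_def)

text \<open>Monien's trees: a candidate is kept at every position of the tree; the child \<open>i\<close> of a
  position keeps a heaviest candidate avoiding also the \<open>i\<close>-th vertex of the candidate kept by
  its parent.  Descending along vertices of \<open>Y\<close> must end at a candidate avoiding \<open>Y\<close>.\<close>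

lemma tree_representative:
  fixes N :: "nat list \<Rightarrow> ('a list \<times> real) option" and raw :: "nat list \<Rightarrow> nat \<Rightarrow> 'a"
  defines "av \<equiv> \<lambda>\<tau>. (\<lambda>j. raw (take j \<tau>) (\<tau> ! j)) ` {..<length \<tau>}"
  assumes N: "\<And>\<tau>. length \<tau> \<le> q \<Longrightarrow> set \<tau> \<subseteq> {..<b} \<Longrightarrow> ismax {c \<in> C. set (fst c) \<inter> av \<tau> = {}} (N \<tau>)"
    and raw: "\<And>\<tau> c. length \<tau> \<le> q \<Longrightarrow> set \<tau> \<subseteq> {..<b} \<Longrightarrow> N \<tau> = Some c \<Longrightarrow> fst c = map (raw \<tau>) [0..<b]"
    and Y: "finite Y" "card Y \<le> q" and c: "c \<in> C" "set (fst c) \<inter> Y = {}"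
  obtains \<tau> c' where "length \<tau> \<le> q" "set \<tau> \<subseteq> {..<b}" "N \<tau> = Some c'" "set (fst c') \<inter> Y = {}"
    "snd c \<le> snd c'"
proof -
  \<comment> \<open>\<open>av \<tau>\<close> collects the vertices along which the descent has
    reached \<open>\<tau>\<close>.\<close>
  have av_snoc: "av (\<tau> @ [i]) = insert (raw \<tau> i) (av \<tau>)" for \<tau> i
    unfolding av_def length_append_singleton lessThan_Suc image_insert
    by (intro arg_cong2[where f = insert] image_cong) (simp_all add: nth_append)
  \<comment> \<open>The descent stays inside \<open>Y\<close> and never repeats a vertex, so its
    depth is at most \<open>card Y \<le> q\<close>.\<close>
  have "\<exists>\<tau> c'. length \<tau> \<le> q \<and> set \<tau> \<subseteq> {..<b} \<and> N \<tau> = Some c' \<and> set (fst c') \<inter> Y = {} \<and>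
      snd c \<le> snd c'"
    if "card (av \<tau>) = length \<tau>" "av \<tau> \<subseteq> Y" "set \<tau> \<subseteq> {..<b}" for \<tau>
    using that
  proof (induction "q - length \<tau>" arbitrary: \<tau> rule: less_induct)
    case less
    have len: "length \<tau> \<le> q" using card_mono[OF Y(1) less.prems(2)] less.prems(1) Y(2) by simp
    note max = N[OF len less.prems(3)]
    \<comment> \<open>As \<open>av \<tau>\<close> lies in \<open>Y\<close>, the given
      \<open>c\<close> still competes at \<open>\<tau>\<close>; hence the weight bound at every
      stage of the descent.\<close>
    have cC: "c \<in> {c \<in> C. set (fst c) \<inter> av \<tau> = {}}" using c less.prems(2) by blast
    obtain c' where "N \<tau> = Some c'" "c' \<in> {c \<in> C. set (fst c) \<inter> av \<tau> = {}}" "snd c \<le> snd c'"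
      by (rule ismaxE[OF max cC])
    then have c': "N \<tau> = Some c'" "set (fst c') \<inter> av \<tau> = {}" "snd c \<le> snd c'"
      by blast+
    show ?case
    proof (cases "set (fst c') \<inter> Y = {}")
      case False
      then obtain v where v: "v \<in> set (fst c')" "v \<in> Y" by auto
      then obtain i where i: "i < b" "v = raw \<tau> i"
        using raw[OF len less.prems(3) c'(1)] by auto
      have fin: "finite (av \<tau>)" unfolding av_def by auto
      \<comment> \<open>The kept candidate avoids \<open>av \<tau>\<close>, so the vertex of
        \<open>Y\<close> that it hits is new, and descending to the child \<open>i\<close> uses up
        one more vertex of \<open>Y\<close>.\<close>
      have "v \<notin> av \<tau>" using v c' by auto
      then have "card (av (\<tau> @ [i])) = Suc (length \<tau>)"
        using i less.prems fin by (simp add: av_snoc)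
      moreover have "av (\<tau> @ [i]) \<subseteq> Y" using less.prems i v by (simp add: av_snoc)
      moreover have "Suc (length \<tau>) \<le> q"
        using card_mono[OF Y(1) calculation(2)] calculation(1) Y(2) by simp
      ultimately show ?thesis
        using less.hyps[of "\<tau> @ [i]"] less.prems(3) i by auto
    qed (use c' len less.prems(3) in blast)
  qed
  from this[of "[]"] show thesis using that by (auto simp: av_def)
qed

text \<open>The bounds on \<open>W\<close> rule out wrap-around: vertices, stamps
  \<open>u + 1\<close>, counters, degrees and half-edge numbers stay below the first one, and the
  indices below \<open>k\<close> written by the output code stay below \<open>W\<close> by the
  second.\<close>

locale weighted_graph =
  fixes n :: nat and E :: "nat set set" and w :: "nat set \<Rightarrow> real" and es :: "(nat \<times> nat) list"
    and k W :: nat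
  assumes graph: "simple_graph {..<n} E" "no_isolated_vertices {..<n} E" "lists_edges es E"
    and k3: "k \<ge> 3" and W: "n + 2 * length es + 2 < W" "k < W"
begin

section \<open>Half-edges and degrees\<close>

definition m where "m = length es"

text \<open>Every edge is split into two half-edges; the number 0 is reserved as the end mark of the
  incidence lists.\<close>

definition H :: "nat set" where "H = {1..2 * m}"

text \<open>For \<open>1 \<le> h \<le> m\<close> the half-edges \<open>h\<close> and
  \<open>m + h\<close> are the two orientations of the edge with index \<open>h - 1\<close>.\<close>

definition S :: "nat \<Rightarrow> nat" where
  "S h = (if h \<le> m then fst (es ! (h - 1)) else snd (es ! (h - m - 1)))"

definition T :: "nat \<Rightarrow> nat" where
  "T h = (if h \<le> m then snd (es ! (h - 1)) else fst (es ! (h - m - 1)))"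

definition dg :: "nat \<Rightarrow> nat" where "dg y = card {h \<in> H. S h = y}"

lemma finite_H[simp]: "finite H"
  by (simp add: H_def)

lemma edge_mem: assumes "i < m" shows "{fst (es ! i), snd (es ! i)} \<in> E"
  using assms graph(3) unfolding lists_edges_def m_def
  by (metis (mono_tags, lifting) case_prod_unfold image_eqI nth_mem list.set_map)

lemma half_edge: assumes "h \<in> H" shows "{S h, T h} \<in> E"
  using assms edge_mem[of "h - 1"] edge_mem[of "h - m - 1"]
  by (auto simp: H_def S_def T_def insert_commute)

lemma ends: assumes "h \<in> H" shows "S h < n" "T h < n" "S h \<noteq> T h"
proof -
  obtain u v where "u < n" "v < n" "u \<noteq> v" "{S h, T h} = {u, v}"
    using half_edge[OF assms] graph(1) unfolding simple_graph_def by blast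
  then show "S h < n" "T h < n" "S h \<noteq> T h" by (auto simp: doubleton_eq_iff)
qed

lemma edgeE:
  assumes "{y, x} \<in> E"
  obtains h where "h \<in> H" "S h = y" "T h = x"
proof -
  have "\<exists>i<m. {fst (es ! i), snd (es ! i)} = {y, x}"
    using assms graph(3) unfolding lists_edges_def m_def
    by (force simp: in_set_conv_nth case_prod_unfold)
  then obtain i where i: "i < m" "{fst (es ! i), snd (es ! i)} = {y, x}" by auto
  then consider "fst (es ! i) = y" "snd (es ! i) = x" | "fst (es ! i) = x" "snd (es ! i) = y"
    by (auto simp: doubleton_eq_iff)
  then show thesis
  proof cases
    case 1 then show ?thesis using that[of "Suc i"] i by (auto simp: H_def S_def T_def)
  next
    case 2 then show ?thesis using that[of "m + Suc i"] i by (auto simp: H_def S_def T_def)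
  qed
qed

text \<open>This is where isolated vertices are excluded. It allows the constant overhead of a
  vertex to be charged to its half-edges, in \<open>n_le\<close> as well as in
  \<open>cost_pos\<close>.\<close>

lemma dg_pos: assumes "y < n" shows "dg y \<ge> 1"
proof -
  obtain e where e: "e \<in> E" "y \<in> e" using graph(2) assms by (auto simp: no_isolated_vertices_def)
  then obtain x where "e = {y, x}" using graph(1) unfolding simple_graph_def by fastforce
  then obtain h where "h \<in> H" "S h = y" using edgeE e by metis
  then have "{h \<in> H. S h = y} \<noteq> {}" by auto
  then show ?thesis unfolding dg_def by (simp add: Suc_le_eq card_gt_0_iff)
qed

lemma sum_dg: assumes "finite Y" shows "(\<Sum>y\<in>Y. dg y) = card {h \<in> H. S h \<in> Y}"
proof -
  have "{h \<in> H. S h \<in> Y} = (\<Union>y\<in>Y. {h \<in> H. S h = y})" by auto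
  moreover have "card (\<Union>y\<in>Y. {h \<in> H. S h = y}) = (\<Sum>y\<in>Y. dg y)"
    unfolding dg_def by (intro card_UN_disjoint) (use assms in auto)
  ultimately show ?thesis by simp
qed

lemma sum_dg_le: assumes "finite Y" shows "(\<Sum>y\<in>Y. dg y) \<le> 2 * m"
proof -
  have "card {h \<in> H. S h \<in> Y} \<le> card H" by (intro card_mono) auto
  moreover have "card H = 2 * m" by (simp add: H_def)
  ultimately show ?thesis by (simp add: sum_dg[OF assms])
qed

lemma dg_le: "dg y \<le> 2 * m" using sum_dg_le[of "{y}"] by simp

lemma n_le: "n \<le> 2 * m"
proof -
  have "n = (\<Sum>y<n. 1)" by simp
  also have "\<dots> \<le> (\<Sum>y<n. dg y)" by (intro sum_mono) (use dg_pos in auto)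
  finally show ?thesis using sum_dg_le[of "{..<n}"] by simp
qed

section \<open>Paths and layers among vertices of bounded degree\<close>

definition low_path :: "nat \<Rightarrow> nat \<Rightarrow> nat \<Rightarrow> nat list \<Rightarrow> bool" where
  "low_path u l x p \<longleftrightarrow> length p = Suc l \<and> p ! 0 = u \<and> p ! l = x \<and> distinct p \<and>
     (\<forall>i<l. {p ! i, p ! Suc i} \<in> E) \<and> (\<forall>v\<in>set p. v < n \<and> dg v \<le> dg u)"

definition pw :: "nat \<Rightarrow> nat list \<Rightarrow> real" where
  "pw l p = (\<Sum>i<l. w {p ! i, p ! Suc i})"

lemma low_path_snoc:
  assumes "low_path u l (S h) p" "h \<in> H" "dg (T h) \<le> dg u" "T h \<notin> set p"
  shows "low_path u (Suc l) (T h) (p @ [T h])" "pw (Suc l) (p @ [T h]) = pw l p + w {S h, T h}"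
  using assms half_edge[OF assms(2)] ends[OF assms(2)] unfolding low_path_def pw_def
  by (auto simp: nth_append less_Suc_eq intro!: sum.cong)

text \<open>The last edge is returned as a half-edge because that is the unit in which layers are
  scanned.\<close>

lemma low_path_SucE:
  assumes "low_path u (Suc l) x q"
  obtains h p where "h \<in> H" "T h = x" "q = p @ [x]" "low_path u l (S h) p" "dg x \<le> dg u" "x \<notin> set p"
proof -
  from assms have "q \<noteq> []" unfolding low_path_def by auto
  with assms have "last q = x" unfolding low_path_def by (simp add: last_conv_nth)
  with \<open>q \<noteq> []\<close> obtain p where q: "q = p @ [x]" by (metis append_butlast_last_id)
  with assms have p: "low_path u l (p ! l) p" "{p ! l, x} \<in> E" "dg x \<le> dg u" "x \<notin> set p"
    unfolding low_path_def by (auto simp: nth_append less_Suc_eq split: if_splits)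
  obtain h where "h \<in> H" "S h = p ! l" "T h = x" using edgeE[OF p(2)] .
  with that p q show thesis by auto
qed

text \<open>Endpoints of walks, not of paths: a layer may contain vertices to which no
  \<open>low_path\<close> of that length leads, even \<open>u\<close> again. Layers can thus be
  computed by a plain search, and the counting below holds for walks as well.\<close>

primrec Lset :: "nat \<Rightarrow> nat \<Rightarrow> nat set" where
  "Lset u 0 = {u}"
| "Lset u (Suc l) = T ` {h \<in> H. S h \<in> Lset u l \<and> dg (T h) \<le> dg u}"

lemma Lset_bounds: assumes "u < n" "x \<in> Lset u l" shows "x < n" "dg x \<le> dg u"
  using assms by (cases l; auto simp: ends)+

lemma finite_Lset[simp]: "finite (Lset u l)"
  by (cases l) auto

lemma low_path_Lset: "low_path u l x p \<Longrightarrow> x \<in> Lset u l"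
proof (induction l arbitrary: x p)
  case (Suc l)
  obtain h q where "h \<in> H" "T h = x" "p = q @ [x]" "low_path u l (S h) q" "dg x \<le> dg u"
    by (rule low_path_SucE[OF Suc.prems])
  with Suc.IH[of "S h" q] show ?case by auto
qed (auto simp: low_path_def)

definition cost where "cost r u = min (2 * m) (dg u ^ r)"

text \<open>All vertices of a layer have degree at most \<open>dg u\<close>, so layer
  \<open>l\<close> has at most \<open>dg u ^ l\<close> vertices and \<open>dg u ^ Suc l\<close>
  outgoing half-edges; \<open>l < r\<close> and the positive degree raise the exponent to
  \<open>r\<close>.\<close>

lemma card_edges_Lset:
  assumes "u < n" "l < r"
  shows "(\<Sum>y\<in>Lset u l. dg y) \<le> cost r u"
proof -
  have card: "card (Lset u l) \<le> dg u ^ l" for l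
  proof (induction l)
    case (Suc l)
    have "card (Lset u (Suc l)) \<le> card {h \<in> H. S h \<in> Lset u l}"
      by (auto intro!: surj_card_le)
    also have "\<dots> = (\<Sum>y\<in>Lset u l. dg y)" by (simp add: sum_dg)
    also have "\<dots> \<le> (\<Sum>y\<in>Lset u l. dg u)" by (intro sum_mono) (use Lset_bounds assms in auto)
    also have "\<dots> \<le> dg u ^ l * dg u" using Suc by simp
    finally show ?case by (simp add: mult.commute)
  qed simp
  have "(\<Sum>y\<in>Lset u l. dg y) \<le> (\<Sum>y\<in>Lset u l. dg u)" by (intro sum_mono) (use Lset_bounds assms in
      auto)
  also have "\<dots> \<le> dg u ^ Suc l" using card[of l] by simp
  also have "\<dots> \<le> dg u ^ r" using assms dg_pos[of u] by (intro power_increasing) auto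
  finally show ?thesis using sum_dg_le[of "Lset u l"] by (simp add: cost_def)
qed

lemma card_Lset:
  assumes "u < n" "l < r"
  shows "card (Lset u l) \<le> cost r u"
proof -
  have "card (Lset u l) = (\<Sum>y\<in>Lset u l. 1)" by simp
  also have "\<dots> \<le> (\<Sum>y\<in>Lset u l. dg y)" by (intro sum_mono) (use Lset_bounds assms dg_pos in auto)
  finally show ?thesis using card_edges_Lset[OF assms] by simp
qed

text \<open>The last layer \<open>r\<close> is listed but never scanned, so its size is charged to
  the half-edges leaving layer \<open>r - 1\<close>.\<close>

lemma card_Lset_Suc:
  assumes "u < n" "l < r"
  shows "card (Lset u (Suc l)) \<le> cost r u"
proof -
  have "card (Lset u (Suc l)) \<le> card {h \<in> H. S h \<in> Lset u l}"
    by (auto intro!: surj_card_le)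
  then show ?thesis using card_edges_Lset[OF assms] by (simp add: sum_dg)
qed

lemma cost_pos: assumes "u < n" shows "1 \<le> cost r u"
  using dg_pos[OF assms] dg_le[of u] by (auto simp: cost_def)

text \<open>Summing the degrees contributes another factor \<open>2 * m\<close>, which turns the
  exponent \<open>1 - 1 / r\<close> into \<open>2 - 1 / r\<close>; the constant 4 bounds 2 to that
  power.\<close>

lemma sum_cost:
  assumes "r > 0"
  shows "real (\<Sum>u<n. cost r u) \<le> 4 * real m powr (2 - 1 / real r)"
proof (cases "m = 0")
  case True
  then show ?thesis using n_le by simp
next
  case False
  define M where "M = real (2 * m)"
  have M: "M \<ge> 1" using False by (simp add: M_def)
  have one: "real (cost r u) \<le> M powr (1 - 1 / r) * real (dg u)" if u: "u < n" for u
  proof -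
    define c where "c = real (cost r u)"
    have c1: "c \<ge> 1" using cost_pos[OF u, of r] unfolding c_def by simp
    have cM: "c \<le> M" unfolding c_def M_def cost_def by simp
    have cd: "c \<le> real (dg u) ^ r" unfolding c_def cost_def by (metis min.cobounded2 of_nat_le_iff
        of_nat_power)
    have d1: "real (dg u) \<ge> 1" using dg_pos[OF u] by simp
    \<comment> \<open>A weighted geometric mean of \<open>c\<close> with itself: the first factor is
      bounded by \<open>c \<le> M\<close>, the second by \<open>c \<le> dg u ^ r\<close>.\<close>
    have "c = c powr (1 - 1 / r) * c powr (1 / r)"
      using c1 by (simp add: powr_add[symmetric])
    also have "\<dots> \<le> M powr (1 - 1 / r) * (real (dg u) ^ r) powr (1 / r)"
      using c1 cM cd assms by (intro mult_mono powr_mono2) auto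
    also have "(real (dg u) ^ r) powr (1 / r) = real (dg u)"
      using d1 assms by (simp add: powr_realpow[symmetric] powr_powr)
    finally show ?thesis unfolding c_def .
  qed
  have "real (\<Sum>u<n. cost r u) \<le> (\<Sum>u<n. M powr (1 - 1 / r) * real (dg u))"
    unfolding of_nat_sum by (intro sum_mono) (use one in auto)
  also have "\<dots> = M powr (1 - 1 / r) * real (\<Sum>u<n. dg u)" by (simp add: sum_distrib_left)
  also have "\<dots> \<le> M powr (1 - 1 / r) * M"
    using sum_dg_le[of "{..<n}"] by (intro mult_left_mono) (auto simp: M_def simp del: of_nat_sum)
  also have "\<dots> = M powr (1 - 1 / r) * M powr 1" using M by simp
  also have "\<dots> = M powr (2 - 1 / r)" unfolding powr_add[symmetric] by simp
  also have "\<dots> = 2 powr (2 - 1 / r) * real m powr (2 - 1 / r)"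
    unfolding M_def by (simp add: powr_mult)
  also have "\<dots> \<le> 2 powr 2 * real m powr (2 - 1 / r)"
    by (intro mult_right_mono powr_mono) auto
  finally show ?thesis by simp
qed

text \<open>\<open>p\<close> is read forwards from \<open>u\<close> to the meeting vertex, then
  \<open>q\<close> backwards towards \<open>u\<close>; the common endpoints are taken from
  \<open>p\<close>.\<close>

definition cyc :: "nat \<Rightarrow> nat list \<Rightarrow> nat list \<Rightarrow> nat list" where
  "cyc r p q = map (\<lambda>i. if i \<le> r then p ! i else q ! (k - i)) [0..<k]"

definition inner_disjoint :: "nat \<Rightarrow> nat list \<Rightarrow> nat list \<Rightarrow> bool" where
  "inner_disjoint r p q \<longleftrightarrow> (\<forall>i\<in>{1..<r}. \<forall>j\<in>{1..<k - r}. p ! i \<noteq> q ! j)"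

lemma cyc_cycle:
  assumes p: "low_path u r x p" and q: "low_path u (k - r) x q" and d: "inner_disjoint r p q"
    and r: "0 < r" "r < k"
  shows "is_cycle E k (cyc r p q)"
    and "weight w (cycle_edges (cyc r p q)) = pw r p + pw (k - r) q"
proof -
  let ?c = "cyc r p q"
  have lp: "length p = Suc r" and lq: "length q = Suc (k - r)" using p q by (auto simp:
      low_path_def)
  have c1: "?c ! i = p ! i" if "i \<le> r" for i using that r by (simp add: cyc_def)
  \<comment> \<open>Reducing \<open>i\<close> modulo \<open>k\<close> covers \<open>i = k\<close>,
    where the backward walk on \<open>q\<close> closes up at \<open>u\<close>.\<close>
  have c2: "?c ! (i mod k) = q ! (k - i)" if "r \<le> i" "i \<le> k" for i
    using that r p q by (cases "i = k"; cases "i = r") (auto simp: cyc_def low_path_def)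
  have pe: "p ! i = p ! j \<longleftrightarrow> i = j" if "i \<le> r" "j \<le> r" for i j
    using that p lp by (auto simp: low_path_def nth_eq_iff_index_eq)
  have qe: "q ! i = q ! j \<longleftrightarrow> i = j" if "i \<le> k - r" "j \<le> k - r" for i j
    using that q lq by (auto simp: low_path_def nth_eq_iff_index_eq)
  have pq: "p ! 0 = q ! 0" "p ! r = q ! (k - r)" using p q by (auto simp: low_path_def)
  \<comment> \<open>The endpoints of \<open>p\<close> are those of \<open>q\<close> and differ from
    its inner vertices because \<open>q\<close> is distinct; inner vertices of \<open>p\<close> are
    handled by \<open>d\<close>.\<close>
  have pq_ne: "p ! i \<noteq> q ! j" if "i \<le> r" "0 < j" "j < k - r" for i j
  proof (cases "i = 0 \<or> i = r")
    case True
    then show ?thesis using that pq qe[of 0 j] qe[of "k - r" j] r by auto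
  next
    case False
    then show ?thesis using that d by (auto simp: inner_disjoint_def)
  qed
  have "distinct ?c"
  proof -
    have "inj_on (\<lambda>i. if i \<le> r then p ! i else q ! (k - i)) {0..<k}"
    proof (rule linorder_inj_onI')
      fix i j assume "i \<in> {0..<k}" "j \<in> {0..<k}" "i < j"
      then show "(if i \<le> r then p ! i else q ! (k - i)) \<noteq> (if j \<le> r then p ! j else q ! (k - j))"
        using pe[of i j] qe[of "k - i" "k - j"] pq_ne[of i "k - j"] by auto
    qed
    then show ?thesis by (simp add: cyc_def distinct_map)
  qed
  moreover have E1: "{?c ! i, ?c ! (Suc i mod k)} = {p ! i, p ! Suc i}" if "i < r" for i
  proof -
    have "Suc i mod k = Suc i" using that r by simp
    then show ?thesis using c1[of i] c1[of "Suc i"] that by simp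
  qed
  moreover have E2: "{?c ! i, ?c ! (Suc i mod k)} = {q ! (k - Suc i), q ! Suc (k - Suc i)}"
    if "r \<le> i" "i < k" for i
    using that c2[of i] c2[of "Suc i"] by (auto simp: Suc_diff_Suc insert_commute)
  moreover have "{?c ! i, ?c ! (Suc i mod k)} \<in> E" if "i < k" for i
  proof (cases "i < r")
    case True
    then show ?thesis using E1 p by (simp add: low_path_def)
  next
    case False
    then show ?thesis using E2[of i] q that by (simp add: low_path_def)
  qed
  ultimately show c: "is_cycle E k ?c" unfolding is_cycle_iff by (simp add: cyc_def)
  have "weight w (cycle_edges ?c) = (\<Sum>i<k. w {?c ! i, ?c ! (Suc i mod k)})"
    by (rule weight_cycle[OF c k3])
  also have "\<dots> = (\<Sum>i<r. w {?c ! i, ?c ! (Suc i mod k)}) + (\<Sum>i=r..<k. w {?c ! i, ?c ! (Suc i mod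
      k)})"
    using r by (subst sum.union_disjoint[symmetric]) (auto intro!: sum.cong)
  also have "(\<Sum>i<r. w {?c ! i, ?c ! (Suc i mod k)}) = pw r p"
    unfolding pw_def by (intro sum.cong) (simp_all add: E1)
  also have "(\<Sum>i=r..<k. w {?c ! i, ?c ! (Suc i mod k)}) = pw (k - r) q"
    unfolding pw_def
    by (rule sum.reindex_bij_witness[where i = "\<lambda>i. k - Suc i" and j = "\<lambda>i. k - Suc i"])
      (use E2 in auto)
  finally show "weight w (cycle_edges ?c) = pw r p + pw (k - r) q" .
qed

text \<open>Converse of \<open>cyc_cycle\<close>: cut at positions 0 and \<open>r\<close>. As
  \<open>u\<close> has the largest degree on the cycle, both halves obey the degree bound.\<close>

lemma cycle_split:
  assumes c: "is_cycle E k vs" "vs ! 0 = u" "\<forall>v\<in>set vs. dg v \<le> dg u" and r: "0 < r" "r < k"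
  obtains x p q where "low_path u r x p" "low_path u (k - r) x q" "inner_disjoint r p q"
    "weight w (cycle_edges vs) = pw r p + pw (k - r) q"
proof -
  define p where "p = map (\<lambda>i. vs ! i) [0..<Suc r]"
  \<comment> \<open>Backwards from \<open>u\<close>, entry \<open>i\<close> is at position
    \<open>k - i\<close>; for \<open>i = 0\<close> this wraps around to 0.\<close>
  define q where "q = map (\<lambda>i. vs ! ((k - i) mod k)) [0..<Suc (k - r)]"
  have len: "length vs = k" and dist: "distinct vs"
    and edge: "\<And>i. i < k \<Longrightarrow> {vs ! i, vs ! (Suc i mod k)} \<in> E"
    using c(1) by (auto simp: is_cycle_iff)
  have vs: "v < n" "dg v \<le> dg u" if v: "v \<in> set vs" for v
  proof -
    obtain i where "i < k" "v = vs ! i" using v len by (auto simp: in_set_conv_nth)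
    then obtain a b where "a < n" "b < n" "{v, vs ! (Suc i mod k)} = {a, b}"
      using edge[of i] graph(1) unfolding simple_graph_def by blast
    then show "v < n" by (auto simp: doubleton_eq_iff)
    show "dg v \<le> dg u" using c v by auto
  qed
  have pn: "p ! i = vs ! i" if "i \<le> r" for i
    using that by (simp add: p_def nth_append del: upt_Suc)
  have p: "low_path u r (vs ! r) p"
    unfolding low_path_def
  proof (intro conjI allI ballI impI)
    show "distinct p" using r dist len
      by (auto simp: p_def distinct_map inj_on_def nth_eq_iff_index_eq simp del: upt_Suc)
    show "{p ! i, p ! Suc i} \<in> E" if "i < r" for i
      using edge[of i] that r by (simp add: pn)
    show "v < n" "dg v \<le> dg u" if "v \<in> set p" for v
      using that r len by (auto simp: p_def simp del: upt_Suc intro!: vs)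
  qed (use c in \<open>simp_all add: pn, simp add: p_def\<close>)
  have qn: "q ! i = vs ! ((k - i) mod k)" if "i \<le> k - r" for i
    using that by (simp add: q_def nth_append del: upt_Suc)
  have q: "low_path u (k - r) (vs ! r) q"
    unfolding low_path_def
  proof (intro conjI allI ballI impI)
    show "q ! 0 = u" using qn[of 0] c by simp
    show "q ! (k - r) = vs ! r" using qn[of "k - r"] r by simp
    have "inj_on (\<lambda>i. vs ! ((k - i) mod k)) {0..<Suc (k - r)}"
    proof (rule linorder_inj_onI')
      fix i j assume "i \<in> {0..<Suc (k - r)}" "j \<in> {0..<Suc (k - r)}" "i < j"
      then show "vs ! ((k - i) mod k) \<noteq> vs ! ((k - j) mod k)"
        using r dist len by (cases i) (simp_all add: nth_eq_iff_index_eq)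
    qed
    then show "distinct q" by (simp add: q_def distinct_map del: upt_Suc)
    show "{q ! i, q ! Suc i} \<in> E" if "i < k - r" for i
    proof -
      have "Suc (k - Suc i) = k - i" "(k - Suc i) mod k = k - Suc i" using that r by auto
      then show ?thesis using qn[of i] qn[of "Suc i"] that edge[of "k - Suc i"] r
        by (simp add: insert_commute)
    qed
    show "v < n" "dg v \<le> dg u" if "v \<in> set q" for v
      using that r len by (auto simp: q_def simp del: upt_Suc intro!: vs nth_mem mod_less_divisor)
  qed (simp add: q_def)
  have d: "inner_disjoint r p q"
    unfolding inner_disjoint_def
  proof (intro ballI)
    fix i j assume ij: "i \<in> {1..<r}" "j \<in> {1..<k - r}"
    then have "q ! j = vs ! (k - j)" "p ! i = vs ! i" using qn[of j] pn[of i] by auto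
    moreover have "i \<noteq> k - j" "i < k" "k - j < k" using ij r by auto
    ultimately show "p ! i \<noteq> q ! j" using dist len by (simp add: nth_eq_iff_index_eq)
  qed
  have "cyc r p q = vs"
  proof (rule nth_equalityI)
    fix i assume "i < length (cyc r p q)"
    then have i: "i < k" by (simp add: cyc_def)
    then have "k - (k - i) = i" "i mod k = i" by auto
    then show "cyc r p q ! i = vs ! i"
      using qn[of "k - i"] pn[of i] r i by (cases "i \<le> r") (simp_all add: cyc_def)
  qed (simp add: cyc_def len)
  with that[OF p q d] cyc_cycle(2)[OF p q d r] show thesis by simp
qed

end

section \<open>Extending paths by one edge\<close>

lemmas set_defs = set_wreg_def set_warr_def set_rreg_def set_rarr_def

lemma agreeD:
  "agree X s s' \<Longrightarrow> WR a \<in> X \<Longrightarrow> wreg s' a = wreg s a"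
  "agree X s s' \<Longrightarrow> WA a \<in> X \<Longrightarrow> warr s' a = warr s a"
  "agree X s s' \<Longrightarrow> RR a \<in> X \<Longrightarrow> rreg s' a = rreg s a"
  "agree X s s' \<Longrightarrow> RA a \<in> X \<Longrightarrow> rarr s' a = rarr s a"
  by (auto simp: agree_def)

lemma hoare_Seq_loopfree:
  assumes "loopfree p" "hoare W q (sem W p s) B Q"
  shows "hoare W (Seq p q) s (csize p + B + 1) Q"
  by (rule hoare_Seq[OF hoare_loopfree[where Q = "\<lambda>s'. s' = sem W p s" and B = "csize p"]])
    (use assms in auto)

text \<open>
  Word registers: 2 holds the constant 1, 3 the current vertex \<open>u\<close>, 4 the number \<open>u + 1\<close>, 5 the
  degree of \<open>u\<close>, 7 to 9 the half-edge being scanned (source, number, target), 12 the outcome of a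
  conjunction of tests, 15 whether a cycle has been found, \<open>20 + l\<close> the size of layer \<open>l\<close>; 14 is
  constantly 0.  Real register 3 holds the weight of the best cycle so far.  Word arrays 3 to 6
  hold the first half-edge of a vertex, the next half-edge, the target of a half-edge and the
  degree of a vertex; real array 1 holds the weights of the half-edges.  All other arrays are
  indexed by vertices or positions and named by \<open>arr\<close>; in particular the array name of a stored
  path contains its length \<open>l\<close> and its position \<open>\<tau>\<close> in the tree of the representative family.
  No array is ever cleared: an entry is valid in the pass for \<open>u\<close> iff its stamp is \<open>u + 1\<close>.
\<close>

definition arr :: "nat \<Rightarrow> nat \<Rightarrow> nat list \<Rightarrow> nat \<Rightarrow> nat" where
  "arr c l \<tau> i = 10 + to_nat (c, l, \<tau>, i)"

lemma arr_eq[simp]: "arr c l \<tau> i = arr c' l' \<tau>' i' \<longleftrightarrow> c = c' \<and> l = l' \<and> \<tau> = \<tau>' \<and> i = i'"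
  by (simp add: arr_def)

lemma arr_neq[simp]: "a < 10 \<Longrightarrow> arr c l \<tau> i \<noteq> a" "a < 10 \<Longrightarrow> a \<noteq> arr c l \<tau> i"
  by (auto simp: arr_def)

abbreviation vtx :: "nat \<Rightarrow> nat list \<Rightarrow> nat \<Rightarrow> nat" where "vtx l \<tau> i \<equiv> arr 0 l \<tau> i"
abbreviation stamp :: "nat \<Rightarrow> nat list \<Rightarrow> nat" where "stamp l \<tau> \<equiv> arr 1 l \<tau> 0"
abbreviation mark :: "nat \<Rightarrow> nat" where "mark l \<equiv> arr 2 l [] 0"
abbreviation lst :: "nat \<Rightarrow> nat" where "lst l \<equiv> arr 3 l [] 0"
text \<open>Real arrays have a name space of their own, so the tag 0 can be shared with
  \<open>vtx\<close>.\<close>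

abbreviation val :: "nat \<Rightarrow> nat list \<Rightarrow> nat" where "val l \<tau> \<equiv> arr 0 l \<tau> 0"

section \<open>Programs for scanning a layer and extending one stored path\<close>

definition scan :: "nat \<Rightarrow> com \<Rightarrow> com" where
  "scan l body = Seq (WConst 6 0) (While (WLess 6 (20 + l)) (seqs [
     WGet 7 (lst l) 6,
     WGet 8 3 7,
     While (WLess 14 8) (seqs [
       WGet 9 5 8,
       WGet 13 6 9,
       IfThenElse (WLess 5 13) Skip body,
       WGet 8 4 8]),
     WOp WAdd 6 6 2]))"

definition visit :: "nat \<Rightarrow> com" where
  "visit l = seqs [
     WGet 10 (mark (Suc l)) 9,
     IfThenElse (WEq 10 4) Skip (seqs [
       WPut (mark (Suc l)) 9 4,
       WPut (lst (Suc l)) (20 + Suc l) 9,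
       WOp WAdd (20 + Suc l) (20 + Suc l) 2])]"

text \<open>An entry is a pair of memory cells, each given by an array and an index register.
  Register 12 accumulates the conjunction without nested branching: any coincidence clears
  it.\<close>

definition neqs :: "((nat \<times> nat) \<times> (nat \<times> nat)) list \<Rightarrow> com" where
  "neqs ps = seqs (map (\<lambda>((A, i), (B, j)). seqs [
     WGet 10 A i, WGet 11 B j, IfThenElse (WEq 10 11) (WConst 12 0) Skip]) ps)"

text \<open>The first group keeps the extended path simple. The second compares it with the vertices
  chosen along the ancestors of \<open>\<tau>\<close>. These are stored at the target, hence index
  register 9, while the path being extended is stored at the source, register 7.\<close>

definition guards :: "nat \<Rightarrow> nat list \<Rightarrow> nat list \<Rightarrow> ((nat \<times> nat) \<times> (nat \<times> nat)) list" where
  "guards l \<tau> \<sigma> = map (\<lambda>i. ((vtx l \<sigma> i, 7), (5, 8))) [0..<Suc l] @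
     List.product (map (\<lambda>i. (vtx l \<sigma> i, 7)) [0..<Suc l] @ [(5, 8)])
       (map (\<lambda>j. (vtx (Suc l) (take j \<tau>) (\<tau> ! j), 9)) [0..<length \<tau>])"

definition copy :: "nat \<Rightarrow> nat list \<Rightarrow> nat list \<Rightarrow> nat \<Rightarrow> com" where
  "copy l \<tau> \<sigma> N = seqs (map (\<lambda>i. seqs [
     if i \<le> l then WGet 10 (vtx l \<sigma> i) 7 else WGet 10 5 8,
     WPut (vtx (Suc l) \<tau> i) 9 10]) [0..<N])"

text \<open>One attempt to carry the path at position \<open>\<sigma>\<close> over the current
  half-edge into position \<open>\<tau>\<close> of the next layer. Stale entries may be read on the
  way; register 12 gathers all conditions before anything is stored, which keeps the code
  loop-free.\<close>

definition upd :: "nat \<Rightarrow> nat list \<Rightarrow> nat list \<Rightarrow> com" where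
  "upd l \<tau> \<sigma> = seqs [
     WConst 12 1,
     WGet 10 (stamp l \<sigma>) 7,
     IfThenElse (WEq 10 4) Skip (WConst 12 0),
     neqs (guards l \<tau> \<sigma>),
     RGet 1 (val l \<sigma>) 7,
     RGet 2 1 8,
     RAdd 1 1 2,
     WGet 10 (stamp (Suc l) \<tau>) 9,
     IfThenElse (WEq 10 4)
       (Seq (RGet 2 (val (Suc l) \<tau>) 9) (IfThenElse (RLess 2 1) Skip (WConst 12 0))) Skip,
     IfThenElse (WEq 12 2)
       (seqs [copy l \<tau> \<sigma> (Suc (Suc l)), WPut (stamp (Suc l) \<tau>) 9 4, RPut (val (Suc l) \<tau>) 9 1])
       Skip]"

lemma loopfree_upd[simp]: "loopfree (upd l \<tau> \<sigma>)"
  by (auto simp: upd_def neqs_def copy_def)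

lemma deterministic_upd[simp]: "deterministic (upd l \<tau> \<sigma>)"
  by (auto simp: upd_def neqs_def copy_def)

lemma loopfree_visit[simp]: "loopfree (visit l)"
  by (auto simp: visit_def)

lemma deterministic_visit[simp]: "deterministic (visit l)"
  by (auto simp: visit_def)

lemma mods_neqs: "mods (neqs ps) \<subseteq> {WR 10, WR 11, WR 12}"
  by (auto simp: neqs_def)

lemma mods_copy: "mods (copy l \<tau> \<sigma> N) \<subseteq> insert (WR 10) (WA ` range (vtx (Suc l) \<tau>))"
  by (auto simp: copy_def split: if_splits)

lemma mods_upd: "mods (upd l \<tau> \<sigma>) \<subseteq> {WR 10, WR 11, WR 12, RR 1, RR 2, WA (stamp (Suc l) \<tau>),
    RA (val (Suc l) \<tau>)} \<union> WA ` range (vtx (Suc l) \<tau>)"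
  using mods_neqs[of "guards l \<tau> \<sigma>"] mods_copy[of l \<tau> \<sigma> "Suc (Suc l)"]
  unfolding upd_def by auto

lemma mods_visit: "mods (visit l) = {WR 10, WA (mark (Suc l)), WA (lst (Suc l)), WR (20 + Suc l)}"
  by (auto simp: visit_def)

text \<open>The side condition protects the index registers: 10 and 11 are scratch, 12 is the
  flag.\<close>

lemma sem_neqs:
  assumes "\<forall>((A, i), (B, j))\<in>set ps. i \<notin> {10, 11, 12} \<and> j \<notin> {10, 11, 12}"
  shows "wreg (sem W (neqs ps) s) 12 =
    (if \<exists>((A, i), (B, j))\<in>set ps. warr s A (wreg s i) = warr s B (wreg s j) then 0 else wreg s 12)"
  using assms
proof (induction ps arbitrary: s)
  case (Cons a ps)
  obtain A i B j where a: "a = ((A, i), (B, j))" by (metis surj_pair)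
  define s1 where "s1 = sem W (seqs [WGet 10 A i, WGet 11 B j, IfThenElse (WEq 10 11) (WConst 12
      0) Skip]) s"
  have eq: "sem W (neqs (a # ps)) s = sem W (neqs ps) s1"
    by (simp add: neqs_def a s1_def)
  have s1: "warr s1 = warr s" "\<And>b. b \<notin> {10, 11, 12} \<Longrightarrow> wreg s1 b = wreg s b"
    "wreg s1 12 = (if warr s A (wreg s i) = warr s B (wreg s j) then 0 else wreg s 12)"
    using Cons.prems a by (auto simp: s1_def set_defs)
  have "(case p of ((A, i), (B, j)) \<Rightarrow> warr s1 A (wreg s1 i) = warr s1 B (wreg s1 j)) =
      (case p of ((A, i), (B, j)) \<Rightarrow> warr s A (wreg s i) = warr s B (wreg s j))"
    if "p \<in> set ps" for p
    using Cons.prems that s1(1,2) by (cases p) fastforce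
  then show ?case
    unfolding eq using Cons.IH[of s1] Cons.prems s1(3) by (auto simp: a)
qed (simp add: neqs_def)

lemma sem_copy:
  assumes "i < N"
  shows "warr (sem W (copy l \<tau> \<sigma> N) s) (vtx (Suc l) \<tau> i) =
    (warr s (vtx (Suc l) \<tau> i))(wreg s 9 :=
       if i \<le> l then warr s (vtx l \<sigma> i) (wreg s 7) else warr s 5 (wreg s 8))"
  using assms
proof (induction N)
  case (Suc N)
  define s1 where "s1 = sem W (copy l \<tau> \<sigma> N) s"
  have "loopfree (copy l \<tau> \<sigma> N)" by (simp add: copy_def)
  from sem_frame[OF this, of s W]
  have s1: "agree (- mods (copy l \<tau> \<sigma> N)) s s1" unfolding s1_def .
  have wreg: "wreg s1 a = wreg s a" if "a \<noteq> 10" for a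
    using agreeD(1)[OF s1] mods_copy[of l \<tau> \<sigma> N] that by auto
  have warr: "warr s1 A = warr s A" if "A \<notin> range (vtx (Suc l) \<tau>)" for A
    using agreeD(2)[OF s1] mods_copy[of l \<tau> \<sigma> N] that by auto
  have N: "warr s1 (vtx (Suc l) \<tau> N) = warr s (vtx (Suc l) \<tau> N)"
    by (rule agreeD(2)[OF s1]) (auto simp: copy_def)
  have eq: "sem W (copy l \<tau> \<sigma> (Suc N)) s = sem W (seqs [
     if N \<le> l then WGet 10 (vtx l \<sigma> N) 7 else WGet 10 5 8,
     WPut (vtx (Suc l) \<tau> N) 9 10]) s1"
    by (simp add: copy_def s1_def)
  show ?case
  proof (cases "i = N")
    case True
    then show ?thesis unfolding eq using wreg warr N by (auto simp: set_defs image_iff)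
  next
    case False
    then show ?thesis using Suc unfolding eq s1_def[symmetric] by (simp add: set_defs)
  qed
qed simp

section \<open>Stored paths as a partial function of position and vertex\<close>

definition cell :: "nat \<Rightarrow> nat \<Rightarrow> nat list \<Rightarrow> nat \<Rightarrow> ram_state \<Rightarrow> (nat list \<times> real) option" where
  "cell su l \<tau> x s = (if warr s (stamp l \<tau>) x = su
     then Some (map (\<lambda>i. warr s (vtx l \<tau> i) x) [0..<Suc l], rarr s (val l \<tau>) x) else None)"

text \<open>The set \<open>av\<close> of \<open>tree_representative\<close>, read off the arrays. If
  an ancestor is empty at \<open>x\<close>, its entries are stale and this set is arbitrary; that is
  harmless, as the descent in the tree passes through filled positions only.\<close>

definition avoid :: "nat \<Rightarrow> nat list \<Rightarrow> nat \<Rightarrow> ram_state \<Rightarrow> nat set" where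
  "avoid l \<tau> x s = (\<lambda>j. warr s (vtx l (take j \<tau>) (\<tau> ! j)) x) ` {..<length \<tau>}"

definition extend :: "nat set \<Rightarrow> nat \<Rightarrow> real \<Rightarrow> (nat list \<times> real) option \<Rightarrow> (nat list \<times> real) option"
    where
  "extend Y x r c = (case c of None \<Rightarrow> None | Some (p, v) \<Rightarrow>
     if x \<notin> set p \<and> set (p @ [x]) \<inter> Y = {} then Some (p @ [x], v + r) else None)"

definition better :: "(nat list \<times> real) option \<Rightarrow> (nat list \<times> real) option \<Rightarrow> (nat list \<times> real)
    option" where
  "better a c = (case c of None \<Rightarrow> a | Some c' \<Rightarrow>
     (case a of None \<Rightarrow> c | Some a' \<Rightarrow> if snd a' < snd c' then c else a))"

text \<open>A running maximum: each \<open>upd\<close> adds at most one candidate.\<close>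

lemma ismax_better:
  "ismax C a \<Longrightarrow> ismax (C \<union> set_option c) (better a c)"
  unfolding ismax_def better_def by (auto split: option.splits)

text \<open>Specification of the code in terms of cells, after which the arrays need not be looked
  at again. The last claim is what later keeps every stamp at most \<open>u + 1\<close>.\<close>

lemma sem_upd:
  fixes s W l \<tau> \<sigma>
  defines "s' \<equiv> sem W (upd l \<tau> \<sigma>) s" and "x \<equiv> wreg s 9" and "su \<equiv> wreg s 4"
  assumes W: "1 < W" and one: "wreg s 2 = 1" and tgt: "warr s 5 (wreg s 8) = wreg s 9"
  shows "cell su (Suc l) \<tau> x s' = better (cell su (Suc l) \<tau> x s)
      (extend (avoid (Suc l) \<tau> x s) x (rarr s 1 (wreg s 8)) (cell su l \<sigma> (wreg s 7) s))"
    and "z \<noteq> x \<Longrightarrow> cell su (Suc l) \<tau> z s' = cell su (Suc l) \<tau> z s"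
    and "warr s' (stamp (Suc l) \<tau>) z \<in> {warr s (stamp (Suc l) \<tau>) z, su}"
proof -
  define y where "y = wreg s 7"
  define h where "h = wreg s 8"
  define s1 where "s1 = sem W (seqs [
     WConst 12 1,
     WGet 10 (stamp l \<sigma>) 7,
     IfThenElse (WEq 10 4) Skip (WConst 12 0)]) s"
  define s2 where "s2 = sem W (neqs (guards l \<tau> \<sigma>)) s1"
  define s3 where "s3 = sem W (seqs [
     RGet 1 (val l \<sigma>) 7,
     RGet 2 1 8,
     RAdd 1 1 2,
     WGet 10 (stamp (Suc l) \<tau>) 9,
     IfThenElse (WEq 10 4)
       (Seq (RGet 2 (val (Suc l) \<tau>) 9) (IfThenElse (RLess 2 1) Skip (WConst 12 0))) Skip]) s2"
  have s': "s' = sem W (IfThenElse (WEq 12 2)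
       (seqs [copy l \<tau> \<sigma> (Suc (Suc l)), WPut (stamp (Suc l) \<tau>) 9 4, RPut (val (Suc l) \<tau>) 9 1])
       Skip) s3"
    by (simp add: s'_def upd_def s3_def s2_def s1_def)
  \<comment> \<open>Failure of the condition in \<open>extend\<close>, read off the arrays: the
    target repeats a vertex of the path, or the extended path meets \<open>avoid\<close>.\<close>
  define bad where "bad = (x \<in> (\<lambda>i. warr s (vtx l \<sigma> i) y) ` {..<Suc l} \<or>
     (insert x ((\<lambda>i. warr s (vtx l \<sigma> i) y) ` {..<Suc l})) \<inter> avoid (Suc l) \<tau> x s \<noteq> {})"
  have s1: "warr s1 = warr s" "rarr s1 = rarr s" "rreg s1 = rreg s"
    "\<And>a. a \<notin> {10, 12} \<Longrightarrow> wreg s1 a = wreg s a"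
    "wreg s1 12 = (if warr s (stamp l \<sigma>) y = su then 1 else 0)"
    using W by (auto simp: s1_def set_defs y_def su_def)
  have "loopfree (neqs (guards l \<tau> \<sigma>))" by (auto simp: neqs_def)
  then have fr2: "agree (- {WR 10, WR 11, WR 12}) s1 s2"
    unfolding s2_def using mods_neqs by (intro agree_mono[OF sem_frame]) auto
  have set_guards: "set (guards l \<tau> \<sigma>) = (\<lambda>i. ((vtx l \<sigma> i, 7), (5, 8))) ` {..<Suc l} \<union>
      insert (5, 8) ((\<lambda>i. (vtx l \<sigma> i, 7)) ` {..<Suc l}) \<times>
        (\<lambda>j. (vtx (Suc l) (take j \<tau>) (\<tau> ! j), 9)) ` {..<length \<tau>}"
    unfolding guards_def by (simp add: lessThan_atLeast0 del: upt_Suc)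
  have bex_prod: "(\<exists>((a, i), (b, j))\<in>A \<times> B. P a i b j) \<longleftrightarrow> (\<exists>(a, i)\<in>A. \<exists>(b, j)\<in>B. P a i b j)"
    for A B :: "(nat \<times> nat) set" and P
    by fastforce
  have Int_ne: "A \<inter> B \<noteq> {} \<longleftrightarrow> (\<exists>a\<in>A. \<exists>b\<in>B. a = b)" for A B :: "nat set"
    by auto
  have mem: "x \<in> f ` B \<longleftrightarrow> (\<exists>b\<in>B. f b = x)" for f :: "nat \<Rightarrow> nat" and B
    by auto
  have "(\<exists>((A, i), (B, j))\<in>set (guards l \<tau> \<sigma>). warr s1 A (wreg s1 i) = warr s1 B (wreg s1 j)) \<longleftrightarrow> bad"
    unfolding bad_def avoid_def set_guards bex_Un bex_prod Int_ne mem
    using tgt by (simp add: s1 y_def x_def image_iff)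
  moreover have "\<forall>((A, i), (B, j))\<in>set (guards l \<tau> \<sigma>). i \<notin> {10, 11, 12} \<and> j \<notin> {10, 11, 12}"
    unfolding guards_def by auto
  ultimately have s2: "wreg s2 12 = (if warr s (stamp l \<sigma>) y = su \<and> \<not> bad then 1 else 0)"
    unfolding s2_def by (subst sem_neqs) (simp_all add: s1)
  have s2': "warr s2 = warr s" "rarr s2 = rarr s" "\<And>a. a \<notin> {10, 11, 12} \<Longrightarrow> wreg s2 a = wreg s a"
    using agreeD[OF fr2] s1 by auto
  define v where "v = rarr s (val l \<sigma>) y + rarr s 1 h"
  \<comment> \<open>A valid occupant must be beaten strictly, matching the tie rule of
    \<open>better\<close>.\<close>
  define good where "good = (warr s (stamp l \<sigma>) y = su \<and> \<not> bad \<and>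
     (warr s (stamp (Suc l) \<tau>) x = su \<longrightarrow> rarr s (val (Suc l) \<tau>) x < v))"
  have s3: "warr s3 = warr s" "rarr s3 = rarr s" "\<And>a. a \<notin> {10, 11, 12} \<Longrightarrow> wreg s3 a = wreg s a"
    "rreg s3 1 = v" "wreg s3 12 = (if good then 1 else 0)"
    using s2 s2' by (auto simp: s3_def set_defs v_def good_def su_def x_def y_def h_def)
  define s4 where "s4 = sem W (copy l \<tau> \<sigma> (Suc (Suc l))) s3"
  have lf4: "loopfree (copy l \<tau> \<sigma> (Suc (Suc l)))" by (simp add: copy_def)
  have fr4: "agree (- insert (WR 10) (WA ` range (vtx (Suc l) \<tau>))) s3 s4"
    unfolding s4_def using mods_copy by (intro agree_mono[OF sem_frame[OF lf4]]) auto
  have s4: "warr s4 (stamp (Suc l) \<tau>) = warr s (stamp (Suc l) \<tau>)" "rarr s4 = rarr s"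
    "\<And>a. a \<notin> {10, 11, 12} \<Longrightarrow> wreg s4 a = wreg s a" "rreg s4 1 = v"
    using agreeD[OF fr4] s3 by (auto simp: image_iff)
  have s4v: "warr s4 (vtx (Suc l) \<tau> i) = (warr s (vtx (Suc l) \<tau> i))(x :=
       if i \<le> l then warr s (vtx l \<sigma> i) y else x)" if "i < Suc (Suc l)" for i
    unfolding s4_def using that tgt by (subst sem_copy) (simp_all add: s3 x_def y_def)
  have ext: "extend (avoid (Suc l) \<tau> x s) x (rarr s 1 h) (cell su l \<sigma> y s) =
      (if warr s (stamp l \<sigma>) y = su \<and> \<not> bad
       then Some (map (\<lambda>i. warr s (vtx l \<sigma> i) y) [0..<Suc l] @ [x], v) else None)"
    unfolding extend_def cell_def bad_def v_def
    by (simp add: lessThan_atLeast0 del: upt_Suc)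
  show *: "z \<noteq> x \<Longrightarrow> cell su (Suc l) \<tau> z s' = cell su (Suc l) \<tau> z s" for z
    unfolding s' cell_def using s3 s4 s4v one
    by (auto simp: s4_def[symmetric] set_defs x_def)
  show "warr s' (stamp (Suc l) \<tau>) z \<in> {warr s (stamp (Suc l) \<tau>) z, su}"
    unfolding s' using s3 s4 one by (auto simp: s4_def[symmetric] set_defs su_def)
  show "cell su (Suc l) \<tau> x s' = better (cell su (Suc l) \<tau> x s)
      (extend (avoid (Suc l) \<tau> x s) x (rarr s 1 (wreg s 8)) (cell su l \<sigma> (wreg s 7) s))"
  proof (cases good)
    case False
    then have "s' = s3" unfolding s' using s3 one by auto
    then have "cell su (Suc l) \<tau> x s' = cell su (Suc l) \<tau> x s" by (simp add: cell_def s3)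
    moreover have "better (cell su (Suc l) \<tau> x s)
      (extend (avoid (Suc l) \<tau> x s) x (rarr s 1 h) (cell su l \<sigma> y s)) = cell su (Suc l) \<tau> x s"
      unfolding ext better_def using False by (auto simp: good_def cell_def)
    ultimately show ?thesis by (simp add: h_def y_def)
  next
    case True
    have "map (\<lambda>i. warr s4 (vtx (Suc l) \<tau> i) x) [0..<Suc (Suc l)] =
        map (\<lambda>i. warr s (vtx l \<sigma> i) y) [0..<Suc l] @ [x]"
      by (rule nth_equalityI) (auto simp: s4v nth_append less_Suc_eq_le simp del: upt_Suc)
    then have "cell su (Suc l) \<tau> x s' = Some (map (\<lambda>i. warr s (vtx l \<sigma> i) y) [0..<Suc l] @ [x], v)"
      unfolding s' cell_def using True s3 s4 one
      by (simp add: s4_def[symmetric] set_defs x_def su_def del: upt_Suc)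
    moreover have "better (cell su (Suc l) \<tau> x s)
      (extend (avoid (Suc l) \<tau> x s) x (rarr s 1 h) (cell su l \<sigma> y s)) =
        Some (map (\<lambda>i. warr s (vtx l \<sigma> i) y) [0..<Suc l] @ [x], v)"
      unfolding ext better_def using True by (auto simp: good_def cell_def simp del: upt_Suc)
    ultimately show ?thesis by (simp add: h_def y_def)
  qed
qed

section \<open>Linked incidence lists and the scan of a layer\<close>

primrec chain :: "(nat \<Rightarrow> nat) \<Rightarrow> nat \<Rightarrow> nat list \<Rightarrow> bool" where
  "chain nx h [] \<longleftrightarrow> h = 0"
| "chain nx h (z # zs) \<longleftrightarrow> h = z \<and> z \<noteq> 0 \<and> chain nx (nx z) zs"

definition static_locs :: "loc set" where
  "static_locs = {WR 0, WR 1, WR 2, WR 14, RR 0, WA 3, WA 4, WA 5, WA 6, RA 1}"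

context weighted_graph
begin

definition static :: "ram_state \<Rightarrow> bool" where
  "static s \<longleftrightarrow> wreg s 0 = n \<and> wreg s 1 = m \<and> wreg s 2 = 1 \<and> wreg s 14 = 0 \<and> rreg s 0 = 0 \<and>
     (\<forall>y<n. warr s 6 y = dg y \<and>
       (\<exists>hs. distinct hs \<and> set hs = {h \<in> H. S h = y} \<and> chain (warr s 4) (warr s 3 y) hs)) \<and>
     (\<forall>h\<in>H. warr s 5 h = T h \<and> rarr s 1 h = w {S h, T h})"

lemma static_agree:
  assumes "static s" "agree X s s'" "static_locs \<subseteq> X"
  shows "static s'"
proof -
  have "agree static_locs s s'" using assms(2,3) by (rule agree_mono)
  then show ?thesis using assms(1) unfolding static_def agree_def static_locs_def by simp
qed

definition layer :: "nat \<Rightarrow> nat \<Rightarrow> ram_state \<Rightarrow> bool" where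
  "layer u l s \<longleftrightarrow> (\<exists>L. distinct L \<and> set L = Lset u l \<and> wreg s (20 + l) = length L \<and>
     (\<forall>i<length L. warr s (lst l) i = L ! i))"

lemma layer_agree:
  assumes "layer u l s" "agree X s s'" "WR (20 + l) \<in> X" "WA (lst l) \<in> X"
  shows "layer u l s'"
  using assms agreeD[OF assms(2)] unfolding layer_def by metis

abbreviation scan_locs :: "loc set" where
  "scan_locs \<equiv> {WR 6, WR 7, WR 8, WR 9, WR 13}"

definition scanned :: "nat \<Rightarrow> nat \<Rightarrow> nat set" where
  "scanned u l = {h \<in> H. S h \<in> Lset u l \<and> dg (T h) \<le> dg u}"

text \<open>One generous constant for all overheads: the \<open>c + 14\<close> steps per half-edge
  and 14 steps per vertex both fit under \<open>c + 20\<close>.\<close>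

definition scan_cost :: "nat \<Rightarrow> nat \<Rightarrow> nat \<Rightarrow> nat" where
  "scan_cost u l c = (c + 20) * ((\<Sum>y\<in>Lset u l. dg y) + card (Lset u l) + 1)"

lemma mods_scan: "mods (scan l body) = scan_locs \<union> mods body"
  by (auto simp: scan_def)

text \<open>\<open>J\<close> depends on the set of processed half-edges, so the orders of the layer
  and of the incidence lists stay hidden from its users. It must survive changes of the scan
  registers, and \<open>body\<close> must leave intact the graph and the layer that is being
  scanned.\<close>

lemma hoare_scan:
  fixes body u l
  defines "M \<equiv> scan_locs \<union> mods body"
  assumes s0: "static s0" "wreg s0 5 = dg u" "u < n" "layer u l s0"
    and mods: "mods body \<inter> (static_locs \<union> {WR 5, WR 6, WR 7, WR 8, WR (20 + l), WA (lst l)}) = {}"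
    and body: "\<And>hs h s. agree (- M) s0 s \<Longrightarrow> J hs s \<Longrightarrow> h \<in> scanned u l \<Longrightarrow> h \<notin> hs \<Longrightarrow>
      wreg s 7 = S h \<Longrightarrow> wreg s 8 = h \<Longrightarrow> wreg s 9 = T h \<Longrightarrow> hoare W body s c (J (insert h hs))"
    and J: "\<And>hs s s'. J hs s \<Longrightarrow> agree (- scan_locs) s s' \<Longrightarrow> J hs s'" and J0: "J {} s0"
  shows "hoare W (scan l body) s0 (scan_cost u l c) (\<lambda>s. J (scanned u l) s \<and> agree (- M) s0 s)"
proof -
  let ?A = "scanned u l"
  obtain L where L: "distinct L" "set L = Lset u l" "wreg s0 (20 + l) = length L"
    "\<And>i. i < length L \<Longrightarrow> warr s0 (lst l) i = L ! i"
    using s0(4) unfolding layer_def by blast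
  have notM: "static_locs \<subseteq> - M" "WR 5 \<notin> M" "WR (20 + l) \<notin> M" "WA (lst l) \<notin> M" "WR 6 \<notin> mods body"
    "WR 7 \<notin> mods body" "WR 8 \<notin> mods body" "WR 14 \<notin> M" "WR 2 \<notin> M"
    using mods unfolding M_def static_locs_def by auto
  have scM: "agree (- M) s0 s'" if "agree (- M) s0 s" "agree (- scan_locs) s s'" for s s'
    by (rule agree_trans[OF that]) (auto simp: M_def)
  have Lb: "L ! i < n" if "i < length L" for i
    using that L(2) Lset_bounds[OF s0(3)] by (metis nth_mem)
  \<comment> \<open>Between vertices, exactly the scanned half-edges leaving the finished vertices
    have been processed.\<close>
  define I where "I = (\<lambda>(ys :: nat list) (zs :: nat list) s. agree (- M) s0 s \<and> wreg s 6 = length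
      ys \<and> J {h \<in> ?A. S h \<in> set ys} s)"
  have lenL: "length L \<le> n"
  proof -
    have "length L = card (set L)" using L(1) by (simp add: distinct_card)
    also have "\<dots> \<le> card {..<n}" using Lset_bounds[OF s0(3)] L(2) by (intro card_mono) auto
    finally show ?thesis by simp
  qed
  have inner: "test_val (WLess 6 (20 + l)) s \<and> hoare W (seqs [
     WGet 7 (lst l) 6, WGet 8 3 7,
     While (WLess 14 8) (seqs [WGet 9 5 8, WGet 13 6 9, IfThenElse (WLess 5 13) Skip body, WGet 8
         4 8]),
     WOp WAdd 6 6 2]) s (dg z * (c + 14) + 13) (I (ys @ [z]) zs)"
    if Ls: "L = ys @ z # zs" and Is: "I ys (z # zs) s" for ys z zs s
  proof
    have ag: "agree (- M) s0 s" and r6: "wreg s 6 = length ys" and Js: "J {h \<in> ?A. S h \<in> set ys} s"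
      using Is by (auto simp: I_def)
    have lz: "L ! length ys = z" and ly: "length ys < length L" using Ls by auto
    have zn: "z < n" using Lb[OF ly] lz by simp
    show "test_val (WLess 6 (20 + l)) s"
      using agreeD(1)[OF ag, of "20 + l"] notM L(3) r6 ly by simp
    have get: "warr s (lst l) (length ys) = z"
      using agreeD(2)[OF ag, of "lst l"] notM L(4)[OF ly] lz by simp
    have st: "static s" by (rule static_agree[OF s0(1) ag notM(1)])
    then obtain hs where hs: "distinct hs" "set hs = {h \<in> H. S h = z}" "chain (warr s 4) (warr s 3
        z) hs"
      using zn unfolding static_def by blast
    have len_hs: "length hs = dg z" unfolding dg_def hs(2)[symmetric] using hs(1) by (simp add:
        distinct_card)
    define s1 where "s1 = sem W (WGet 8 3 7) (sem W (WGet 7 (lst l) 6) s)"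
    have s1: "wreg s1 7 = z" "wreg s1 8 = warr s 3 z" "wreg s1 6 = length ys"
      "agree (- scan_locs) s s1"
      using get r6 by (auto simp: s1_def set_defs agree_def)
    \<comment> \<open>Within the list of \<open>z\<close>, the chain starting at register 8 is
      exactly the unvisited part \<open>bs\<close>.\<close>
    define I' where "I' = (\<lambda>as bs s. agree (- M) s0 s \<and> wreg s 6 = length ys \<and> wreg s 7 = z \<and>
       chain (warr s 4) (wreg s 8) bs \<and> J ({h \<in> ?A. S h \<in> set ys} \<union> (?A \<inter> set as)) s)"
    have ag1: "agree (- M) s0 s1" by (rule scM[OF ag s1(4)])
    have w4: "warr s' 4 = warr s0 4" "wreg s' 14 = 0" "wreg s' 5 = dg u" "static s'" "wreg s' 2 = 1"
      if "agree (- M) s0 s'" for s'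
    proof -
      show st': "static s'" by (rule static_agree[OF s0(1) that notM(1)])
      then show "wreg s' 14 = 0" "wreg s' 2 = 1" by (auto simp: static_def)
      show "warr s' 4 = warr s0 4" using agreeD(2)[OF that] notM(1) by (auto simp: static_locs_def)
      show "wreg s' 5 = dg u" using agreeD(1)[OF that] notM(2) s0(2) by auto
    qed
    have I'0: "I' [] hs s1"
      unfolding I'_def using ag1 s1 hs(3) J[OF Js s1(4)] w4(1)[OF ag1] w4(1)[OF ag] by simp
    have loop: "hoare W (While (WLess 14 8) (seqs [WGet 9 5 8, WGet 13 6 9,
        IfThenElse (WLess 5 13) Skip body, WGet 8 4 8])) s1 ((\<Sum>h\<leftarrow>hs. c + 13 + 1) + 1) (I' hs [])"
    proof (rule hoare_While_list[where c = "\<lambda>_. c + 13" and I = I' and xs = hs, OF _ _ I'0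
        order_refl])
      fix s assume "I' hs [] s"
      then show "\<not> test_val (WLess 14 8) s" by (simp add: I'_def)
    next
      fix as h bs s assume hs': "hs = as @ h # bs" and I': "I' as (h # bs) s"
      then have ag: "agree (- M) s0 s" and r6: "wreg s 6 = length ys" and r7: "wreg s 7 = z"
        and ch: "wreg s 8 = h" "h \<noteq> 0" "chain (warr s 4) (warr s 4 h) bs"
        and Js: "J ({h \<in> ?A. S h \<in> set ys} \<union> (?A \<inter> set as)) s"
        by (auto simp: I'_def)
      note w = w4[OF ag]
      have hH: "h \<in> H" "S h = z" using hs(2) hs' by auto
      define s2 where "s2 = sem W (WGet 13 6 9) (sem W (WGet 9 5 8) s)"
      have "T h < n" using ends[OF hH(1)] by simp
      then have s2: "wreg s2 9 = T h" "wreg s2 13 = dg (T h)" "wreg s2 7 = z" "wreg s2 8 = h"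
        "wreg s2 6 = length ys" "agree (- scan_locs) s s2"
        using w(4) hH ch r6 r7 by (auto simp: s2_def set_defs agree_def static_def)
      have ag2: "agree (- M) s0 s2" by (rule scM[OF ag s2(6)])
      have hA: "h \<in> ?A \<longleftrightarrow> dg (T h) \<le> dg u"
        using hH L(2) Ls by (auto simp: scanned_def)
      \<comment> \<open>\<open>L\<close> and \<open>hs\<close> are distinct, so no half-edge is
        offered to \<open>body\<close> twice.\<close>
      have new: "h \<notin> {h \<in> ?A. S h \<in> set ys} \<union> (?A \<inter> set as)"
        using hs(1) hs' hH L(1) Ls by auto
      have set_eq: "{h \<in> ?A. S h \<in> set ys} \<union> (?A \<inter> set (as @ [h])) =
          (if h \<in> ?A then insert h ({h \<in> ?A. S h \<in> set ys} \<union> (?A \<inter> set as))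
           else {h \<in> ?A. S h \<in> set ys} \<union> (?A \<inter> set as))"
        by auto
      define R where "R = (\<lambda>s. agree (- M) s0 s \<and> wreg s 6 = length ys \<and> wreg s 7 = z \<and>
         wreg s 8 = h \<and> J ({h \<in> ?A. S h \<in> set ys} \<union> (?A \<inter> set (as @ [h]))) s)"
      have J2: "J ({h \<in> ?A. S h \<in> set ys} \<union> (?A \<inter> set as)) s2" by (rule J[OF Js s2(6)])
      have If: "hoare W (IfThenElse (WLess 5 13) Skip body) s2 (c + 2) R"
      proof (rule hoare_If[where B = "c + 1"])
        assume "test_val (WLess 5 13) s2"
        then have "h \<notin> ?A" using hA s2(2) w4(3)[OF ag2] by auto
        then have "R s2" unfolding R_def set_eq using ag2 s2 J2 by simp
        then show "hoare W Skip s2 (c + 1) R" by (auto intro: hoare_step)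
      next
        assume "\<not> test_val (WLess 5 13) s2"
        then have h: "h \<in> ?A" using hA s2(2) w4(3)[OF ag2] by auto
        have "hoare W body s2 c (J (insert h ({h \<in> ?A. S h \<in> set ys} \<union> (?A \<inter> set as))))"
          by (rule body[OF ag2 J2 h new]) (use s2 hH in auto)
        from hoare_frame[OF this] show "hoare W body s2 (c + 1) R"
        proof (rule hoare_conseq)
          fix s' assume s': "J (insert h ({h \<in> ?A. S h \<in> set ys} \<union> (?A \<inter> set as))) s' \<and>
            agree (- mods body) s2 s'"
          have "agree (- M) s0 s'"
            by (rule agree_trans[OF ag2 conjunct2[OF s']]) (auto simp: M_def)
          moreover have "wreg s' 6 = wreg s2 6" "wreg s' 7 = wreg s2 7" "wreg s' 8 = wreg s2 8"
            using agreeD(1)[OF conjunct2[OF s']] notM by auto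
          ultimately show "R s'" unfolding R_def set_eq using s2 s' h by simp
        qed simp
      qed simp
      have last: "hoare W (seqs [WGet 8 4 8]) s3 3 (I' (as @ [h]) bs)" if R: "R s3" for s3
      proof (rule hoare_loopfree)
        define s4 where "s4 = sem W (seqs [WGet 8 4 8]) s3"
        have a: "agree (- scan_locs) s3 s4" by (auto simp: s4_def set_defs agree_def)
        have ag4: "agree (- M) s0 s4" using scM[OF _ a] R by (simp add: R_def)
        have "wreg s4 8 = warr s 4 h" "wreg s4 6 = length ys" "wreg s4 7 = z"
          using R w(1) w4(1)[of s3] by (auto simp: s4_def set_defs R_def)
        then show "I' (as @ [h]) bs (sem W (seqs [WGet 8 4 8]) s3)"
          using ag4 ch J[OF _ a] R w(1) w4(1)[OF ag4] unfolding s4_def[symmetric] I'_def R_def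
          by simp
      qed simp_all
      have "hoare W (seqs [WGet 9 5 8, WGet 13 6 9, IfThenElse (WLess 5 13) Skip body, WGet 8 4
          8]) s
          (csize (WGet 9 5 8) + (csize (WGet 13 6 9) + (c + 2 + 3 + 1) + 1) + 1) (I' (as @ [h]) bs)"
        unfolding seqs.simps(2)[of "WGet 9 5 8"] seqs.simps(2)[of "WGet 13 6 9"]
          seqs.simps(2)[of "IfThenElse x y z" for x y z]
        apply (intro hoare_Seq_loopfree)
          apply simp
         apply simp
        apply (fold s2_def)
        apply (rule hoare_Seq[OF If last])
         apply assumption
        apply simp
        done
      then have "hoare W (seqs [WGet 9 5 8, WGet 13 6 9, IfThenElse (WLess 5 13) Skip body, WGet 8
          4 8]) s
          (c + 13) (I' (as @ [h]) bs)"
        by (rule hoare_conseq) auto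
      moreover have "test_val (WLess 14 8) s" using w(2) ch by simp
      ultimately show "test_val (WLess 14 8) s \<and> hoare W (seqs [WGet 9 5 8, WGet 13 6 9,
          IfThenElse (WLess 5 13) Skip body, WGet 8 4 8]) s (c + 13) (I' (as @ [h]) bs)" by blast
    qed
    have last: "hoare W (seqs [WOp WAdd 6 6 2]) s3 3 (I (ys @ [z]) zs)" if I': "I' hs [] s3" for s3
    proof (rule hoare_loopfree)
      define s4 where "s4 = sem W (seqs [WOp WAdd 6 6 2]) s3"
      have ag3: "agree (- M) s0 s3" using I' by (simp add: I'_def)
      have a: "agree (- scan_locs) s3 s4" by (auto simp: s4_def set_defs agree_def)
      have "wreg s4 6 = Suc (length ys)"
        using I' w4(5)[OF ag3] ly lenL W by (auto simp: s4_def set_defs I'_def)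
      moreover have "{h \<in> ?A. S h \<in> set ys} \<union> (?A \<inter> set hs) = {h \<in> ?A. S h \<in> set (ys @ [z])}"
        using hs(2) by (auto simp: scanned_def)
      ultimately show "I (ys @ [z]) zs (sem W (seqs [WOp WAdd 6 6 2]) s3)"
        using J[OF _ a] scM[OF ag3 a] I' unfolding s4_def[symmetric] I_def I'_def by simp
    qed simp_all
    have "hoare W (seqs [
     WGet 7 (lst l) 6, WGet 8 3 7,
     While (WLess 14 8) (seqs [WGet 9 5 8, WGet 13 6 9, IfThenElse (WLess 5 13) Skip body, WGet 8
         4 8]),
     WOp WAdd 6 6 2]) s (csize (WGet 7 (lst l) 6) + (csize (WGet 8 3 7) +
        (((\<Sum>h\<leftarrow>hs. c + 13 + 1) + 1) + 3 + 1) + 1) + 1) (I (ys @ [z]) zs)"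
      unfolding seqs.simps(2)[of "WGet 7 (lst l) 6"] seqs.simps(2)[of "WGet 8 3 7"]
        seqs.simps(2)[of "While x y" for x y]
      apply (intro hoare_Seq_loopfree)
        apply simp
       apply simp
      apply (fold s1_def)
      apply (rule hoare_Seq[OF loop last])
       apply assumption
      apply simp
      done
    then show "hoare W (seqs [
     WGet 7 (lst l) 6, WGet 8 3 7,
     While (WLess 14 8) (seqs [WGet 9 5 8, WGet 13 6 9, IfThenElse (WLess 5 13) Skip body, WGet 8
         4 8]),
     WOp WAdd 6 6 2]) s (dg z * (c + 14) + 13) (I (ys @ [z]) zs)"
      by (rule hoare_conseq) (auto simp: sum_list_triv len_hs add.commute)
  qed
  have "hoare W (While (WLess 6 (20 + l)) (seqs [
     WGet 7 (lst l) 6, WGet 8 3 7,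
     While (WLess 14 8) (seqs [WGet 9 5 8, WGet 13 6 9, IfThenElse (WLess 5 13) Skip body, WGet 8
         4 8]),
     WOp WAdd 6 6 2])) (sem W (WConst 6 0) s0) ((\<Sum>z\<leftarrow>L. dg z * (c + 14) + 13 + 1) + 1) (I L [])"
  proof (rule hoare_While_list[where I = I, OF inner])
    show "\<not> test_val (WLess 6 (20 + l)) s" if "I L [] s" for s
      using that L(3) agreeD(1)[of "- M" s0 s "20 + l"] notM by (auto simp: I_def)
    have a: "agree (- scan_locs) s0 (sem W (WConst 6 0) s0)" by (auto simp: set_defs agree_def)
    show "I [] L (sem W (WConst 6 0) s0)"
      using J[OF J0 a] scM[OF agree_refl a] by (simp add: I_def) (simp add: set_defs)
  qed simp_all
  then have "hoare W (scan l body) s0 (csize (WConst 6 0) + ((\<Sum>z\<leftarrow>L. dg z * (c + 14) + 13 + 1) + 1)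
      + 1) (I L [])"
    unfolding scan_def by (intro hoare_Seq_loopfree) simp_all
  then show ?thesis
  proof (rule hoare_conseq)
    have "(\<Sum>z\<leftarrow>L. dg z * (c + 14) + 13 + 1) = (\<Sum>z\<in>Lset u l. dg z * (c + 14) + 14)"
      using L(1,2) by (simp add: sum_list_distinct_conv_sum_set add.commute)
    also have "\<dots> = (\<Sum>z\<in>Lset u l. dg z) * (c + 14) + card (Lset u l) * 14"
      by (simp add: sum.distrib sum_distrib_right)
    also have "\<dots> \<le> (\<Sum>z\<in>Lset u l. dg z) * (c + 20) + card (Lset u l) * (c + 20)"
      by (intro add_mono mult_mono) auto
    finally show "csize (WConst 6 0) + ((\<Sum>z\<leftarrow>L. dg z * (c + 14) + 13 + 1) + 1) + 1 \<le> scan_cost u l c"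
      unfolding scan_cost_def by (simp add: algebra_simps)
    fix s assume "I L [] s"
    moreover have "{h \<in> ?A. S h \<in> set L} = ?A" using L(2) by (auto simp: scanned_def)
    ultimately show "J ?A s \<and> agree (- M) s0 s" by (simp add: I_def)
  qed
qed

end

section \<open>Growing the layers\<close>

text \<open>The positions are listed by length, so that a slot is filled after its ancestors.\<close>

definition slots :: "nat \<Rightarrow> nat \<Rightarrow> nat list list" where
  "slots k l = (if l = 0 then [[]]
     else concat (map (\<lambda>j. List.n_lists j [0..<Suc l]) [0..<Suc (k - l)]))"

lemma slots_0[simp]: "slots k 0 = [[]]" by (simp add: slots_def)

text \<open>A path of length \<open>Suc l\<close> has \<open>Suc (Suc l)\<close> vertices, which is
  the branching of the tree; the depth is the largest size of a set to be avoided. In layer 0 one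
  position is enough, as the only path is \<open>u\<close> itself.\<close>

lemma set_slots_Suc: "set (slots k (Suc l)) = {\<tau>. length \<tau> \<le> k - Suc l \<and> set \<tau> \<subseteq> {..<Suc (Suc l)}}"
  unfolding slots_def by (auto simp: set_n_lists less_Suc_eq_le atLeast0LessThan simp del: upt_Suc)

lemma distinct_slots: "distinct (slots k l)"
proof -
  have "distinct (concat (map (\<lambda>j. List.n_lists j xs) js))" if "distinct xs" "distinct js"
    for xs :: "nat list" and js
    using that(2)
  proof (induction js)
    case (Cons j js)
    then show ?case using that(1) by (auto simp: distinct_n_lists set_n_lists)
  qed simp
  then show ?thesis by (simp add: slots_def del: upt_Suc)
qed

text \<open>Ancestors of an earlier position are strictly shorter than \<open>\<tau>\<close>, so
  filling \<open>\<tau>\<close> does not change what earlier positions have to avoid;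
  \<open>hoare_fill\<close> relies on this.\<close>

lemma slots_sorted:
  assumes "slots k l = ys @ \<tau> # zs" "\<tau>' \<in> set ys"
  shows "length \<tau>' \<le> length \<tau>"
proof -
  have "sorted_wrt (\<lambda>a b. length a \<le> length b) (concat (map (\<lambda>j. List.n_lists j xs) js))"
    if "sorted js" for xs :: "nat list" and js
    using that
  proof (induction js)
    case (Cons j js)
    have "sorted_wrt (\<lambda>a b. length a \<le> length b) (List.n_lists j xs)"
      unfolding sorted_wrt_iff_nth_less
      by (metis length_n_lists_elem less_trans nth_mem order_refl)
    then show ?case using Cons by (auto simp: sorted_wrt_append set_n_lists)
  qed simp
  then have "sorted_wrt (\<lambda>a b. length a \<le> length b) (slots k l)"
    by (simp add: slots_def del: upt_Suc)
  then show ?thesis using assms by (auto simp: sorted_wrt_append)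
qed

definition upd_all :: "nat \<Rightarrow> nat \<Rightarrow> nat list \<Rightarrow> com" where
  "upd_all k l \<tau> = seqs (map (upd l \<tau>) (slots k l))"

text \<open>Each position gets a scan of its own: what it must avoid at a vertex is settled only
  when its ancestors have seen all candidates.\<close>

definition fill :: "nat \<Rightarrow> nat \<Rightarrow> com" where
  "fill k l = seqs (map (\<lambda>\<tau>. scan l (upd_all k l \<tau>)) (slots k (Suc l)))"

definition grow :: "nat \<Rightarrow> nat \<Rightarrow> com" where
  "grow k l = Seq (WConst (20 + Suc l) 0) (Seq (scan l (visit l)) (fill k l))"

lemma deterministic_scan[simp]: "deterministic (scan l p) \<longleftrightarrow> deterministic p"
  by (auto simp: scan_def)

lemma deterministic_grow[simp]: "deterministic (grow k l)"
  by (auto simp: grow_def fill_def upd_all_def)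

section \<open>Memory footprints\<close>

definition temp_locs :: "loc set" where
  "temp_locs = {WR 6, WR 7, WR 8, WR 9, WR 10, WR 11, WR 12, WR 13, RR 1, RR 2}"

definition slot_locs :: "nat \<Rightarrow> nat list \<Rightarrow> loc set" where
  "slot_locs l \<tau> = insert (WA (stamp l \<tau>)) (insert (RA (val l \<tau>)) (WA ` range (vtx l \<tau>)))"

lemma mods_upd_all: "mods (upd_all k l \<tau>) \<subseteq>
    {WR 10, WR 11, WR 12, RR 1, RR 2} \<union> slot_locs (Suc l) \<tau>"
proof -
  have "mods (upd l \<tau> \<sigma>) \<subseteq> {WR 10, WR 11, WR 12, RR 1, RR 2} \<union> slot_locs (Suc l) \<tau>" for \<sigma>
    by (rule order_trans[OF mods_upd]) (auto simp: slot_locs_def)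
  then show ?thesis unfolding upd_all_def mods_seqs set_map by blast
qed

lemma cell_agree:
  assumes "agree X s s'" "slot_locs l \<tau> \<subseteq> X"
  shows "cell su l \<tau> x s' = cell su l \<tau> x s"
proof -
  have "warr s' (stamp l \<tau>) = warr s (stamp l \<tau>)" "rarr s' (val l \<tau>) = rarr s (val l \<tau>)"
    using agreeD(2,4)[OF assms(1)] assms(2) unfolding slot_locs_def by auto
  moreover have "warr s' (vtx l \<tau> i) = warr s (vtx l \<tau> i)" for i
    by (rule agreeD(2)[OF assms(1)]) (use assms(2) in \<open>unfold slot_locs_def, blast\<close>)
  ultimately show ?thesis unfolding cell_def by simp
qed

lemma avoid_agree:
  assumes "agree X s s'" "\<And>j. j < length \<tau> \<Longrightarrow> slot_locs l (take j \<tau>) \<subseteq> X"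
  shows "avoid l \<tau> x s' = avoid l \<tau> x s"
  unfolding avoid_def
proof (intro image_cong refl)
  fix j assume "j \<in> {..<length \<tau>}"
  then have "WA (vtx l (take j \<tau>) (\<tau> ! j)) \<in> X" using assms(2)[of j] unfolding slot_locs_def by
      blast
  then show "warr s' (vtx l (take j \<tau>) (\<tau> ! j)) x = warr s (vtx l (take j \<tau>) (\<tau> ! j)) x"
    using agreeD(2)[OF assms(1)] by simp
qed

lemma slot_locs_disjoint:
  "l \<noteq> l' \<or> \<tau> \<noteq> \<tau>' \<Longrightarrow> slot_locs l \<tau> \<inter> slot_locs l' \<tau>' = {}"
  "slot_locs l \<tau> \<inter> temp_locs = {}" "slot_locs l \<tau> \<inter> static_locs = {}"
  by (auto simp: slot_locs_def temp_locs_def static_locs_def)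

definition upd_cost :: "nat \<Rightarrow> nat \<Rightarrow> nat list \<Rightarrow> nat" where
  "upd_cost k l \<tau> = (\<Sum>\<sigma>\<leftarrow>slots k l. csize (upd l \<tau> \<sigma>) + 1) + 1"

section \<open>Invariants for the families in the layers\<close>

context weighted_graph
begin

text \<open>Soundness and completeness of the stored families. The budget \<open>k - l\<close> for
  \<open>Y\<close> drops by one per layer, since extending to \<open>x\<close> spends one forbidden
  vertex on \<open>x\<close>. At lengths \<open>r\<close> and \<open>k - r\<close> it still covers
  the inner vertices of the other path.\<close>

definition good :: "nat \<Rightarrow> nat \<Rightarrow> ram_state \<Rightarrow> bool" where
  "good u l s \<longleftrightarrow>
     (\<forall>\<sigma>\<in>set (slots k l). \<forall>x p v. cell (Suc u) l \<sigma> x s = Some (p, v) \<longrightarrow> low_path u l x p \<and> v = pw l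
         p) \<and>
     (\<forall>x p Y. low_path u l x p \<longrightarrow> finite Y \<longrightarrow> card Y \<le> k - l \<longrightarrow> set p \<inter> Y = {} \<longrightarrow>
       (\<exists>\<sigma>\<in>set (slots k l). \<exists>q v. cell (Suc u) l \<sigma> x s = Some (q, v) \<and> set q \<inter> Y = {} \<and> pw l p \<le>
           v))"

lemma good_sound:
  assumes "good u l s" "\<sigma> \<in> set (slots k l)" "cell (Suc u) l \<sigma> x s = Some (p, v)"
  shows "low_path u l x p" "v = pw l p"
  using assms by (simp_all add: good_def)

lemma good_complete:
  assumes "good u l s" "low_path u l x p" "finite Y" "card Y \<le> k - l" "set p \<inter> Y = {}"
  obtains \<sigma> q v where "\<sigma> \<in> set (slots k l)" "cell (Suc u) l \<sigma> x s = Some (q, v)"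
    "set q \<inter> Y = {}" "pw l p \<le> v"
  using assms unfolding good_def by meson

lemma good_agree:
  assumes "good u l s" "agree X s s'" "\<And>\<tau>. slot_locs l \<tau> \<subseteq> X"
  shows "good u l s'"
  using assms(1) cell_agree[OF assms(2,3)] unfolding good_def by simp

text \<open>\<open>I\<close> holds the pairs of half-edge and position tried so far, so the
  candidate set grows along the scan.\<close>

definition cands :: "nat \<Rightarrow> nat \<Rightarrow> nat \<Rightarrow> ram_state \<Rightarrow> (nat \<times> nat list) set \<Rightarrow> (nat list \<times> real) set"
    where
  "cands u l x s I = {(p @ [x], v + w {S h, x}) |h \<sigma> p v. (h, \<sigma>) \<in> I \<and> T h = x \<and>
     cell (Suc u) l \<sigma> (S h) s = Some (p, v) \<and> x \<notin> set p}"

lemma cands_insert: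
  "{c \<in> cands u l x s (insert (h, \<sigma>) I). set (fst c) \<inter> Y = {}} =
   {c \<in> cands u l x s I. set (fst c) \<inter> Y = {}} \<union>
     (if T h = x then set_option (extend Y x (w {S h, T h}) (cell (Suc u) l \<sigma> (S h) s)) else {})"
proof -
  have "cands u l x s (insert (h, \<sigma>) I) = cands u l x s I \<union> (if T h = x then
      {(p @ [x], v + w {S h, x}) |p v. cell (Suc u) l \<sigma> (S h) s = Some (p, v) \<and> x \<notin> set p} else {})"
    unfolding cands_def by auto
  then show ?thesis
    by (cases "cell (Suc u) l \<sigma> (S h) s") (auto simp: extend_def disjoint_iff split: if_splits)
qed

definition ctx :: "nat \<Rightarrow> ram_state \<Rightarrow> bool" where
  "ctx u s \<longleftrightarrow> static s \<and> u < n \<and> wreg s 3 = u \<and> wreg s 4 = Suc u \<and> wreg s 5 = dg u"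

lemma ctx_agree:
  assumes "ctx u s" "agree X s s'" "static_locs \<union> {WR 3, WR 4, WR 5} \<subseteq> X"
  shows "ctx u s'"
  using assms static_agree[OF _ assms(2)] agreeD(1)[OF assms(2)] unfolding ctx_def by auto

text \<open>Of the stored families only position \<open>\<tau>\<close> of layer \<open>Suc l\<close>
  changes, so candidates and avoided sets are frozen at \<open>s0\<close> and every entry is the
  running maximum over the pairs tried. By \<open>fresh\<close>, all entries of the position are
  empty at the start.\<close>

lemma hoare_pass:
  assumes ctx: "ctx u s0" and layer: "layer u l s0"
    and fresh: "\<And>x. warr s0 (stamp (Suc l) \<tau>) x \<le> u"
  shows "hoare W (scan l (upd_all k l \<tau>)) s0 (scan_cost u l (upd_cost k l \<tau>)) (\<lambda>s.
     agree (- (temp_locs \<union> slot_locs (Suc l) \<tau>)) s0 s \<and>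
     (\<forall>x. warr s (stamp (Suc l) \<tau>) x \<le> Suc u) \<and>
     (\<forall>x. ismax {c \<in> cands u l x s0 (scanned u l \<times> set (slots k l)). set (fst c) \<inter> avoid (Suc l) \<tau>
         x s0 = {}}
        (cell (Suc u) (Suc l) \<tau> x s)))"
proof -
  let ?M = "scan_locs \<union> mods (upd_all k l \<tau>)"
  define Q where "Q = (\<lambda>I s. (\<forall>x. warr s (stamp (Suc l) \<tau>) x \<le> Suc u) \<and>
     (\<forall>x. ismax {c \<in> cands u l x s0 I. set (fst c) \<inter> avoid (Suc l) \<tau> x s0 = {}}
        (cell (Suc u) (Suc l) \<tau> x s)))"
  have M: "?M \<subseteq> temp_locs \<union> slot_locs (Suc l) \<tau>"
    using mods_upd_all[of k l \<tau>] by (auto simp: temp_locs_def)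
  have Qframe: "Q I s'" if "Q I s" "agree (- scan_locs) s s'" for I s s'
  proof -
    have sub: "slot_locs (Suc l) \<tau> \<subseteq> - scan_locs" by (auto simp: slot_locs_def)
    have "warr s' (stamp (Suc l) \<tau>) = warr s (stamp (Suc l) \<tau>)" by (rule agreeD(2)[OF that(2)]) auto
    then show ?thesis using that(1) cell_agree[OF that(2) sub] unfolding Q_def by simp
  qed
  have "hoare W (scan l (upd_all k l \<tau>)) s0 (scan_cost u l (upd_cost k l \<tau>)) (\<lambda>s.
     Q (scanned u l \<times> set (slots k l)) s \<and> agree (- ?M) s0 s)"
  proof (rule hoare_scan[where J = "\<lambda>hs. Q (hs \<times> set (slots k l))"])
    show "static s0" "wreg s0 5 = dg u" "u < n" "layer u l s0" using ctx layer by (auto simp: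
        ctx_def)
    show "mods (upd_all k l \<tau>) \<inter> (static_locs \<union> {WR 5, WR 6, WR 7, WR 8, WR (20 + l), WA (lst l)})
        = {}"
      using mods_upd_all[of k l \<tau>] by (fastforce simp: static_locs_def slot_locs_def)
    show "Q (hs \<times> set (slots k l)) s'" if "Q (hs \<times> set (slots k l)) s" "agree (- scan_locs) s s'"
        for hs s s'
      using Qframe that .
    have "cell (Suc u) (Suc l) \<tau> x s0 = None" for x
      using fresh[of x] by (auto simp: cell_def)
    then show "Q ({} \<times> set (slots k l)) s0"
      using fresh by (auto simp: Q_def cands_def ismax_def le_SucI)
  next
    fix hs h s
    assume ag: "agree (- ?M) s0 s" and Qs: "Q (hs \<times> set (slots k l)) s" and h: "h \<in> scanned u l"
      and r: "wreg s 7 = S h" "wreg s 8 = h" "wreg s 9 = T h"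
    define I where "I = (\<lambda>ys s. agree (- ?M) s0 s \<and> wreg s 7 = S h \<and> wreg s 8 = h \<and> wreg s 9 = T h \<and>
       Q (hs \<times> set (slots k l) \<union> {h} \<times> set ys) s)"
    have "hoare W (upd_all k l \<tau>) s (upd_cost k l \<tau>) (I (slots k l))"
      unfolding upd_all_def upd_cost_def
    proof (rule hoare_seqs[where I = I, OF _ _ order_refl])
      show "I [] s" using ag Qs r by (simp add: I_def)
    next
      fix ys \<sigma> zs s assume sl: "slots k l = ys @ \<sigma> # zs" and Is: "I ys s"
      have ag: "agree (- ?M) s0 s" and r: "wreg s 7 = S h" "wreg s 8 = h" "wreg s 9 = T h"
        and Qs: "Q (hs \<times> set (slots k l) \<union> {h} \<times> set ys) s" using Is by (auto simp: I_def)
      have ag': "agree (- (temp_locs \<union> slot_locs (Suc l) \<tau>)) s0 s" using M by (intro agree_mono[OF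
          ag]) auto
      have "ctx u s" by (rule ctx_agree[OF ctx ag'])
          (use slot_locs_disjoint(3)[of "Suc l" \<tau>] in \<open>auto simp: temp_locs_def static_locs_def
              slot_locs_def\<close>)
      then have c: "wreg s 2 = 1" "wreg s 4 = Suc u" "warr s 5 h = T h" "rarr s 1 h = w {S h, T h}"
        using h by (auto simp: ctx_def static_def scanned_def)
      have cell0: "cell (Suc u) l \<sigma> y s = cell (Suc u) l \<sigma> y s0" for y
        by (rule cell_agree[OF ag']) (auto simp: slot_locs_def temp_locs_def)
      have avoid0: "avoid (Suc l) \<tau> x s = avoid (Suc l) \<tau> x s0" for x
      proof (rule avoid_agree[OF ag'])
        fix j assume "j < length \<tau>"
        \<comment> \<open>A proper prefix of \<open>\<tau>\<close> is a different position, hence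
          not written in this pass.\<close>
        then have "take j \<tau> \<noteq> \<tau>" by (metis length_take min.absorb2 nat_less_le)
        then show "slot_locs (Suc l) (take j \<tau>) \<subseteq> - (temp_locs \<union> slot_locs (Suc l) \<tau>)"
          using slot_locs_disjoint(1)[of "Suc l" "Suc l" "take j \<tau>" \<tau>] slot_locs_disjoint(2) by
              blast
      qed
      define s' where "s' = sem W (upd l \<tau> \<sigma>) s"
      have W1: "1 < W" using W by simp
      note upd = sem_upd[where l = l and \<tau> = \<tau> and \<sigma> = \<sigma>, OF W1 c(1), unfolded r c(2), OF c(3),
          folded s'_def, unfolded c(4) cell0 avoid0]
      have ag_s': "agree (- mods (upd_all k l \<tau>)) s s'"
        unfolding s'_def by (rule agree_mono[OF sem_frame]) (auto simp: upd_all_def sl)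
      have "I (ys @ [\<sigma>]) s'" unfolding I_def
      proof (intro conjI)
        show "agree (- ?M) s0 s'" by (rule agree_trans[OF ag ag_s']) auto
        have nin: "WR 7 \<notin> mods (upd_all k l \<tau>)" "WR 8 \<notin> mods (upd_all k l \<tau>)" "WR 9 \<notin> mods
            (upd_all k l \<tau>)"
          using mods_upd_all[of k l \<tau>] by (auto simp: slot_locs_def)
        then show "wreg s' 7 = S h" "wreg s' 8 = h" "wreg s' 9 = T h"
          using agreeD(1)[OF ag_s'] r by auto
        have set_eq: "hs \<times> set (slots k l) \<union> {h} \<times> set (ys @ [\<sigma>]) =
          insert (h, \<sigma>) (hs \<times> set (slots k l) \<union> {h} \<times> set ys)" by auto
        show "Q (hs \<times> set (slots k l) \<union> {h} \<times> set (ys @ [\<sigma>])) s'"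
          unfolding Q_def set_eq
        proof (intro conjI allI)
          show "warr s' (stamp (Suc l) \<tau>) x \<le> Suc u" for x
            using upd(3)[of x] Qs by (auto simp: Q_def)
          show "ismax {c \<in> cands u l x s0 (insert (h, \<sigma>) (hs \<times> set (slots k l) \<union> {h} \<times> set ys)).
              set (fst c) \<inter> avoid (Suc l) \<tau> x s0 = {}} (cell (Suc u) (Suc l) \<tau> x s')" for x
          proof (cases "x = T h")
            case True
            then show ?thesis unfolding cands_insert using upd(1) Qs
              by (auto simp: Q_def intro!: ismax_better)
          next
            case False
            then show ?thesis unfolding cands_insert using upd(2)[of x] Qs by (auto simp: Q_def)
          qed
        qed
      qed
      then show "hoare W (upd l \<tau> \<sigma>) s (csize (upd l \<tau> \<sigma>)) (I (ys @ [\<sigma>]))"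
        by (intro hoare_loopfree) (simp_all add: s'_def)
    qed
    then show "hoare W (upd_all k l \<tau>) s (upd_cost k l \<tau>) (Q (insert h hs \<times> set (slots k l)))"
    proof (rule hoare_conseq)
      fix s' assume "I (slots k l) s'"
      moreover have "insert h hs \<times> set (slots k l) = hs \<times> set (slots k l) \<union> {h} \<times> set (slots k l)"
          by auto
      ultimately show "Q (insert h hs \<times> set (slots k l)) s'" by (simp add: I_def)
    qed simp
  qed
  then show ?thesis
  proof (rule hoare_conseq)
    fix s assume s: "Q (scanned u l \<times> set (slots k l)) s \<and> agree (- ?M) s0 s"
    then have "agree (- (temp_locs \<union> slot_locs (Suc l) \<tau>)) s0 s" using M by (blast intro:
        agree_mono)
    with s show "agree (- (temp_locs \<union> slot_locs (Suc l) \<tau>)) s0 s \<and>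
     (\<forall>x. warr s (stamp (Suc l) \<tau>) x \<le> Suc u) \<and>
     (\<forall>x. ismax {c \<in> cands u l x s0 (scanned u l \<times> set (slots k l)). set (fst c) \<inter> avoid (Suc l) \<tau>
         x s0 = {}}
        (cell (Suc u) (Suc l) \<tau> x s))" unfolding Q_def by blast
  qed simp
qed

lemma cands_agree:
  assumes "agree X s s'" "\<And>\<sigma>. slot_locs l \<sigma> \<subseteq> X"
  shows "cands u l x s' I = cands u l x s I"
  unfolding cands_def cell_agree[OF assms] ..

text \<open>Representation is transitive: the initial part of a path is exchanged for a stored one
  that avoids \<open>Y\<close> and the new endpoint, so its extension is a candidate; the tree then
  represents the candidates.\<close>

lemma good_Suc:
  assumes good: "good u l s" and l: "l < k"
    and max: "\<And>\<tau> x. \<tau> \<in> set (slots k (Suc l)) \<Longrightarrow>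
      ismax {c \<in> cands u l x s (scanned u l \<times> set (slots k l)). set (fst c) \<inter> avoid (Suc l) \<tau> x s'
          = {}}
        (cell (Suc u) (Suc l) \<tau> x s')"
  shows "good u (Suc l) s'"
  unfolding good_def
proof (intro conjI ballI allI impI)
  fix \<tau> x p v assume \<tau>: "\<tau> \<in> set (slots k (Suc l))" "cell (Suc u) (Suc l) \<tau> x s' = Some (p, v)"
  then have "(p, v) \<in> cands u l x s (scanned u l \<times> set (slots k l))"
    using max[OF \<tau>(1), of x] by (simp add: ismax_def)
  then obtain h \<sigma> p' v' where h: "h \<in> scanned u l" "\<sigma> \<in> set (slots k l)" "T h = x"
    "cell (Suc u) l \<sigma> (S h) s = Some (p', v')" "x \<notin> set p'" "p = p' @ [x]" "v = v' + w {S h, x}"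
    unfolding cands_def by auto
  then have "low_path u l (S h) p'" "v' = pw l p'" using good_sound[OF good h(2,4)] by auto
  then show "low_path u (Suc l) x p" "v = pw (Suc l) p"
    using low_path_snoc[of u l h p'] h by (auto simp: scanned_def)
next
  fix x p Y assume p: "low_path u (Suc l) x p" and Y: "finite Y" "card Y \<le> k - Suc l" "set p \<inter> Y =
      {}"
  obtain h p0 where h: "h \<in> H" "T h = x" "p = p0 @ [x]" "low_path u l (S h) p0" "dg x \<le> dg u" "x \<notin>
      set p0"
    by (rule low_path_SucE[OF p])
  \<comment> \<open>The budget lost between the two layers pays for adding \<open>x\<close> to
    \<open>Y\<close>, which keeps \<open>x\<close> off the replacement of \<open>p0\<close>.\<close>
  have "Suc (card Y) \<le> k - l" using Y(2) l by arith
  then have "card (insert x Y) \<le> k - l" using Y(1) by (simp add: card_insert_if)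
  moreover have "set p0 \<inter> insert x Y = {}" using h Y by auto
  ultimately obtain \<sigma> q v where q: "\<sigma> \<in> set (slots k l)" "cell (Suc u) l \<sigma> (S h) s = Some (q, v)"
    "set q \<inter> insert x Y = {}" "pw l p0 \<le> v"
    using good_complete[OF good h(4)] Y(1) by (metis finite_insert)
  have "h \<in> scanned u l" using h low_path_Lset by (auto simp: scanned_def)
  then have c: "(q @ [x], v + w {S h, x}) \<in> cands u l x s (scanned u l \<times> set (slots k l))"
    using q h unfolding cands_def by blast
  have pw: "pw (Suc l) p \<le> v + w {S h, x}"
    using low_path_snoc(2)[of u l h p0] h q by auto
  define raw where "raw = (\<lambda>\<tau> i. warr s' (vtx (Suc l) \<tau> i) x)"
  obtain \<tau> c' where c': "length \<tau> \<le> k - Suc l" "set \<tau> \<subseteq> {..<Suc (Suc l)}"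
    "cell (Suc u) (Suc l) \<tau> x s' = Some c'" "set (fst c') \<inter> Y = {}"
    "snd (q @ [x], v + w {S h, x}) \<le> snd c'"
  proof (rule tree_representative[where N = "\<lambda>\<tau>. cell (Suc u) (Suc l) \<tau> x s'" and raw = raw
      and Y = Y and q = "k - Suc l" and b = "Suc (Suc l)" and c = "(q @ [x], v + w {S h, x})"
      and C = "cands u l x s (scanned u l \<times> set (slots k l))"])
    show "ismax {c \<in> cands u l x s (scanned u l \<times> set (slots k l)).
        set (fst c) \<inter> (\<lambda>j. raw (take j \<tau>) (\<tau> ! j)) ` {..<length \<tau>} = {}} (cell (Suc u) (Suc l) \<tau> x
            s')"
      if "length \<tau> \<le> k - Suc l" "set \<tau> \<subseteq> {..<Suc (Suc l)}" for \<tau>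
      using max[of \<tau> x] that unfolding set_slots_Suc avoid_def raw_def by simp
    show "fst c = map (raw \<tau>) [0..<Suc (Suc l)]" if "cell (Suc u) (Suc l) \<tau> x s' = Some c" for \<tau> c
      using that by (auto simp: cell_def raw_def split: if_splits)
    show "set (fst (q @ [x], v + w {S h, x})) \<inter> Y = {}" using q(3) Y(3) h(3) by auto
  qed (use c Y that in auto)
  obtain q' v' where c'_eq: "c' = (q', v')" by (cases c')
  have "\<tau> \<in> set (slots k (Suc l))" using c' by (simp add: set_slots_Suc)
  moreover have "pw (Suc l) p \<le> v'" "set q' \<inter> Y = {}" using c' pw c'_eq by auto
  ultimately show "\<exists>\<sigma>\<in>set (slots k (Suc l)). \<exists>q v. cell (Suc u) (Suc l) \<sigma> x s' = Some (q, v) \<and>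
      set q \<inter> Y = {} \<and> pw (Suc l) p \<le> v"
    using c'(3) c'_eq by blast
qed

definition fill_cost :: "nat \<Rightarrow> nat \<Rightarrow> nat" where
  "fill_cost u l = (\<Sum>\<tau>\<leftarrow>slots k (Suc l). scan_cost u l (upd_cost k l \<tau>) + 1) + 1"

text \<open>Two things must survive the scans still to come: maximality at filled positions, whose
  ancestors are final by then, and freshness of the positions not yet filled.\<close>

lemma hoare_fill:
  assumes ctx: "ctx u s0" and layer: "layer u l s0" and good: "good u l s0" and l: "l < k"
    and fresh: "\<And>\<tau> x. warr s0 (stamp (Suc l) \<tau>) x \<le> u"
  shows "hoare W (fill k l) s0 (fill_cost u l) (\<lambda>s.
     agree (- (temp_locs \<union> (\<Union>\<tau>. slot_locs (Suc l) \<tau>))) s0 s \<and>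
     (\<forall>\<tau> x. warr s (stamp (Suc l) \<tau>) x \<le> Suc u) \<and> good u (Suc l) s)"
proof -
  let ?M = "temp_locs \<union> (\<Union>\<tau>. slot_locs (Suc l) \<tau>)"
  let ?C = "\<lambda>x. cands u l x s0 (scanned u l \<times> set (slots k l))"
  define I where "I = (\<lambda>ys s. agree (- ?M) s0 s \<and> (\<forall>\<tau> x. warr s (stamp (Suc l) \<tau>) x \<le> Suc u) \<and>
     (\<forall>\<tau> x. \<tau> \<notin> set ys \<longrightarrow> warr s (stamp (Suc l) \<tau>) x \<le> u) \<and>
     (\<forall>\<tau>\<in>set ys. \<forall>x. ismax {c \<in> ?C x. set (fst c) \<inter> avoid (Suc l) \<tau> x s = {}}
       (cell (Suc u) (Suc l) \<tau> x s)))"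
  have "hoare W (fill k l) s0 (fill_cost u l) (I (slots k (Suc l)))"
    unfolding fill_def fill_cost_def
  proof (rule hoare_seqs[where I = I, OF _ _ order_refl])
    show "I [] s0" using fresh by (auto simp: I_def le_SucI)
  next
    fix ys \<tau> zs s assume sl: "slots k (Suc l) = ys @ \<tau> # zs" and Is: "I ys s"
    then have new: "\<tau> \<notin> set ys" using distinct_slots[of k "Suc l"] by auto
    have ag: "agree (- ?M) s0 s" using Is by (simp add: I_def)
    have ctx_s: "ctx u s" by (rule ctx_agree[OF ctx ag])
      (auto simp: temp_locs_def static_locs_def slot_locs_def)
    have layer_s: "layer u l s" by (rule layer_agree[OF layer ag])
      (auto simp: temp_locs_def slot_locs_def)
    have cands_s: "cands u l x s J = cands u l x s0 J" for x J
      by (rule cands_agree[OF ag]) (auto simp: temp_locs_def slot_locs_def)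
    have fresh_s: "warr s (stamp (Suc l) \<tau>) x \<le> u" for x using Is new by (simp add: I_def)
    note pass = hoare_pass[OF ctx_s layer_s, of \<tau>, OF fresh_s, unfolded cands_s]
    from pass show "hoare W (scan l (upd_all k l \<tau>)) s (scan_cost u l (upd_cost k l \<tau>)) (I (ys @
        [\<tau>]))"
    proof (rule hoare_conseq)
      fix s' assume s': "agree (- (temp_locs \<union> slot_locs (Suc l) \<tau>)) s s' \<and>
        (\<forall>x. warr s' (stamp (Suc l) \<tau>) x \<le> Suc u) \<and>
        (\<forall>x. ismax {c \<in> ?C x. set (fst c) \<inter> avoid (Suc l) \<tau> x s = {}} (cell (Suc u) (Suc l) \<tau> x
            s'))"
      then have ag': "agree (- (temp_locs \<union> slot_locs (Suc l) \<tau>)) s s'" by blast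
      have other: "slot_locs (Suc l) \<tau>' \<subseteq> - (temp_locs \<union> slot_locs (Suc l) \<tau>)" if "\<tau>' \<noteq> \<tau>" for \<tau>'
        using slot_locs_disjoint(1)[of "Suc l" "Suc l" \<tau>' \<tau>] slot_locs_disjoint(2)[of "Suc l" \<tau>']
            that
        by blast
      have stamp': "warr s' (stamp (Suc l) \<tau>') = warr s (stamp (Suc l) \<tau>')" if "\<tau>' \<noteq> \<tau>" for \<tau>'
        by (rule agreeD(2)[OF ag']) (use that in \<open>auto simp: temp_locs_def slot_locs_def\<close>)
      have avoid': "avoid (Suc l) \<tau>' x s' = avoid (Suc l) \<tau>' x s" if "length \<tau>' \<le> length \<tau>" for \<tau>' x
      proof (rule avoid_agree[OF ag' other])
        fix j assume "j < length \<tau>'"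
        then show "take j \<tau>' \<noteq> \<tau>" using that by auto
      qed
      show "I (ys @ [\<tau>]) s'" unfolding I_def
      proof (intro conjI ballI allI impI)
        show "agree (- ?M) s0 s'" by (rule agree_trans[OF ag ag']) auto
        show "warr s' (stamp (Suc l) \<tau>') x \<le> Suc u" for \<tau>' x
          using s' stamp'[of \<tau>'] Is by (cases "\<tau>' = \<tau>") (auto simp: I_def)
        show "warr s' (stamp (Suc l) \<tau>') x \<le> u" if "\<tau>' \<notin> set (ys @ [\<tau>])" for \<tau>' x
          using that stamp'[of \<tau>'] Is by (auto simp: I_def)
        show "ismax {c \<in> ?C x. set (fst c) \<inter> avoid (Suc l) \<tau>' x s' = {}} (cell (Suc u) (Suc l) \<tau>'
            x s')"
          if "\<tau>' \<in> set (ys @ [\<tau>])" for \<tau>' x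
        proof (cases "\<tau>' = \<tau>")
          case True
          then show ?thesis using s' avoid'[of \<tau> x] by simp
        next
          case False
          then have "\<tau>' \<in> set ys" using that by simp
          then show ?thesis
            using Is avoid'[OF slots_sorted[OF sl], of \<tau>' x] cell_agree[OF ag' other[OF False]]
            by (simp add: I_def)
        qed
      qed
    qed simp
  qed
  then show ?thesis
  proof (rule hoare_conseq)
    fix s assume "I (slots k (Suc l)) s"
    then show "agree (- ?M) s0 s \<and> (\<forall>\<tau> x. warr s (stamp (Suc l) \<tau>) x \<le> Suc u) \<and> good u (Suc l) s"
      using good_Suc[OF good l, of s] by (simp add: I_def)
  qed simp
qed

text \<open>Beyond layer \<open>l\<close> no stamp or mark of the current pass occurs, so the next
  \<open>grow\<close> finds its layer empty.\<close>

definition ready :: "nat \<Rightarrow> nat \<Rightarrow> ram_state \<Rightarrow> bool" where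
  "ready u l s \<longleftrightarrow> ctx u s \<and> (\<forall>l'\<le>l. layer u l' s \<and> good u l' s) \<and>
     (\<forall>l' \<tau> x. warr s (stamp l' \<tau>) x \<le> Suc u \<and> warr s (mark l') x \<le> Suc u) \<and>
     (\<forall>l' \<tau> x. l < l' \<longrightarrow> warr s (stamp l' \<tau>) x \<le> u \<and> warr s (mark l') x \<le> u)"

text \<open>The vertices marked with the current stamp are exactly the listed ones, so a vertex
  reached by several half-edges is listed once. This keeps the list within \<open>n\<close> entries
  and its counter below \<open>W\<close>.\<close>

lemma hoare_visit:
  assumes ctx: "ctx u s0" and layer: "layer u l s0" and cnt: "wreg s0 (20 + Suc l) = 0"
    and fresh: "\<And>x. warr s0 (mark (Suc l)) x \<le> u"
  shows "hoare W (scan l (visit l)) s0 (scan_cost u l (csize (visit l))) (\<lambda>s.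
     agree (- (temp_locs \<union> {WA (mark (Suc l)), WA (lst (Suc l)), WR (20 + Suc l)})) s0 s \<and>
     (\<forall>x. warr s (mark (Suc l)) x \<le> Suc u) \<and> layer u (Suc l) s)"
proof -
  let ?M = "scan_locs \<union> mods (visit l)"
  define J where "J = (\<lambda>hs (s :: ram_state). hs \<subseteq> H \<and> (\<exists>L. distinct L \<and> set L = T ` hs \<and> wreg s
      (20 + Suc l) = length L \<and>
     (\<forall>i<length L. warr s (lst (Suc l)) i = L ! i) \<and>
     (\<forall>x. warr s (mark (Suc l)) x \<le> Suc u \<and> (warr s (mark (Suc l)) x = Suc u \<longleftrightarrow> x \<in> set L))))"
  have "hoare W (scan l (visit l)) s0 (scan_cost u l (csize (visit l))) (\<lambda>s. J (scanned u l) s \<and>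
      agree (- ?M) s0 s)"
  proof (rule hoare_scan)
    show "static s0" "wreg s0 5 = dg u" "u < n" "layer u l s0" using ctx layer by (auto simp:
        ctx_def)
    show "mods (visit l) \<inter> (static_locs \<union> {WR 5, WR 6, WR 7, WR 8, WR (20 + l), WA (lst l)}) = {}"
      by (auto simp: mods_visit static_locs_def)
    show "J hs s'" if "J hs s" "agree (- scan_locs) s s'" for hs s s'
    proof -
      have "wreg s' (20 + Suc l) = wreg s (20 + Suc l)" "warr s' (lst (Suc l)) = warr s (lst (Suc
          l))"
        "warr s' (mark (Suc l)) = warr s (mark (Suc l))"
        using agreeD(1,2)[OF that(2)] by auto
      then show ?thesis using that(1) unfolding J_def by simp
    qed
    have "warr s0 (mark (Suc l)) x \<noteq> Suc u \<and> warr s0 (mark (Suc l)) x \<le> Suc u" for x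
      using fresh[of x] by linarith
    then show "J {} s0" using cnt unfolding J_def by (auto intro!: exI[of _ "[]"])
  next
    fix hs h s
    assume ag: "agree (- ?M) s0 s" and Js: "J hs s" and h: "h \<in> scanned u l"
      and r: "wreg s 7 = S h" "wreg s 8 = h" "wreg s 9 = T h"
    have hH: "h \<in> H" using h by (simp add: scanned_def)
    have c: "wreg s 4 = Suc u" "wreg s 2 = 1"
      using agreeD(1)[OF ag] ctx by (auto simp: mods_visit ctx_def static_def)
    obtain L where L: "distinct L" "set L = T ` hs" "wreg s (20 + Suc l) = length L"
      "\<forall>i<length L. warr s (lst (Suc l)) i = L ! i"
      "\<And>x. warr s (mark (Suc l)) x \<le> Suc u" "\<And>x. warr s (mark (Suc l)) x = Suc u \<longleftrightarrow> x \<in> set L"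
      using Js unfolding J_def by auto
    have hs: "insert h hs \<subseteq> H" using Js hH by (simp add: J_def)
    show "hoare W (visit l) s (csize (visit l)) (J (insert h hs))"
    proof (rule hoare_loopfree)
      show "J (insert h hs) (sem W (visit l) s)"
      proof (cases "T h \<in> set L")
        case True
        then have "warr s (mark (Suc l)) (T h) = Suc u" using L(6) by simp
        then have eq: "wreg (sem W (visit l) s) (20 + Suc l) = wreg s (20 + Suc l)"
            "warr (sem W (visit l) s) = warr s"
          using c r by (auto simp: visit_def set_defs)
        show ?thesis unfolding J_def eq
          using hs L True by (intro conjI exI[of _ L]) auto
      next
        case False
        then have "warr s (mark (Suc l)) (T h) \<noteq> Suc u" using L(6) by simp
        moreover have "length L + 1 < W"
        proof -
          have "length L = card (set L)" using L(1) by (simp add: distinct_card)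
          also have "\<dots> \<le> card {..<n}"
            using Js ends unfolding L(2) J_def by (intro card_mono) auto
          finally show ?thesis using W by simp
        qed
        ultimately have eq: "wreg (sem W (visit l) s) (20 + Suc l) = Suc (length L)"
            "warr (sem W (visit l) s) (lst (Suc l)) = (warr s (lst (Suc l)))(length L := T h)"
            "warr (sem W (visit l) s) (mark (Suc l)) = (warr s (mark (Suc l)))(T h := Suc u)"
          using c r L(3) by (auto simp: visit_def set_defs)
        show ?thesis unfolding J_def eq
          using hs L False by (intro conjI exI[of _ "L @ [T h]"]) (auto simp: nth_append
              less_Suc_eq)
      qed
    qed simp_all
  qed
  then show ?thesis
  proof (rule hoare_conseq)
    fix s assume s: "J (scanned u l) s \<and> agree (- ?M) s0 s"
    then have "agree (- (temp_locs \<union> {WA (mark (Suc l)), WA (lst (Suc l)), WR (20 + Suc l)})) s0 s"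
      by (auto simp: mods_visit temp_locs_def intro: agree_mono)
    moreover have "layer u (Suc l) s"
      using s unfolding layer_def J_def by (auto simp: scanned_def)
    ultimately show "agree (- (temp_locs \<union> {WA (mark (Suc l)), WA (lst (Suc l)), WR (20 + Suc
        l)})) s0 s \<and>
     (\<forall>x. warr s (mark (Suc l)) x \<le> Suc u) \<and> layer u (Suc l) s" using s unfolding J_def by blast
  qed simp
qed

definition grow_cost :: "nat \<Rightarrow> nat \<Rightarrow> nat" where
  "grow_cost u l = scan_cost u l (csize (visit l)) + fill_cost u l + 3"

lemma hoare_grow:
  assumes ready: "ready u l s0" and l: "l < k"
  shows "hoare W (grow k l) s0 (grow_cost u l) (ready u (Suc l))"
proof -
  define s1 where "s1 = sem W (WConst (20 + Suc l) 0) s0"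
  have ctx: "ctx u s0" and lg: "\<And>l'. l' \<le> l \<Longrightarrow> layer u l' s0 \<and> good u l' s0"
    and old: "\<And>l' \<tau> x. warr s0 (stamp l' \<tau>) x \<le> Suc u" "\<And>l' x. warr s0 (mark l') x \<le> Suc u"
    and new: "\<And>l' \<tau> x. l < l' \<Longrightarrow> warr s0 (stamp l' \<tau>) x \<le> u" "\<And>l' x. l < l' \<Longrightarrow> warr s0 (mark l') x \<le>
        u"
    using ready unfolding ready_def by auto
  have ag1: "agree (- {WR (20 + Suc l)}) s0 s1" by (auto simp: s1_def set_defs agree_def)
  have ctx1: "ctx u s1" by (rule ctx_agree[OF ctx ag1]) (auto simp: static_locs_def)
  have layer1: "layer u l s1" by (rule layer_agree[OF _ ag1]) (use lg in auto)
  have fresh1: "warr s1 (mark (Suc l)) x \<le> u" for x using new by (auto simp: s1_def set_defs)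
  have cnt1: "wreg s1 (20 + Suc l) = 0" by (simp add: s1_def set_defs)
  let ?M2 = "temp_locs \<union> {WA (mark (Suc l)), WA (lst (Suc l)), WR (20 + Suc l)}"
  let ?M3 = "temp_locs \<union> (\<Union>\<tau>. slot_locs (Suc l) \<tau>)"
  have fill: "hoare W (fill k l) s2 (fill_cost u l) (ready u (Suc l))"
    if s2: "agree (- ?M2) s1 s2 \<and> (\<forall>x. warr s2 (mark (Suc l)) x \<le> Suc u) \<and> layer u (Suc l) s2" for
        s2
  proof -
    have ag2: "agree (- ?M2) s0 s2" by (rule agree_trans[OF ag1 conjunct1[OF s2]]) auto
    have ctx2: "ctx u s2" by (rule ctx_agree[OF ctx ag2]) (auto simp: temp_locs_def static_locs_def)
    have layer2: "layer u l' s2" if "l' \<le> l" for l'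
      by (rule layer_agree[OF _ ag2]) (use lg that in \<open>auto simp: temp_locs_def\<close>)
    have good2: "good u l' s2" if "l' \<le> l" for l'
      by (rule good_agree[OF _ ag2]) (use lg that in \<open>auto simp: temp_locs_def slot_locs_def\<close>)
    have stamp2: "warr s2 (stamp l' \<tau>) = warr s0 (stamp l' \<tau>)" for l' \<tau>
      by (rule agreeD(2)[OF ag2]) (auto simp: temp_locs_def)
    have mark2: "warr s2 (mark l') = warr s0 (mark l')" if "l' \<noteq> Suc l" for l'
      by (rule agreeD(2)[OF ag2]) (use that in \<open>auto simp: temp_locs_def\<close>)
    have "hoare W (fill k l) s2 (fill_cost u l) (\<lambda>s. agree (- ?M3) s2 s \<and>
        (\<forall>\<tau> x. warr s (stamp (Suc l) \<tau>) x \<le> Suc u) \<and> good u (Suc l) s)"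
      by (rule hoare_fill[OF ctx2 layer2 good2 l]) (use new stamp2 in auto)
    then show ?thesis
    proof (rule hoare_conseq)
      fix s assume s: "agree (- ?M3) s2 s \<and> (\<forall>\<tau> x. warr s (stamp (Suc l) \<tau>) x \<le> Suc u) \<and> good u
          (Suc l) s"
      then have ag: "agree (- ?M3) s2 s" by blast
      have ctx3: "ctx u s" by (rule ctx_agree[OF ctx2 ag]) (auto simp: temp_locs_def
          static_locs_def slot_locs_def)
      have layer3: "layer u l' s" if "l' \<le> Suc l" for l'
        by (rule layer_agree[OF _ ag])
          (use s2 layer2[of l'] that in \<open>auto simp: temp_locs_def slot_locs_def le_Suc_eq\<close>)
      have good3: "good u l' s" if "l' \<le> Suc l" for l'
      proof (cases "l' = Suc l")
        case False
        then have "l' \<le> l" using that by simp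
        then show ?thesis by (intro good_agree[OF good2 ag]) (auto simp: temp_locs_def
            slot_locs_def)
      qed (use s in simp)
      have mark3: "warr s (mark l') = warr s2 (mark l')" for l'
        by (rule agreeD(2)[OF ag]) (auto simp: temp_locs_def slot_locs_def)
      have stamp3: "warr s (stamp l' \<tau>) = warr s0 (stamp l' \<tau>)" if "l' \<noteq> Suc l" for l' \<tau>
        unfolding stamp2[symmetric]
        by (rule agreeD(2)[OF ag]) (use that in \<open>auto simp: temp_locs_def slot_locs_def\<close>)
      show "ready u (Suc l) s"
        unfolding ready_def
      proof (intro conjI allI impI)
        show "warr s (stamp l' \<tau>) x \<le> Suc u" for l' \<tau> x
          using s old stamp3 by (cases "l' = Suc l") auto
        show "warr s (mark l') x \<le> Suc u" for l' x
          using s2 mark3 old mark2 by (cases "l' = Suc l") auto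
        show "warr s (stamp l' \<tau>) x \<le> u" "warr s (mark l') x \<le> u" if "Suc l < l'" for l' \<tau> x
          using new that stamp3 mark2 mark3 by auto
      qed (use ctx3 layer3 good3 in auto)
    qed simp
  qed
  have "hoare W (Seq (scan l (visit l)) (fill k l)) s1
      (scan_cost u l (csize (visit l)) + fill_cost u l + 1) (ready u (Suc l))"
    by (rule hoare_Seq[OF hoare_visit[OF ctx1 layer1 cnt1 fresh1] fill]) auto
  then have "hoare W (grow k l) s0 (csize (WConst (20 + Suc l) 0) +
      (scan_cost u l (csize (visit l)) + fill_cost u l + 1) + 1) (ready u (Suc l))"
    unfolding grow_def s1_def by (intro hoare_Seq_loopfree) simp_all
  then show ?thesis by (rule hoare_conseq) (auto simp: grow_cost_def)
qed

end

section \<open>Closing cycles\<close>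

definition check :: "nat \<Rightarrow> com" where
  "check A = seqs [WGet 10 A 9, IfThenElse (WEq 10 4) Skip (WConst 12 0)]"

text \<open>Indices 0 and the last ones are left out because both paths share \<open>u\<close> and
  the meeting vertex.\<close>

definition cross :: "nat \<Rightarrow> nat \<Rightarrow> nat list \<Rightarrow> nat list \<Rightarrow> ((nat \<times> nat) \<times> (nat \<times> nat)) list" where
  "cross k r \<sigma> \<rho> = List.product (map (\<lambda>i. (vtx r \<sigma> i, 9)) [1..<r])
     (map (\<lambda>j. (vtx (k - r) \<rho> j, 9)) [1..<k - r])"

definition emit :: "nat \<Rightarrow> nat \<Rightarrow> nat list \<Rightarrow> nat list \<Rightarrow> nat \<Rightarrow> com" where
  "emit k r \<sigma> \<rho> N = seqs (map (\<lambda>i. seqs [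
     if i \<le> r then WGet 10 (vtx r \<sigma> i) 9 else WGet 10 (vtx (k - r) \<rho> (k - i)) 9,
     WConst 11 i, WPut 2 11 10]) [0..<N])"

text \<open>Register 15, not a sentinel weight, tells whether a cycle is known: weights may be
  negative and there is no least real. The first cycle is therefore accepted without comparing
  weights.\<close>

definition join :: "nat \<Rightarrow> nat \<Rightarrow> nat list \<Rightarrow> nat list \<Rightarrow> com" where
  "join k r \<sigma> \<rho> = seqs [
     WConst 12 1,
     check (stamp r \<sigma>),
     check (stamp (k - r) \<rho>),
     neqs (cross k r \<sigma> \<rho>),
     RGet 1 (val r \<sigma>) 9,
     RGet 2 (val (k - r) \<rho>) 9,
     RAdd 1 1 2,
     IfThenElse (WEq 15 2) (IfThenElse (RLess 3 1) Skip (WConst 12 0)) Skip,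
     IfThenElse (WEq 12 2) (seqs [emit k r \<sigma> \<rho> k, WConst 15 1, RMove 3 1]) Skip]"

lemma loopfree_join[simp]: "loopfree (join k r \<sigma> \<rho>)"
  by (auto simp: join_def check_def neqs_def emit_def)

lemma deterministic_join[simp]: "deterministic (join k r \<sigma> \<rho>)"
  by (auto simp: join_def check_def neqs_def emit_def)

lemma mods_emit: "mods (emit k r \<sigma> \<rho> N) \<subseteq> {WR 10, WR 11, WA 2}"
  by (auto simp: emit_def split: if_splits)

definition best_locs :: "loc set" where
  "best_locs = {WR 15, RR 3, WA 2}"

lemma mods_join: "mods (join k r \<sigma> \<rho>) \<subseteq> {WR 10, WR 11, WR 12, RR 1, RR 2} \<union> best_locs"
  using mods_neqs[of "cross k r \<sigma> \<rho>"] mods_emit[of k r \<sigma> \<rho> k]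
  unfolding join_def check_def best_locs_def by auto

lemma sem_emit:
  assumes "N \<le> W" "i < N"
  shows "warr (sem W (emit k r \<sigma> \<rho> N) s) 2 i =
    (if i \<le> r then warr s (vtx r \<sigma> i) (wreg s 9) else warr s (vtx (k - r) \<rho> (k - i)) (wreg s 9))"
  using assms
proof (induction N)
  case (Suc N)
  define s1 where "s1 = sem W (emit k r \<sigma> \<rho> N) s"
  have "loopfree (emit k r \<sigma> \<rho> N)" by (simp add: emit_def)
  then have s1: "agree (- {WR 10, WR 11, WA 2}) s s1"
    unfolding s1_def using mods_emit by (intro agree_mono[OF sem_frame]) auto
  have eq: "sem W (emit k r \<sigma> \<rho> (Suc N)) s = sem W (seqs [
     if N \<le> r then WGet 10 (vtx r \<sigma> N) 9 else WGet 10 (vtx (k - r) \<rho> (k - N)) 9,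
     WConst 11 N, WPut 2 11 10]) s1"
    by (simp add: emit_def s1_def)
  have same: "wreg s1 9 = wreg s 9" "\<And>A. A \<noteq> 2 \<Longrightarrow> warr s1 A = warr s A"
    using agreeD(1,2)[OF s1] by auto
  have N: "N mod W = N" using Suc.prems by simp
  show ?case
  proof (cases "i = N")
    case True
    then show ?thesis unfolding eq using same N by (auto simp: set_defs)
  next
    case False
    then show ?thesis using Suc N unfolding eq s1_def[symmetric] by (simp add: set_defs)
  qed
qed simp

context weighted_graph
begin

text \<open>A set with at most one element, because a position stores at most one path per
  vertex.\<close>

definition joinable :: "nat \<Rightarrow> nat \<Rightarrow> nat \<Rightarrow> nat list \<Rightarrow> nat list \<Rightarrow> ram_state \<Rightarrow> (nat list \<times> real) set"
    where
  "joinable u r x \<sigma> \<rho> s = {(cyc r p q, a + b) |p a q b. cell (Suc u) r \<sigma> x s = Some (p, a) \<and>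
     cell (Suc u) (k - r) \<rho> x s = Some (q, b) \<and> inner_disjoint r p q}"

text \<open>Stated as a case distinction on the raw locations, as the record is kept in output form:
  flag, weight register and word array 2.\<close>

lemma sem_join:
  fixes s u r \<sigma> \<rho>
  defines "s' \<equiv> sem W (join k r \<sigma> \<rho>) s" and "x \<equiv> wreg s 9"
  assumes c: "wreg s 2 = 1" "wreg s 4 = Suc u" and r: "0 < r" "r < k"
  shows "(wreg s' 15 = wreg s 15 \<and> rreg s' 3 = rreg s 3 \<and> warr s' 2 = warr s 2 \<and>
      (joinable u r x \<sigma> \<rho> s = {} \<or>
        wreg s 15 = 1 \<and> (\<forall>c\<in>joinable u r x \<sigma> \<rho> s. snd c \<le> rreg s 3))) \<or>
    (wreg s' 15 = 1 \<and> (wreg s 15 = 1 \<longrightarrow> rreg s 3 < rreg s' 3) \<and>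
      joinable u r x \<sigma> \<rho> s = {(map (warr s' 2) [0..<k], rreg s' 3)})"
proof -
  have W1: "1 < W" using W by simp
  define s1 where "s1 = sem W (seqs [WConst 12 1, check (stamp r \<sigma>), check (stamp (k - r) \<rho>)]) s"
  define s2 where "s2 = sem W (neqs (cross k r \<sigma> \<rho>)) s1"
  define s3 where "s3 = sem W (seqs [
     RGet 1 (val r \<sigma>) 9,
     RGet 2 (val (k - r) \<rho>) 9,
     RAdd 1 1 2,
     IfThenElse (WEq 15 2) (IfThenElse (RLess 3 1) Skip (WConst 12 0)) Skip]) s2"
  have s': "s' = sem W (IfThenElse (WEq 12 2) (seqs [emit k r \<sigma> \<rho> k, WConst 15 1, RMove 3 1])
      Skip) s3"
    by (simp add: s'_def join_def s3_def s2_def s1_def)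
  define ok where "ok = (warr s (stamp r \<sigma>) x = Suc u \<and> warr s (stamp (k - r) \<rho>) x = Suc u)"
  define p where "p = map (\<lambda>i. warr s (vtx r \<sigma> i) x) [0..<Suc r]"
  define q where "q = map (\<lambda>i. warr s (vtx (k - r) \<rho> i) x) [0..<Suc (k - r)]"
  have pn: "p ! i = warr s (vtx r \<sigma> i) x" if "i \<le> r" for i
    using that by (simp add: p_def nth_append del: upt_Suc)
  have qn: "q ! i = warr s (vtx (k - r) \<rho> i) x" if "i \<le> k - r" for i
    using that by (simp add: q_def nth_append del: upt_Suc)
  define v where "v = rarr s (val r \<sigma>) x + rarr s (val (k - r) \<rho>) x"
  have s1: "warr s1 = warr s" "rarr s1 = rarr s" "rreg s1 = rreg s"
    "\<And>a. a \<notin> {10, 12} \<Longrightarrow> wreg s1 a = wreg s a" "wreg s1 12 = (if ok then 1 else 0)"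
    using W1 c by (auto simp: s1_def check_def set_defs ok_def x_def)
  have "loopfree (neqs (cross k r \<sigma> \<rho>))" by (auto simp: neqs_def)
  then have fr2: "agree (- {WR 10, WR 11, WR 12}) s1 s2"
    unfolding s2_def using mods_neqs by (intro agree_mono[OF sem_frame]) auto
  have set_cross: "set (cross k r \<sigma> \<rho>) = (\<lambda>i. (vtx r \<sigma> i, 9)) ` {1..<r} \<times> (\<lambda>j. (vtx (k - r) \<rho> j,
      9)) ` {1..<k - r}"
    unfolding cross_def by simp
  have bex_prod: "(\<exists>((a, i), (b, j))\<in>A \<times> B. P a i b j) \<longleftrightarrow> (\<exists>(a, i)\<in>A. \<exists>(b, j)\<in>B. P a i b j)"
    for A B :: "(nat \<times> nat) set" and P
    by fastforce
  have "(\<exists>((A, i), (B, j))\<in>set (cross k r \<sigma> \<rho>). warr s1 A (wreg s1 i) = warr s1 B (wreg s1 j)) \<longleftrightarrow>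
      \<not> inner_disjoint r p q"
    unfolding set_cross bex_prod inner_disjoint_def using pn qn
    by (simp add: s1 x_def)
  moreover have "\<forall>((A, i), (B, j))\<in>set (cross k r \<sigma> \<rho>). i \<notin> {10, 11, 12} \<and> j \<notin> {10, 11, 12}"
    unfolding cross_def by auto
  ultimately have s2: "wreg s2 12 = (if ok \<and> inner_disjoint r p q then 1 else 0)"
    unfolding s2_def by (subst sem_neqs) (simp_all add: s1)
  have s2': "warr s2 = warr s" "rarr s2 = rarr s" "\<And>a. a \<notin> {10, 11, 12} \<Longrightarrow> wreg s2 a = wreg s a"
    "rreg s2 3 = rreg s 3"
    using agreeD[OF fr2] s1 by auto
  define improve where "improve = (ok \<and> inner_disjoint r p q \<and> (wreg s 15 = 1 \<longrightarrow> rreg s 3 < v))"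
  have s3: "warr s3 = warr s" "\<And>a. a \<notin> {10, 11, 12} \<Longrightarrow> wreg s3 a = wreg s a"
    "rreg s3 1 = v" "rreg s3 3 = rreg s 3" "wreg s3 12 = (if improve then 1 else 0)"
    using s2 s2' c by (auto simp: s3_def set_defs v_def improve_def x_def)
  have joinable: "joinable u r x \<sigma> \<rho> s = (if ok \<and> inner_disjoint r p q then {(cyc r p q, v)} else
      {})"
    unfolding joinable_def cell_def ok_def p_def q_def v_def by auto
  show ?thesis
  proof (cases improve)
    case False
    then have "s' = s3" unfolding s' using s3 c by auto
    then show ?thesis using s3 False unfolding joinable improve_def by auto
  next
    case True
    define s4 where "s4 = sem W (emit k r \<sigma> \<rho> k) s3"
    have lf: "loopfree (emit k r \<sigma> \<rho> k)" by (simp add: emit_def)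
    have fr4: "agree (- {WR 10, WR 11, WA 2}) s3 s4"
      unfolding s4_def using mods_emit by (intro agree_mono[OF sem_frame[OF lf]]) auto
    have "wreg s' 15 = 1" "rreg s' 3 = v" "warr s' 2 = warr s4 2"
      unfolding s' using True s3 c W1 agreeD[OF fr4] by (auto simp: s4_def[symmetric] set_defs)
    moreover have "map (warr s4 2) [0..<k] = cyc r p q"
    proof (rule nth_equalityI)
      fix i assume "i < length (map (warr s4 2) [0..<k])"
      then have i: "i < k" by simp
      have "warr s4 2 i = (if i \<le> r then warr s (vtx r \<sigma> i) x else warr s (vtx (k - r) \<rho> (k - i))
          x)"
        unfolding s4_def using W(2) i by (subst sem_emit) (simp_all add: s3 x_def)
      then show "map (warr s4 2) [0..<k] ! i = cyc r p q ! i"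
        using i pn[of i] qn[of "k - i"] by (simp add: cyc_def)
    qed (simp add: cyc_def)
    ultimately show ?thesis using True unfolding joinable improve_def by simp
  qed
qed

definition wgt :: "nat list \<Rightarrow> real" where
  "wgt c = weight w (cycle_edges c)"

definition best :: "nat list set \<Rightarrow> ram_state \<Rightarrow> bool" where
  "best C s \<longleftrightarrow> (wreg s 15 = 0 \<and> C = {} \<or>
     wreg s 15 = 1 \<and> is_cycle E k (map (warr s 2) [0..<k]) \<and>
       rreg s 3 = wgt (map (warr s 2) [0..<k]) \<and> (\<forall>c\<in>C. wgt c \<le> rreg s 3))"

lemma best_agree: "best C s \<Longrightarrow> agree X s s' \<Longrightarrow> best_locs \<subseteq> X \<Longrightarrow> best C s'"
  unfolding best_def best_locs_def agree_def by simp

lemma best_dominated: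
  assumes "best C s" "\<And>c'. c' \<in> C' \<Longrightarrow> \<exists>c\<in>C. wgt c' \<le> wgt c"
  shows "best (C \<union> C') s"
proof (cases "C = {}")
  case True
  then have "C' = {}" using assms(2) by auto
  then show ?thesis using assms(1) by simp
next
  case False
  have "wgt c' \<le> rreg s 3" if "c' \<in> C'" for c'
    using assms(1) assms(2)[OF that] False unfolding best_def by (meson order_trans)
  then show ?thesis using assms(1) False unfolding best_def by blast
qed

text \<open>Soundness of the two families makes the joined list a genuine cycle whose weight is the
  sum in the register.\<close>

lemma best_join:
  assumes best: "best C s" and c: "wreg s 2 = 1" "wreg s 4 = Suc u" and r: "0 < r" "r < k"
    and good: "good u r s" "good u (k - r) s" and sl: "\<sigma> \<in> set (slots k r)" "\<rho> \<in> set (slots k (k -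
        r))"
  shows "best (C \<union> fst ` joinable u r (wreg s 9) \<sigma> \<rho> s) (sem W (join k r \<sigma> \<rho>) s)"
proof -
  let ?s' = "sem W (join k r \<sigma> \<rho>) s" and ?J = "joinable u r (wreg s 9) \<sigma> \<rho> s"
  have J: "is_cycle E k c \<and> wgt c = v" if cv: "(c, v) \<in> ?J" for c v
  proof -
    obtain p a q b where pq: "c = cyc r p q" "v = a + b" "cell (Suc u) r \<sigma> (wreg s 9) s = Some (p,
        a)"
      "cell (Suc u) (k - r) \<rho> (wreg s 9) s = Some (q, b)" "inner_disjoint r p q"
      using cv unfolding joinable_def by auto
    then have "low_path u r (wreg s 9) p" "a = pw r p" "low_path u (k - r) (wreg s 9) q" "b = pw
        (k - r) q"
      using good_sound[OF good(1) sl(1)] good_sound[OF good(2) sl(2)] by auto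
    then show ?thesis using cyc_cycle[OF _ _ pq(5) r] pq(1,2) unfolding wgt_def by metis
  qed
  from sem_join[OF c r, of \<sigma> \<rho>] show ?thesis
  proof (elim disjE conjE)
    assume "wreg ?s' 15 = wreg s 15" "rreg ?s' 3 = rreg s 3" "warr ?s' 2 = warr s 2" "?J = {}"
    then show ?thesis using best unfolding best_def by simp
  next
    assume a: "wreg ?s' 15 = wreg s 15" "rreg ?s' 3 = rreg s 3" "warr ?s' 2 = warr s 2"
      "wreg s 15 = 1" "\<forall>c\<in>?J. snd c \<le> rreg s 3"
    then have "\<forall>c\<in>fst ` ?J. wgt c \<le> rreg s 3" using J by force
    then show ?thesis using best a unfolding best_def by auto
  next
    assume a: "wreg ?s' 15 = 1" "wreg s 15 = 1 \<longrightarrow> rreg s 3 < rreg ?s' 3"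
      "?J = {(map (warr ?s' 2) [0..<k], rreg ?s' 3)}"
    then show ?thesis using best J[of "map (warr ?s' 2) [0..<k]" "rreg ?s' 3"]
      unfolding best_def by force
  qed
qed

end

section \<open>Joining all pairs of stored paths\<close>

definition join_all :: "nat \<Rightarrow> nat \<Rightarrow> com" where
  "join_all k r = seqs (map (\<lambda>(\<sigma>, \<rho>). join k r \<sigma> \<rho>) (List.product (slots k r) (slots k (k - r))))"

definition finish :: "nat \<Rightarrow> nat \<Rightarrow> com" where
  "finish k r = Seq (WConst 6 0) (While (WLess 6 (20 + r)) (Seq (WGet 9 (lst r) 6)
     (Seq (join_all k r) (WOp WAdd 6 6 2))))"

lemma loopfree_join_all[simp]: "loopfree (join_all k r)"
  by (auto simp: join_all_def)

lemma mods_join_all: "mods (join_all k r) \<subseteq> {WR 10, WR 11, WR 12, RR 1, RR 2} \<union> best_locs"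
  unfolding join_all_def mods_seqs
proof (rule UN_least)
  fix c assume "c \<in> set (map (\<lambda>(\<sigma>, \<rho>). join k r \<sigma> \<rho>) (List.product (slots k r) (slots k (k - r))))"
  then obtain \<sigma> \<rho> where "c = join k r \<sigma> \<rho>" by auto
  then show "mods c \<subseteq> {WR 10, WR 11, WR 12, RR 1, RR 2} \<union> best_locs" using mods_join by simp
qed

lemma deterministic_finish[simp]: "deterministic (finish k r)"
  by (auto simp: finish_def join_all_def)

context weighted_graph
begin

definition joined :: "nat \<Rightarrow> nat \<Rightarrow> nat \<Rightarrow> ram_state \<Rightarrow> nat list set" where
  "joined u r x s = (\<Union>(\<sigma>, \<rho>)\<in>set (slots k r) \<times> set (slots k (k - r)). fst ` joinable u r x \<sigma> \<rho> s)"

lemma joinable_agree: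
  assumes "agree X s s'" "\<And>l \<tau>. slot_locs l \<tau> \<subseteq> X"
  shows "joinable u r x \<sigma> \<rho> s' = joinable u r x \<sigma> \<rho> s"
  unfolding joinable_def cell_agree[OF assms] ..

text \<open>Joins write only scratch locations and the record, so all cells can be read in the
  initial state \<open>s0\<close>.\<close>

lemma best_join_all:
  assumes best: "best C s0" and ctx: "ctx u s0" and r: "0 < r" "r < k"
    and good: "good u r s0" "good u (k - r) s0"
  shows "best (C \<union> joined u r (wreg s0 9) s0) (sem W (join_all k r) s0)"
proof -
  let ?M = "{WR 10, WR 11, WR 12, RR 1, RR 2} \<union> best_locs"
  let ?D = "\<lambda>ps. \<Union>(\<sigma>, \<rho>)\<in>ps. fst ` joinable u r (wreg s0 9) \<sigma> \<rho> s0"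
  have "set ps \<subseteq> set (slots k r) \<times> set (slots k (k - r)) \<Longrightarrow> best C' s \<Longrightarrow> agree (- ?M) s0 s \<Longrightarrow>
    best (C' \<union> ?D (set ps)) (sem W (seqs (map (\<lambda>(\<sigma>, \<rho>). join k r \<sigma> \<rho>) ps)) s)" for ps C' s
  proof (induction ps arbitrary: C' s)
    case (Cons a ps)
    obtain \<sigma> \<rho> where a: "a = (\<sigma>, \<rho>)" by (cases a)
    have ctx_s: "ctx u s" by (rule ctx_agree[OF ctx Cons.prems(3)]) (auto simp: static_locs_def
        best_locs_def)
    have sub: "slot_locs l \<tau> \<subseteq> - ?M" for l \<tau> by (auto simp: slot_locs_def best_locs_def)
    note good_s = good(1)[THEN good_agree, OF Cons.prems(3) sub] good(2)[THEN good_agree, OF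
        Cons.prems(3) sub]
    have r9: "wreg s 9 = wreg s0 9" using agreeD(1)[OF Cons.prems(3)] by (auto simp: best_locs_def)
    have 1: "best (C' \<union> fst ` joinable u r (wreg s0 9) \<sigma> \<rho> s0) (sem W (join k r \<sigma> \<rho>) s)"
      using best_join[OF Cons.prems(2) _ _ r good_s, of \<sigma> \<rho>] ctx_s Cons.prems(1) a
      unfolding joinable_agree[OF Cons.prems(3) sub] r9 by (simp add: ctx_def static_def)
    have 2: "agree (- ?M) s0 (sem W (join k r \<sigma> \<rho>) s)"
      by (rule agree_trans[OF Cons.prems(3) sem_frame]) (use mods_join in auto)
    show ?case using Cons.IH[OF _ 1 2] Cons.prems(1) by (simp add: a Un_assoc)
  qed simp
  from this[of "List.product (slots k r) (slots k (k - r))" C s0] best show ?thesis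
    unfolding join_all_def joined_def by simp
qed

lemma hoare_finish:
  assumes best: "best C s0" and ctx: "ctx u s0" and r: "0 < r" "r < k"
    and good: "good u r s0" "good u (k - r) s0" and layer: "layer u r s0"
  shows "hoare W (finish k r) s0 ((csize (join_all k r) + 6) * (card (Lset u r) + 1))
    (\<lambda>s. best (C \<union> (\<Union>x\<in>Lset u r. joined u r x s0)) s \<and> agree (- (temp_locs \<union> best_locs)) s0 s)"
proof -
  let ?M = "temp_locs \<union> best_locs"
  obtain L where L: "distinct L" "set L = Lset u r" "wreg s0 (20 + r) = length L"
    "\<And>i. i < length L \<Longrightarrow> warr s0 (lst r) i = L ! i"
    using layer unfolding layer_def by blast
  have lenL: "length L \<le> n"
  proof -
    have "length L = card (set L)" using L(1) by (simp add: distinct_card)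
    also have "\<dots> \<le> card {..<n}" using Lset_bounds ctx L(2) by (intro card_mono) (auto simp: ctx_def)
    finally show ?thesis by simp
  qed
  define I where "I = (\<lambda>(ys :: nat list) (zs :: nat list) s. agree (- ?M) s0 s \<and> wreg s 6 = length
      ys \<and>
    best (C \<union> (\<Union>x\<in>set ys. joined u r x s0)) s)"
  let ?body = "Seq (WGet 9 (lst r) 6) (Seq (join_all k r) (WOp WAdd 6 6 2))"
  have loop: "hoare W (While (WLess 6 (20 + r)) ?body) (sem W (WConst 6 0) s0)
      ((\<Sum>z\<leftarrow>L. (csize (join_all k r) + 4) + 1) + 1) (I L [])"
  proof (rule hoare_While_list[where I = I, OF _ _ _ order_refl])
    fix ys z zs s assume Ls: "L = ys @ z # zs" and Is: "I ys (z # zs) s"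
    have ag: "agree (- ?M) s0 s" and r6: "wreg s 6 = length ys"
      and best_s: "best (C \<union> (\<Union>x\<in>set ys. joined u r x s0)) s" using Is by (auto simp: I_def)
    have lz: "L ! length ys = z" and ly: "length ys < length L" using Ls by auto
    have r20: "wreg s (20 + r) = length L" "warr s (lst r) = warr s0 (lst r)"
      using agreeD(1,2)[OF ag] L(3) by (auto simp: temp_locs_def best_locs_def)
    define s1 where "s1 = sem W (WGet 9 (lst r) 6) s"
    define s2 where "s2 = sem W (join_all k r) s1"
    have "agree (- {WR 9}) s s1" by (auto simp: s1_def set_defs agree_def)
    then have ag1: "agree (- ?M) s0 s1" and best1: "best (C \<union> (\<Union>x\<in>set ys. joined u r x s0)) s1"
      using best_agree[OF best_s] by (auto simp: temp_locs_def best_locs_def intro: agree_trans[OF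
          ag])
    have r1: "wreg s1 9 = z" "wreg s1 6 = length ys"
      using r6 r20 L(4)[OF ly] lz by (auto simp: s1_def set_defs)
    have ctx1: "ctx u s1" by (rule ctx_agree[OF ctx ag1]) (auto simp: static_locs_def
        temp_locs_def best_locs_def)
    have sub: "slot_locs l \<tau> \<subseteq> - ?M" for l \<tau> by (auto simp: slot_locs_def best_locs_def
        temp_locs_def)
    have joined1: "joined u r x s1 = joined u r x s0" for x
      unfolding joined_def joinable_agree[OF ag1 sub] ..
    have best2: "best ((C \<union> (\<Union>x\<in>set ys. joined u r x s0)) \<union> joined u r z s0) s2"
      using best_join_all[OF best1 ctx1 r good_agree[OF good(1) ag1 sub] good_agree[OF good(2) ag1
          sub]]
      unfolding s2_def joined1 r1 .
    have fr2: "agree (- ({WR 10, WR 11, WR 12, RR 1, RR 2} \<union> best_locs)) s1 s2"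
      unfolding s2_def using mods_join_all by (intro agree_mono[OF sem_frame]) auto
    have ag2: "agree (- ?M) s0 s2" by (rule agree_trans[OF ag1 fr2]) (auto simp: temp_locs_def)
    have r2: "wreg s2 6 = length ys" "wreg s2 2 = 1"
      using agreeD(1)[OF fr2] r1 ctx1 by (auto simp: best_locs_def ctx_def static_def)
    define s3 where "s3 = sem W (WOp WAdd 6 6 2) s2"
    have fr3: "agree (- {WR 6}) s2 s3" by (auto simp: s3_def set_defs agree_def)
    have "I (ys @ [z]) zs s3"
      unfolding I_def
    proof (intro conjI)
      show "agree (- ?M) s0 s3" by (rule agree_trans[OF ag2 fr3]) (auto simp: temp_locs_def)
      show "wreg s3 6 = length (ys @ [z])" using r2 ly lenL W by (simp add: s3_def set_defs)
      have "(C \<union> (\<Union>x\<in>set ys. joined u r x s0)) \<union> joined u r z s0 = C \<union> (\<Union>x\<in>set (ys @ [z]). joined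
          u r x s0)"
        by auto
      then show "best (C \<union> (\<Union>x\<in>set (ys @ [z]). joined u r x s0)) s3"
        using best_agree[OF best2 fr3] by (auto simp: best_locs_def)
    qed
    then have "hoare W ?body s (csize (join_all k r) + 4) (I (ys @ [z]) zs)"
      by (intro hoare_loopfree) (simp_all add: s1_def s2_def s3_def)
    then show "test_val (WLess 6 (20 + r)) s \<and> hoare W ?body s (csize (join_all k r) + 4) (I (ys @
        [z]) zs)"
      using r6 r20 ly by simp
  next
    show "\<not> test_val (WLess 6 (20 + r)) s" if "I L [] s" for s
      using that L(3) agreeD(1)[of "- ?M" s0 s "20 + r"] by (auto simp: I_def temp_locs_def
          best_locs_def)
    have a: "agree (- {WR 6}) s0 (sem W (WConst 6 0) s0)" by (auto simp: set_defs agree_def)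
    then have "agree (- ?M) s0 (sem W (WConst 6 0) s0)" by (rule agree_mono) (auto simp:
        temp_locs_def)
    moreover have "wreg (sem W (WConst 6 0) s0) 6 = 0" by (simp add: set_defs)
    moreover have "best C (sem W (WConst 6 0) s0)" by (rule best_agree[OF best a]) (auto simp:
        best_locs_def)
    ultimately show "I [] L (sem W (WConst 6 0) s0)" by (simp add: I_def)
  qed
  have "hoare W (finish k r) s0 (csize (WConst 6 0) + ((\<Sum>z\<leftarrow>L. (csize (join_all k r) + 4) + 1) + 1)
      + 1) (I L [])"
    unfolding finish_def by (rule hoare_Seq_loopfree[OF _ loop]) simp
  then show ?thesis
  proof (rule hoare_conseq)
    have "card (Lset u r) = length L" using L(1,2) by (metis distinct_card)
    then show "csize (WConst 6 0) + ((\<Sum>z\<leftarrow>L. (csize (join_all k r) + 4) + 1) + 1) + 1 \<le>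
        (csize (join_all k r) + 6) * (card (Lset u r) + 1)"
      by (simp add: sum_list_triv algebra_simps)
    fix s assume "I L [] s"
    then show "best (C \<union> (\<Union>x\<in>Lset u r. joined u r x s0)) s \<and> agree (- ?M) s0 s"
      using L(2) by (simp add: I_def)
  qed
qed

text \<open>Both families being representative, an arbitrary pair of paths is replaced by stored ones
  one after the other: first the long path, keeping it off the short one, then the short path,
  keeping it off the replacement.\<close>

lemma joined_dominates:
  assumes c: "is_cycle E k vs" "vs ! 0 = u" "\<forall>v\<in>set vs. dg v \<le> dg u" and r: "0 < r" "r < k"
    and good: "good u r s" "good u (k - r) s"
  shows "\<exists>x\<in>Lset u r. \<exists>c\<in>joined u r x s. wgt vs \<le> wgt c"
proof -
  obtain x p q where pq: "low_path u r x p" "low_path u (k - r) x q" "inner_disjoint r p q"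
    "weight w (cycle_edges vs) = pw r p + pw (k - r) q"
    by (rule cycle_split[OF c r])
  have pos: "\<exists>i\<le>l. v = p ! i" if "low_path u l x p" "v \<in> set p" for v l p
    using that by (auto simp: low_path_def in_set_conv_nth less_Suc_eq_le)
  have ends: "p ! 0 = u" "p ! l = x" if "low_path u l x p" for l p
    using that by (auto simp: low_path_def)
  have neq: "p ! i \<noteq> p ! j" if "low_path u l x p" "i \<le> l" "j \<le> l" "i \<noteq> j" for i j l p
    using that by (auto simp: low_path_def nth_eq_iff_index_eq)
  define Y where "Y = (\<lambda>j. q ! j) ` {1..<k - r}"
  have cardY: "finite Y" "card Y \<le> k - r"
    unfolding Y_def using card_image_le[of "{1..<k - r}" "\<lambda>j. q ! j"] by simp_all
  have disjY: "set p \<inter> Y = {}"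
  proof -
    have "p ! i \<noteq> q ! j" if ij: "i \<le> r" "j \<in> {1..<k - r}" for i j
    proof -
      consider "i = 0" | "i = r" | "i \<in> {1..<r}" using ij by fastforce
      then show ?thesis
      proof cases
        case 1 then show ?thesis using ends[OF pq(1)] ends[OF pq(2)] neq[OF pq(2), of 0 j] that by
            auto
      next
        case 2 then show ?thesis using ends[OF pq(1)] ends[OF pq(2)] neq[OF pq(2), of "k - r" j]
            that by auto
      next
        case 3 then show ?thesis using pq(3) that by (auto simp: inner_disjoint_def)
      qed
    qed
    then show ?thesis using pos[OF pq(1)] unfolding Y_def by fastforce
  qed
  obtain \<sigma> p' a where p': "\<sigma> \<in> set (slots k r)" "cell (Suc u) r \<sigma> x s = Some (p', a)"
    "set p' \<inter> Y = {}" "pw r p \<le> a"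
    by (rule good_complete[OF good(1) pq(1) cardY disjY])
  then have path': "low_path u r x p'" "a = pw r p'" using good_sound[OF good(1) p'(1,2)] by auto
  define Z where "Z = (\<lambda>i. p' ! i) ` {1..<r}"
  have cardZ: "finite Z" "card Z \<le> k - (k - r)"
    unfolding Z_def using card_image_le[of "{1..<r}" "\<lambda>j. p' ! j"] r by simp_all
  \<comment> \<open>The endpoints of \<open>q\<close> are those of \<open>p'\<close>, and its inner
    vertices form \<open>Y\<close>, which \<open>p'\<close> avoids.\<close>
  have disjZ: "set q \<inter> Z = {}"
  proof -
    have "q ! j \<noteq> p' ! i" if ij: "j \<le> k - r" "i \<in> {1..<r}" for i j
    proof -
      consider "j = 0" | "j = k - r" | "j \<in> {1..<k - r}" using ij by fastforce
      then show ?thesis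
      proof cases
        case 1 then show ?thesis using ends[OF path'(1)] ends[OF pq(2)] neq[OF path'(1), of 0 i]
            that by auto
      next
        case 2 then show ?thesis using ends[OF path'(1)] ends[OF pq(2)] neq[OF path'(1), of r i]
            that by auto
      next
        case 3
        have "p' ! i \<in> set p'" using path'(1) that by (auto simp: low_path_def)
        moreover have "q ! j \<in> Y" using 3 by (auto simp: Y_def)
        ultimately show ?thesis using p'(3) by auto
      qed
    qed
    then show ?thesis using pos[OF pq(2)] unfolding Z_def by fastforce
  qed
  obtain \<rho> q' b where q': "\<rho> \<in> set (slots k (k - r))" "cell (Suc u) (k - r) \<rho> x s = Some (q', b)"
    "set q' \<inter> Z = {}" "pw (k - r) q \<le> b"
    by (rule good_complete[OF good(2) pq(2) cardZ disjZ])
  then have path'': "low_path u (k - r) x q'" "b = pw (k - r) q'" using good_sound[OF good(2)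
      q'(1,2)] by auto
  have d: "inner_disjoint r p' q'"
    unfolding inner_disjoint_def
  proof (intro ballI)
    fix i j assume "i \<in> {1..<r}" "j \<in> {1..<k - r}"
    then have "q' ! j \<in> set q'" "p' ! i \<in> Z" using path''(1) by (auto simp: low_path_def Z_def)
    then show "p' ! i \<noteq> q' ! j" using q'(3) by auto
  qed
  have "(cyc r p' q', a + b) \<in> joinable u r x \<sigma> \<rho> s"
    unfolding joinable_def using p' q' d by blast
  then have "cyc r p' q' \<in> joined u r x s" unfolding joined_def using p'(1) q'(1) by force
  moreover have "wgt vs \<le> wgt (cyc r p' q')"
    using cyc_cycle(2)[OF path'(1) path''(1) d r] pq(4) p'(4) q'(4) path'(2) path''(2) by (simp
        add: wgt_def)
  moreover have "x \<in> Lset u r" using low_path_Lset pq(1) .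
  ultimately show ?thesis by blast
qed

end

section \<open>The pass for one vertex\<close>

definition start :: com where
  "start = seqs [
     WOp WAdd 4 3 2,
     WGet 5 6 3,
     WConst 20 1,
     WPut (lst 0) 14 3,
     WPut (stamp 0 []) 3 4,
     WPut (vtx 0 [] 0) 3 3,
     RPut (val 0 []) 3 0]"

definition vertex_pass :: "nat \<Rightarrow> nat \<Rightarrow> com" where
  "vertex_pass k r = Seq start (Seq (seqs (map (grow k) [0..<r])) (Seq (finish k r) (WOp WAdd 3 3
      2)))"

lemma deterministic_vertex_pass[simp]: "deterministic (vertex_pass k r)"
  by (auto simp: vertex_pass_def start_def)

context weighted_graph
begin

text \<open>Between passes the coming stamp \<open>u + 1\<close> occurs nowhere, so every entry
  already counts as empty.\<close>

definition idle :: "nat \<Rightarrow> ram_state \<Rightarrow> bool" where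
  "idle u s \<longleftrightarrow> static s \<and> wreg s 3 = u \<and>
     (\<forall>l \<tau> x. warr s (stamp l \<tau>) x \<le> u \<and> warr s (mark l) x \<le> u)"

text \<open>The family of layer 0 is the one-vertex path of weight 0. The second claim carries the
  record of the best cycle into the pass.\<close>

lemma ready_start:
  assumes "idle u s" "u < n"
  shows "ready u 0 (sem W start s)" "agree best_locs s (sem W start s)"
proof -
  let ?s = "sem W start s"
  have W1: "Suc u < W" "1 < W" using assms(2) W by auto
  have st: "static s" "wreg s 3 = u" "wreg s 2 = 1" "wreg s 14 = 0" "rreg s 0 = 0" "warr s 6 u =
      dg u"
    and old: "\<And>l \<tau> x. warr s (stamp l \<tau>) x \<le> u" "\<And>l x. warr s (mark l) x \<le> u"
    using assms by (auto simp: idle_def static_def)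
  have fr: "agree (- mods start) s ?s" by (rule sem_frame) (simp add: start_def)
  have "static ?s" by (rule static_agree[OF st(1) fr]) (auto simp: start_def static_locs_def)
  then have ctx: "ctx u ?s"
    using st W1 assms(2) by (auto simp: ctx_def start_def set_defs)
  have "layer u 0 ?s"
    unfolding layer_def using st W1 by (intro exI[of _ "[u]"]) (auto simp: start_def set_defs)
  moreover have stamp: "warr ?s (stamp l \<tau>) = (if l = 0 \<and> \<tau> = [] then (warr s (stamp l \<tau>))(u :=
      Suc u) else warr s (stamp l \<tau>))"
    for l \<tau> using st W1 by (auto simp: start_def set_defs)
  have mark: "warr ?s (mark l) = warr s (mark l)" for l by (auto simp: start_def set_defs)
  have cell: "cell (Suc u) 0 [] x ?s = (if x = u then Some ([u], 0) else None)" for x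
  proof -
    have "warr s (stamp 0 []) x \<noteq> Suc u" using old(1)[of 0 "[]" x] by linarith
    then show ?thesis using st W1 by (auto simp: cell_def start_def set_defs)
  qed
  have "good u 0 ?s"
    unfolding good_def
  proof (intro conjI ballI allI impI)
    fix \<sigma> x p v assume "\<sigma> \<in> set (slots k 0)" "cell (Suc u) 0 \<sigma> x ?s = Some (p, v)"
    then have "x = u" "p = [u]" "v = 0" using cell[of x] by (auto split: if_splits)
    then show "low_path u 0 x p" "v = pw 0 p" using assms(2) by (auto simp: low_path_def pw_def)
  next
    fix x p and Y :: "nat set" assume p: "low_path u 0 x p" and Y: "set p \<inter> Y = {}"
    then have "p = [u]" "x = u" by (auto simp: low_path_def length_Suc_conv)
    then show "\<exists>\<sigma>\<in>set (slots k 0). \<exists>q v. cell (Suc u) 0 \<sigma> x ?s = Some (q, v) \<and> set q \<inter> Y = {} \<and> pw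
        0 p \<le> v"
      using Y cell[of u] by (auto simp: pw_def)
  qed
  ultimately show "ready u 0 ?s"
    using ctx old unfolding ready_def stamp mark by (auto simp: le_SucI)
  show "agree best_locs s ?s" by (rule agree_mono[OF fr]) (auto simp: start_def best_locs_def)
qed

definition vertex_pass_cost :: "nat \<Rightarrow> nat \<Rightarrow> nat" where
  "vertex_pass_cost r u = csize start + ((\<Sum>l\<leftarrow>[0..<r]. grow_cost u l + 1) + 1 +
     ((csize (join_all k r) + 6) * (card (Lset u r) + 1) + 1 + 1) + 1) + 1"

lemma mods_grow: "mods (grow k l) \<inter> best_locs = {}"
proof -
  have "mods (upd_all k l \<tau>) \<inter> best_locs = {}" for \<tau>
    using mods_upd_all[of k l \<tau>] by (fastforce simp: best_locs_def slot_locs_def)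
  then show ?thesis by (auto simp: grow_def fill_def mods_scan mods_visit best_locs_def)
qed

text \<open>By \<open>k - r \<le> r\<close>, growing up to layer \<open>r\<close> also provides the
  family of the shorter path. The joined cycles are then traded for all cycles that start at
  \<open>u\<close> and have largest degree there.\<close>

lemma hoare_vertex_pass:
  assumes idle: "idle u s0" and u: "u < n" and best: "best C s0" and r: "0 < r" "r < k" "k - r \<le> r"
  shows "hoare W (vertex_pass k r) s0 (vertex_pass_cost r u) (\<lambda>s. idle (Suc u) s \<and>
    best (C \<union> {vs. is_cycle E k vs \<and> vs ! 0 = u \<and> (\<forall>v\<in>set vs. dg v \<le> dg u)}) s)"
proof -
  define s1 where "s1 = sem W start s0"
  note s1 = ready_start[OF idle u, folded s1_def]
  have best1: "best C s1" by (rule best_agree[OF best s1(2)]) simp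
  have last: "hoare W (WOp WAdd 3 3 2) s 1 (\<lambda>s. idle (Suc u) s \<and>
     best (C \<union> {vs. is_cycle E k vs \<and> vs ! 0 = u \<and> (\<forall>v\<in>set vs. dg v \<le> dg u)}) s)"
    if ready: "ready u r s2" and s: "best (C \<union> (\<Union>x\<in>Lset u r. joined u r x s2)) s \<and>
      agree (- (temp_locs \<union> best_locs)) s2 s" for s2 s
  proof (rule hoare_loopfree)
    define s' where "s' = sem W (WOp WAdd 3 3 2) s"
    have ag: "agree (- (temp_locs \<union> best_locs)) s2 s" using s by blast
    have ctx: "ctx u s" by (rule ctx_agree[OF _ ag])
      (use ready in \<open>auto simp: ready_def static_locs_def temp_locs_def best_locs_def\<close>)
    have fr: "agree (- {WR 3}) s s'" by (auto simp: s'_def set_defs agree_def)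
    have "static s'" by (rule static_agree[OF _ fr]) (use ctx in \<open>auto simp: ctx_def
        static_locs_def\<close>)
    moreover have "wreg s' 3 = Suc u" using ctx u W by (simp add: s'_def set_defs ctx_def
        static_def)
    moreover have "warr s' (stamp l \<tau>) = warr s2 (stamp l \<tau>)" "warr s' (mark l) = warr s2 (mark
        l)" for l \<tau>
      using agreeD(2)[OF ag] by (auto simp: s'_def set_defs temp_locs_def best_locs_def)
    ultimately have "idle (Suc u) s'" using ready by (simp add: idle_def ready_def)
    moreover have "best (C \<union> (\<Union>x\<in>Lset u r. joined u r x s2) \<union>
        {vs. is_cycle E k vs \<and> vs ! 0 = u \<and> (\<forall>v\<in>set vs. dg v \<le> dg u)}) s'"
    proof (rule best_dominated)
      show "best (C \<union> (\<Union>x\<in>Lset u r. joined u r x s2)) s'"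
        by (rule best_agree[OF _ fr]) (use s in \<open>auto simp: best_locs_def\<close>)
      have good: "good u r s2" "good u (k - r) s2" using ready r by (auto simp: ready_def)
      fix vs assume "vs \<in> {vs. is_cycle E k vs \<and> vs ! 0 = u \<and> (\<forall>v\<in>set vs. dg v \<le> dg u)}"
      then show "\<exists>c\<in>C \<union> (\<Union>x\<in>Lset u r. joined u r x s2). wgt vs \<le> wgt c"
        using joined_dominates[OF _ _ _ r(1,2) good, of vs] by blast
    qed
    \<comment> \<open>The joined cycles are dropped, so that the invariant speaks of the graph and
      not of memory contents.\<close>
    then have "best (C \<union> {vs. is_cycle E k vs \<and> vs ! 0 = u \<and> (\<forall>v\<in>set vs. dg v \<le> dg u)}) s'"
      unfolding best_def by auto
    ultimately show "idle (Suc u) (sem W (WOp WAdd 3 3 2) s) \<and>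
     best (C \<union> {vs. is_cycle E k vs \<and> vs ! 0 = u \<and> (\<forall>v\<in>set vs. dg v \<le> dg u)}) (sem W (WOp WAdd 3 3
         2) s)"
      unfolding s'_def by blast
  qed simp_all
  have grow: "hoare W (seqs (map (grow k) [0..<r])) s1 ((\<Sum>l\<leftarrow>[0..<r]. grow_cost u l + 1) + 1)
      (\<lambda>s. ready u (length [0..<r]) s \<and> best C s)"
  proof (rule hoare_seqs[where I = "\<lambda>ys s. ready u (length ys) s \<and> best C s", OF _ _ order_refl])
    show "ready u (length []) s1 \<and> best C s1" using s1 best1 by simp
    fix ys l zs s assume ys: "[0..<r] = ys @ l # zs" and s: "ready u (length ys) s \<and> best C s"
    have l: "l = length ys" "l < r"
    proof -
      have "length ys < r" using arg_cong[OF ys, of length] by simp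
      moreover have "[0..<r] ! length ys = l" by (simp add: ys)
      ultimately show "l = length ys" "l < r" by auto
    qed
    from hoare_frame[OF hoare_grow[of u l s]] s l r(2)
    have "hoare W (grow k l) s (grow_cost u l) (\<lambda>s'. ready u (Suc l) s' \<and> agree (- mods (grow k
        l)) s s')"
      by simp
    then show "hoare W (grow k l) s (grow_cost u l) (\<lambda>s. ready u (length (ys @ [l])) s \<and> best C s)"
    proof (rule hoare_conseq)
      fix s' assume s': "ready u (Suc l) s' \<and> agree (- mods (grow k l)) s s'"
      have "best C s'" by (rule best_agree[OF _ conjunct2[OF s']]) (use s mods_grow[of l] in auto)
      then show "ready u (length (ys @ [l])) s' \<and> best C s'" using s' l by simp
    qed simp
  qed
  have rest: "hoare W (Seq (finish k r) (WOp WAdd 3 3 2)) s2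
      ((csize (join_all k r) + 6) * (card (Lset u r) + 1) + 1 + 1) (\<lambda>s. idle (Suc u) s \<and>
     best (C \<union> {vs. is_cycle E k vs \<and> vs ! 0 = u \<and> (\<forall>v\<in>set vs. dg v \<le> dg u)}) s)"
    if s2: "ready u (length [0..<r]) s2 \<and> best C s2" for s2
  proof (rule hoare_Seq[OF hoare_finish last])
    show "best C s2" "ctx u s2" "0 < r" "r < k" "good u r s2" "good u (k - r) s2" "layer u r s2"
      "ready u r s2"
      using s2 r by (auto simp: ready_def)
  qed auto
  have "hoare W (Seq (seqs (map (grow k) [0..<r])) (Seq (finish k r) (WOp WAdd 3 3 2))) s1
      ((\<Sum>l\<leftarrow>[0..<r]. grow_cost u l + 1) + 1 + ((csize (join_all k r) + 6) * (card (Lset u r) + 1) +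
          1 + 1) + 1)
      (\<lambda>s. idle (Suc u) s \<and>
     best (C \<union> {vs. is_cycle E k vs \<and> vs ! 0 = u \<and> (\<forall>v\<in>set vs. dg v \<le> dg u)}) s)"
    by (rule hoare_Seq[OF grow rest]) auto
  then show ?thesis
    unfolding vertex_pass_def s1_def vertex_pass_cost_def by (intro hoare_Seq_loopfree) (simp add:
        start_def)
qed

end

section \<open>The algorithm and its running time\<close>

text \<open>Prepending takes constant time, and the head of an empty list is 0 in the initial
  memory, so the end mark needs no code.\<close>

definition link :: "nat \<Rightarrow> nat \<Rightarrow> nat \<Rightarrow> com" where
  "link h a b = seqs [
     WPut 5 h b,
     RPut 1 h 1,
     WGet 10 3 a,
     WPut 4 h 10,
     WPut 3 a h,
     WGet 10 6 a,
     WOp WAdd 10 10 2,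
     WPut 6 a 10]"

definition build_body :: com where
  "build_body = seqs [
     WGet 7 0 6,
     WGet 9 1 6,
     RGet 1 0 6,
     WOp WAdd 6 6 2,
     link 6 7 9,
     WOp WAdd 8 1 6,
     link 8 9 7]"

definition build :: com where
  "build = Seq (WConst 2 1) (Seq (WConst 6 0) (While (WLess 6 1) build_body))"

text \<open>A word move is expressed as addition of the zero in register 14. Register 0 has to keep
  \<open>n\<close> until the loop over the vertices is over.\<close>

definition algorithm :: "nat \<Rightarrow> com" where
  "algorithm k = Seq build (Seq (While (WLess 3 0) (vertex_pass k ((k + 1) div 2))) (WOp WAdd 0 15
      14))"

lemma deterministic_algorithm: "deterministic (algorithm k)"
  by (simp add: algorithm_def build_def build_body_def link_def)

lemma chain_cong:
  "\<forall>z\<in>set hs. nx z = nx' z \<Longrightarrow> chain nx h hs \<longleftrightarrow> chain nx' h hs"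
  by (induction hs arbitrary: h) auto

context weighted_graph
begin

text \<open>The graph part of \<open>static\<close> for the half-edges inserted so far; it is
  complete at \<open>K = H\<close>.\<close>

definition linked :: "nat set \<Rightarrow> ram_state \<Rightarrow> bool" where
  "linked K s \<longleftrightarrow>
     (\<forall>y<n. warr s 6 y = card {h \<in> K. S h = y} \<and>
       (\<exists>hs. distinct hs \<and> set hs = {h \<in> K. S h = y} \<and> chain (warr s 4) (warr s 3 y) hs)) \<and>
     (\<forall>h\<in>K. warr s 5 h = T h \<and> rarr s 1 h = w {S h, T h})"

lemma linked_agree:
  "linked K s \<Longrightarrow> agree X s s' \<Longrightarrow> {WA 3, WA 4, WA 5, WA 6, RA 1} \<subseteq> X \<Longrightarrow> linked K s'"
  unfolding linked_def agree_def by simp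

lemma linked_insert:
  assumes K: "linked K s" "K \<subseteq> H" and h: "h \<in> H" "h \<notin> K"
    and regs: "wreg s hr = h" "wreg s ar = S h" "wreg s br = T h" "rreg s 1 = w {S h, T h}" "wreg
        s 2 = 1"
    and names: "10 \<notin> {hr, ar, br}"
  shows "linked (insert h K) (sem W (link hr ar br) s)"
proof -
  let ?s = "sem W (link hr ar br) s"
  have Sn: "S h < n" using ends[OF h(1)] by simp
  have finK: "finite K" using finite_subset[OF K(2)] by simp
  have "card {h \<in> K. S h = S h'} + 1 < W" for h'
  proof -
    have "card {h \<in> K. S h = S h'} \<le> card H" using K(2) by (intro card_mono) auto
    then show ?thesis using W(1) by (simp add: H_def m_def)
  qed
  then have deg: "warr s 6 (S h) + 1 < W" using K(1) Sn by (simp add: linked_def)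
  have s': "warr ?s 5 = (warr s 5)(h := T h)" "rarr ?s 1 = (rarr s 1)(h := w {S h, T h})"
    "warr ?s 4 = (warr s 4)(h := warr s 3 (S h))" "warr ?s 3 = (warr s 3)(S h := h)"
    "warr ?s 6 = (warr s 6)(S h := warr s 6 (S h) + 1)"
    using regs names deg by (auto simp: link_def set_defs)
  show ?thesis
    unfolding linked_def s'
  proof (intro conjI allI impI ballI)
    fix y assume y: "y < n"
    obtain hs where hs: "distinct hs" "set hs = {h \<in> K. S h = y}" "chain (warr s 4) (warr s 3 y) hs"
      using K(1) y unfolding linked_def by blast
    \<comment> \<open>The new half-edge is in no old list, so overwriting its successor leaves all
      of them intact.\<close>
    have "h \<notin> set hs" using hs h by auto
    then have ch: "chain ((warr s 4)(h := warr s 3 (S h))) (warr s 3 y) hs"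
      using hs(3) chain_cong[of hs "warr s 4" "(warr s 4)(h := warr s 3 (S h))"] by auto
    show "((warr s 6)(S h := warr s 6 (S h) + 1)) y = card {h' \<in> insert h K. S h' = y}"
    proof (cases "y = S h")
      case True
      then have "{h' \<in> insert h K. S h' = y} = insert h {h' \<in> K. S h' = y}" by auto
      then show ?thesis using True y K(1) h finK by (simp add: linked_def)
    next
      case False
      then have "{h' \<in> insert h K. S h' = y} = {h' \<in> K. S h' = y}" by auto
      then show ?thesis using False y K(1) by (simp add: linked_def)
    qed
    show "\<exists>hs. distinct hs \<and> set hs = {h' \<in> insert h K. S h' = y} \<and>
        chain ((warr s 4)(h := warr s 3 (S h))) (((warr s 3)(S h := h)) y) hs"
    proof (cases "y = S h")
      case True
      have "h \<noteq> 0" using h(1) by (simp add: H_def)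
      then show ?thesis
        using True hs ch \<open>h \<notin> set hs\<close> by (intro exI[of _ "h # hs"]) auto
    next
      case False
      then show ?thesis using hs ch by (intro exI[of _ hs]) auto
    qed
  qed (use K(1) in \<open>auto simp: linked_def\<close>)
qed

definition input where "input = input_state n es w"

lemma mods_link: "mods (link h a b) = {WA 5, RA 1, WR 10, WA 4, WA 3, WA 6}"
  by (auto simp: link_def)

lemma loopfree_link[simp]: "loopfree (link h a b)"
  by (simp add: link_def)

lemma hoare_build:
  "hoare W build input ((csize build_body + 1) * m + 5) (\<lambda>s. idle 0 s \<and> best {} s)"
proof -
  define M where "M = {WR 6, WR 7, WR 8, WR 9, WR 10, RR 1, WA 3, WA 4, WA 5, WA 6, RA 1}"
  define s0 where "s0 = sem W (WConst 2 1) input"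
  \<comment> \<open>Both half-edges of each of the first \<open>i\<close> edges.\<close>
  define part where "part = (\<lambda>i. {1..i} \<union> {Suc m..m + i})"
  define I where "I = (\<lambda>(ys :: nat list) (zs :: nat list) s. agree (- M) s0 s \<and> wreg s 6 = length
      ys \<and>
    linked (part (length ys)) s)"
  have s0: "wreg s0 0 = n" "wreg s0 1 = m" "wreg s0 2 = 1" "\<And>a. a > 2 \<Longrightarrow> wreg s0 a = 0" "rreg s0 =
      (\<lambda>_. 0)"
    "\<And>A. A > 1 \<Longrightarrow> warr s0 A = (\<lambda>_. 0)" "\<And>i. i < m \<Longrightarrow> warr s0 0 i = fst (es ! i)"
    "\<And>i. i < m \<Longrightarrow> warr s0 1 i = snd (es ! i)"
    "\<And>i. i < m \<Longrightarrow> rarr s0 0 i = w {fst (es ! i), snd (es ! i)}"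
    using W by (auto simp: s0_def input_def input_state_def set_defs m_def)
  have loop: "hoare W (While (WLess 6 1) build_body) (sem W (WConst 6 0) s0)
      ((\<Sum>z\<leftarrow>[0..<m]. csize build_body + 1) + 1) (I [0..<m] [])"
  proof (rule hoare_While_list[where I = I, OF _ _ _ order_refl])
    show "\<not> test_val (WLess 6 1) s" if "I [0..<m] [] s" for s
      using that s0 agreeD(1)[of "- M" s0 s 1] by (auto simp: I_def M_def)
    have "agree (- M) s0 (sem W (WConst 6 0) s0)" by (auto simp: M_def set_defs agree_def)
    moreover have "linked (part 0) (sem W (WConst 6 0) s0)"
      using s0 by (auto simp: linked_def part_def set_defs)
    ultimately show "I [] [0..<m] (sem W (WConst 6 0) s0)" by (simp add: I_def set_defs)
  next
    fix ys z zs s assume ys: "[0..<m] = ys @ z # zs" and Is: "I ys (z # zs) s"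
    define i where "i = length ys"
    have i: "i < m" using arg_cong[OF ys, of length] by (simp add: i_def)
    have ag: "agree (- M) s0 s" and r6: "wreg s 6 = i" and lk: "linked (part i) s"
      using Is by (auto simp: I_def i_def)
    have in_s: "wreg s 1 = m" "wreg s 2 = 1" "warr s 0 = warr s0 0" "warr s 1 = warr s0 1" "rarr s
        0 = rarr s0 0"
      using agreeD[OF ag] s0 by (auto simp: M_def)
    have iW: "Suc i < W" "m + Suc i < W" using i W by (auto simp: m_def)
    define s1 where "s1 = sem W (seqs [WGet 7 0 6, WGet 9 1 6, RGet 1 0 6, WOp WAdd 6 6 2]) s"
    define s2 where "s2 = sem W (link 6 7 9) s1"
    define s3 where "s3 = sem W (WOp WAdd 8 1 6) s2"
    define s4 where "s4 = sem W (link 8 9 7) s3"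
    have ST: "S (Suc i) = fst (es ! i)" "T (Suc i) = snd (es ! i)"
      "S (m + Suc i) = snd (es ! i)" "T (m + Suc i) = fst (es ! i)"
      using i by (auto simp: S_def T_def)
    have s1: "wreg s1 6 = Suc i" "wreg s1 7 = S (Suc i)" "wreg s1 9 = T (Suc i)"
      "rreg s1 1 = w {S (Suc i), T (Suc i)}" "wreg s1 2 = 1" "wreg s1 1 = m"
      using in_s r6 iW s0 i ST by (auto simp: s1_def set_defs)
    have fr1: "agree (- {WR 6, WR 7, WR 9, RR 1}) s s1" by (auto simp: s1_def set_defs agree_def)
    have lk1: "linked (part i) s1" by (rule linked_agree[OF lk fr1]) auto
    have h1: "part i \<subseteq> H" "Suc i \<in> H" "Suc i \<notin> part i" using i by (auto simp: part_def H_def)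
    have lk2: "linked (insert (Suc i) (part i)) s2"
      unfolding s2_def by (rule linked_insert[OF lk1 h1]) (use s1 in auto)
    have fr2: "agree (- {WA 5, RA 1, WR 10, WA 4, WA 3, WA 6}) s1 s2"
      unfolding s2_def using sem_frame[of "link 6 7 9" s1 W] by (simp add: mods_link)
    have r2: "wreg s2 6 = Suc i" "wreg s2 7 = S (Suc i)" "wreg s2 9 = T (Suc i)"
      "rreg s2 1 = w {S (Suc i), T (Suc i)}" "wreg s2 2 = 1" "wreg s2 1 = m"
      using agreeD(1,3)[OF fr2] s1 by auto
    have fr3: "agree (- {WR 8}) s2 s3" by (auto simp: s3_def set_defs agree_def)
    have lk3: "linked (insert (Suc i) (part i)) s3" by (rule linked_agree[OF lk2 fr3]) auto
    have r3: "wreg s3 8 = m + Suc i" "wreg s3 9 = S (m + Suc i)" "wreg s3 7 = T (m + Suc i)"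
      "rreg s3 1 = w {S (m + Suc i), T (m + Suc i)}" "wreg s3 2 = 1" "wreg s3 6 = Suc i"
      using r2 iW ST by (auto simp: s3_def set_defs insert_commute)
    have h3: "insert (Suc i) (part i) \<subseteq> H" "m + Suc i \<in> H" "m + Suc i \<notin> insert (Suc i) (part i)"
      using i by (auto simp: part_def H_def)
    have lk4: "linked (insert (m + Suc i) (insert (Suc i) (part i))) s4"
      unfolding s4_def by (rule linked_insert[OF lk3 h3]) (use r3 in auto)
    have fr4: "agree (- {WA 5, RA 1, WR 10, WA 4, WA 3, WA 6}) s3 s4"
      unfolding s4_def using sem_frame[of "link 8 9 7" s3 W] by (simp add: mods_link)
    have "insert (m + Suc i) (insert (Suc i) (part i)) = part (Suc i)" by (auto simp: part_def)
    moreover have "agree (- M) s0 s4"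
    proof -
      have "agree (- M) s0 s1" by (rule agree_trans[OF ag fr1]) (auto simp: M_def)
      then have "agree (- M) s0 s2" by (rule agree_trans[OF _ fr2]) (auto simp: M_def)
      then have "agree (- M) s0 s3" by (rule agree_trans[OF _ fr3]) (auto simp: M_def)
      then show ?thesis by (rule agree_trans[OF _ fr4]) (auto simp: M_def)
    qed
    moreover have "wreg s4 6 = Suc i" using agreeD(1)[OF fr4] r3 by auto
    ultimately have "I (ys @ [z]) zs s4" using lk4 by (simp add: I_def i_def)
    moreover have "sem W build_body s = s4"
      by (simp add: build_body_def s4_def s3_def s2_def s1_def)
    ultimately have "hoare W build_body s (csize build_body) (I (ys @ [z]) zs)"
      by (intro hoare_loopfree) (simp_all add: build_body_def)
    moreover have "test_val (WLess 6 1) s" using r6 in_s i by simp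
    ultimately show "test_val (WLess 6 1) s \<and> hoare W build_body s (csize build_body) (I (ys @
        [z]) zs)"
      by blast
  qed
  have "hoare W build input (csize (WConst 2 1) + (csize (WConst 6 0) +
      ((\<Sum>z\<leftarrow>[0..<m]. csize build_body + 1) + 1) + 1) + 1) (I [0..<m] [])"
    unfolding build_def
    by (intro hoare_Seq_loopfree) (use loop in \<open>simp_all add: s0_def\<close>)
  then show ?thesis
  proof (rule hoare_conseq)
    fix s assume Is: "I [0..<m] [] s"
    then have ag: "agree (- M) s0 s" and lk: "linked (part m) s" by (auto simp: I_def)
    have "part m = H" by (auto simp: part_def H_def)
    then have "static s"
      using lk s0 agreeD[OF ag] unfolding static_def linked_def dg_def by (auto simp: M_def)
    moreover have "warr s (arr c l \<tau> i) = (\<lambda>_. 0)" for c l \<tau> i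
      using agreeD(2)[OF ag, of "arr c l \<tau> i"] s0(6)[of "arr c l \<tau> i"]
      by (auto simp: M_def arr_def)
    moreover have "wreg s 3 = 0" "wreg s 15 = 0" using agreeD(1)[OF ag] s0(4) by (auto simp: M_def)
    ultimately show "idle 0 s \<and> best {} s" by (simp add: idle_def best_def)
  qed (simp add: sum_list_triv algebra_simps)
qed

text \<open>Rotations of cycles that start at a vertex of largest degree; the bound \<open>u\<close>
  marks the passes already done. Ties give several representatives of one cycle, which does not
  affect a maximum.\<close>

definition reps :: "nat \<Rightarrow> nat list set" where
  "reps u = {vs. is_cycle E k vs \<and> vs ! 0 < u \<and> (\<forall>v\<in>set vs. dg v \<le> dg (vs ! 0))}"

lemma cycle_rep:
  assumes "is_cycle E k us"
  obtains vs where "vs \<in> reps n" "wgt vs = wgt us"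
proof -
  have len: "length us = k" using assms by (simp add: is_cycle_def)
  have "finite (dg ` set us)" "dg ` set us \<noteq> {}" using len k3 by auto
  then have "Max (dg ` set us) \<in> dg ` set us" by (rule Max_in)
  then obtain v where v: "v \<in> set us" "dg v = Max (dg ` set us)" by (metis imageE)
  have max: "dg x \<le> dg v" if "x \<in> set us" for x unfolding v(2) using that by simp
  obtain j where j: "j < k" "us ! j = v" using v(1) len by (auto simp: in_set_conv_nth)
  have c: "is_cycle E k (rotate j us)" using is_cycle_rotate[OF assms] k3 by simp
  have hd: "rotate j us ! 0 = v"
    using j len k3 by (subst nth_rotate) auto
  have "{us ! j, us ! (Suc j mod k)} \<in> E" using assms j(1) unfolding is_cycle_iff by blast
  then obtain h where "h \<in> H" "S h = us ! j" by (rule edgeE)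
  then have "v < n" using ends(1) j by metis
  then have "rotate j us \<in> reps n" using c hd max by (simp add: reps_def)
  moreover have "wgt (rotate j us) = wgt us"
    using cycle_edges_rotate[OF len] k3 by (simp add: wgt_def)
  ultimately show thesis using that by blast
qed

lemma correct_if_best:
  assumes "best (reps n) s" "wreg s' 0 = wreg s 15" "warr s' 2 = warr s 2"
  shows "correct_output k E w s'"
proof (cases "\<exists>vs. is_cycle E k vs")
  case True
  then have "reps n \<noteq> {}" using cycle_rep by blast
  then have b: "wreg s 15 = 1" "is_cycle E k (map (warr s 2) [0..<k])"
    "rreg s 3 = wgt (map (warr s 2) [0..<k])" "\<forall>c\<in>reps n. wgt c \<le> rreg s 3"
    using assms(1) unfolding best_def by auto
  have "wgt us \<le> wgt (map (warr s 2) [0..<k])" if "is_cycle E k us" for us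
    using cycle_rep[OF that] b(3,4) by metis
  then show ?thesis using True b(1,2) assms(2,3)
    unfolding correct_output_def is_max_weight_cycle_def wgt_def by simp
next
  case False
  then have "wreg s 15 = 0" using assms(1) unfolding best_def by auto
  then show ?thesis using False assms(2) unfolding correct_output_def by simp
qed

definition total_cost :: nat where
  "total_cost = (csize build_body + 1) * m + 5 +
     ((\<Sum>u\<leftarrow>[0..<n]. vertex_pass_cost ((k + 1) div 2) u + 1) + 1 + 1 + 1) + 1"

lemma hoare_algorithm:
  "hoare W (algorithm k) input total_cost (correct_output k E w)"
proof -
  define r where "r = (k + 1) div 2"
  have r: "0 < r" "r < k" "k - r \<le> r" using k3 by (auto simp: r_def)
  define I where "I = (\<lambda>(ys :: nat list) (zs :: nat list) s. idle (length ys) s \<and> best (reps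
      (length ys)) s)"
  have reps0: "reps 0 = {}" by (simp add: reps_def)
  have main: "hoare W (While (WLess 3 0) (vertex_pass k r)) s ((\<Sum>u\<leftarrow>[0..<n]. vertex_pass_cost r u +
      1) + 1) (I [0..<n] [])"
    if s: "idle 0 s \<and> best {} s" for s
  proof (rule hoare_While_list[where I = I, OF _ _ _ order_refl])
    show "I [] [0..<n] s" using s by (simp add: I_def reps0)
    show "\<not> test_val (WLess 3 0) s" if "I [0..<n] [] s" for s
      using that by (auto simp: I_def idle_def static_def)
    fix ys z zs s assume ys: "[0..<n] = ys @ z # zs" and Is: "I ys (z # zs) s"
    have z: "z = length ys" "z < n"
    proof -
      have "length ys < n" using arg_cong[OF ys, of length] by simp
      moreover have "[0..<n] ! length ys = z" by (simp add: ys)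
      ultimately show "z = length ys" "z < n" by auto
    qed
    have idle: "idle z s" and best: "best (reps z) s" using Is z by (auto simp: I_def)
    have "reps z \<union> {vs. is_cycle E k vs \<and> vs ! 0 = z \<and> (\<forall>v\<in>set vs. dg v \<le> dg z)} = reps (Suc z)"
      by (auto simp: reps_def less_Suc_eq)
    with hoare_vertex_pass[OF idle z(2) best r]
    have "hoare W (vertex_pass k r) s (vertex_pass_cost r z) (I (ys @ [z]) zs)"
      by (simp add: I_def z)
    then show "test_val (WLess 3 0) s \<and> hoare W (vertex_pass k r) s (vertex_pass_cost r z) (I (ys
        @ [z]) zs)"
      using idle z(2) by (simp add: idle_def static_def)
  qed
  have last: "hoare W (WOp WAdd 0 15 14) s 1 (correct_output k E w)" if Is: "I [0..<n] [] s" for s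
  proof (rule hoare_loopfree)
    have idle: "idle n s" and best: "best (reps n) s" using Is by (auto simp: I_def)
    have "1 < W" using W by simp
    then have "wreg s 15 < W" using best by (auto simp: best_def)
    then have "wreg (sem W (WOp WAdd 0 15 14) s) 0 = wreg s 15"
      using idle by (simp add: set_defs idle_def static_def)
    then show "correct_output k E w (sem W (WOp WAdd 0 15 14) s)"
      by (rule correct_if_best[OF best]) (simp add: set_defs)
  qed simp_all
  have "hoare W (Seq (While (WLess 3 0) (vertex_pass k r)) (WOp WAdd 0 15 14)) s
      ((\<Sum>u\<leftarrow>[0..<n]. vertex_pass_cost r u + 1) + 1 + 1 + 1) (correct_output k E w)"
    if "idle 0 s \<and> best {} s" for s
    by (rule hoare_Seq[OF main[OF that] last]) auto
  then show ?thesis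
    unfolding algorithm_def r_def[symmetric]
    by (intro hoare_Seq[OF hoare_build]) (auto simp: total_cost_def r_def)
qed

end

section \<open>The running time\<close>

definition vertex_pass_const :: "nat \<Rightarrow> nat \<Rightarrow> nat" where
  "vertex_pass_const k r = csize start + (\<Sum>l\<leftarrow>[0..<r]. 3 * (csize (visit l) + 20) +
     (\<Sum>\<tau>\<leftarrow>slots k (Suc l). 3 * (upd_cost k l \<tau> + 20) + 1) + 5) +
     2 * (csize (join_all k r) + 6) + 5"

context weighted_graph
begin

text \<open>As \<open>cost r u\<close> is at least 1, additive constants are absorbed by multiples
  of it. The factor 3 comes from the three summands in \<open>scan_cost\<close>.\<close>

lemma vertex_pass_cost_le:
  assumes u: "u < n" and r: "0 < r"
  shows "vertex_pass_cost r u \<le> vertex_pass_const k r * cost r u"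
proof -
  let ?X = "cost r u"
  have X: "1 \<le> ?X" by (rule cost_pos[OF u])
  have scan: "scan_cost u l c \<le> 3 * (c + 20) * ?X" if "l < r" for l c
  proof -
    have "(\<Sum>y\<in>Lset u l. dg y) + card (Lset u l) + 1 \<le> 3 * ?X"
      using card_edges_Lset[OF u that] card_Lset[OF u that] X by simp
    then have "scan_cost u l c \<le> (c + 20) * (3 * ?X)"
      unfolding scan_cost_def by (rule mult_left_mono) simp
    then show ?thesis by (simp add: algebra_simps)
  qed
  have fill: "fill_cost u l \<le> (\<Sum>\<tau>\<leftarrow>slots k (Suc l). 3 * (upd_cost k l \<tau> + 20) + 1) * ?X + ?X" if "l
      < r" for l
  proof -
    have "(\<Sum>\<tau>\<leftarrow>slots k (Suc l). scan_cost u l (upd_cost k l \<tau>) + 1) \<le>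
        (\<Sum>\<tau>\<leftarrow>slots k (Suc l). (3 * (upd_cost k l \<tau> + 20) + 1) * ?X)"
    proof (rule sum_list_mono)
      fix \<tau>
      show "scan_cost u l (upd_cost k l \<tau>) + 1 \<le> (3 * (upd_cost k l \<tau> + 20) + 1) * ?X"
        using scan[OF that, of "upd_cost k l \<tau>"] X unfolding add_mult_distrib[of _ 1] by linarith
    qed
    then show ?thesis using X by (simp add: fill_cost_def sum_list_mult_const)
  qed
  have grow: "grow_cost u l + 1 \<le> (3 * (csize (visit l) + 20) +
     (\<Sum>\<tau>\<leftarrow>slots k (Suc l). 3 * (upd_cost k l \<tau> + 20) + 1) + 5) * ?X" if "l < r" for l
  proof -
    have "grow_cost u l + 1 \<le> 3 * (csize (visit l) + 20) * ?X +
        ((\<Sum>\<tau>\<leftarrow>slots k (Suc l). 3 * (upd_cost k l \<tau> + 20) + 1) * ?X + ?X) + 4 * ?X"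
      unfolding grow_cost_def using scan[OF that, of "csize (visit l)"] fill[OF that] X by linarith
    then show ?thesis by (simp add: add_mult_distrib)
  qed
  have "(\<Sum>l\<leftarrow>[0..<r]. grow_cost u l + 1) \<le> (\<Sum>l\<leftarrow>[0..<r]. (3 * (csize (visit l) + 20) +
     (\<Sum>\<tau>\<leftarrow>slots k (Suc l). 3 * (upd_cost k l \<tau> + 20) + 1) + 5) * ?X)"
    by (intro sum_list_mono) (use grow in auto)
  also have "\<dots> = (\<Sum>l\<leftarrow>[0..<r]. (3 * (csize (visit l) + 20) +
     (\<Sum>\<tau>\<leftarrow>slots k (Suc l). 3 * (upd_cost k l \<tau> + 20) + 1) + 5)) * ?X"
    by (rule sum_list_mult_const)
  finally have 1: "(\<Sum>l\<leftarrow>[0..<r]. grow_cost u l + 1) \<le> \<dots>" .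
  have "card (Lset u r) \<le> ?X"
    using card_Lset_Suc[OF u, of "r - 1" r] r by simp
  then have "(csize (join_all k r) + 6) * (card (Lset u r) + 1) \<le> (csize (join_all k r) + 6) * (2
      * ?X)"
    using X by (intro mult_left_mono) auto
  then have 2: "(csize (join_all k r) + 6) * (card (Lset u r) + 1) \<le> 2 * (csize (join_all k r) +
      6) * ?X"
    by (simp add: algebra_simps)
  have 3: "csize start \<le> csize start * ?X" "5 \<le> 5 * ?X" using X by auto
  show ?thesis
    unfolding vertex_pass_cost_def vertex_pass_const_def
    using 1 2 3 by (simp only: add_mult_distrib)
qed

end

text \<open>The 9 is the sum of the constants in \<open>total_cost\<close>. It keeps the bound valid
  at \<open>m = 0\<close>, where \<open>powr\<close> yields 0 although the program still makes a few
  steps.\<close>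

definition time_bound :: "nat \<Rightarrow> nat \<Rightarrow> nat" where
  "time_bound k m = nat \<lceil>real (csize build_body + 3 + 4 * vertex_pass_const k ((k + 1) div 2)) *
     real m powr (2 - 1 / real ((k + 1) div 2))\<rceil> + 9"

context weighted_graph
begin

text \<open>The exponent is at least 1, so the terms linear in \<open>m\<close>, including the
  overhead \<open>n \<le> 2 * m\<close> of the vertex loop, go into the main term.\<close>

lemma total_cost_le: "total_cost \<le> time_bound k m"
proof -
  define r where "r = (k + 1) div 2"
  define e where "e = 2 - 1 / real r"
  let ?K = "vertex_pass_const k r"
  have r: "0 < r" using k3 by (simp add: r_def)
  have m_le: "real m \<le> real m powr e"
  proof (cases "m = 0")
    case False
    then have "real m powr 1 \<le> real m powr e"
      using r by (intro powr_mono) (auto simp: e_def)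
    then show ?thesis using False by simp
  qed simp
  have "(\<Sum>u\<leftarrow>[0..<n]. vertex_pass_cost r u + 1) = (\<Sum>u<n. vertex_pass_cost r u + 1)"
    by (simp add: interv_sum_list_conv_sum_set_nat atLeast0LessThan)
  also have "\<dots> \<le> (\<Sum>u<n. ?K * cost r u + 1)"
    by (intro sum_mono) (use vertex_pass_cost_le[OF _ r] in auto)
  also have "\<dots> = ?K * (\<Sum>u<n. cost r u) + n"
    by (simp only: sum.distrib sum_distrib_left) simp
  also have "\<dots> \<le> ?K * (\<Sum>u<n. cost r u) + 2 * m" using n_le by simp
  finally have 1: "(\<Sum>u\<leftarrow>[0..<n]. vertex_pass_cost r u + 1) \<le> ?K * (\<Sum>u<n. cost r u) + 2 * m" .
  have "real ?K * real (\<Sum>u<n. cost r u) \<le> real ?K * (4 * real m powr e)"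
    using sum_cost[OF r] by (intro mult_left_mono) (auto simp: e_def)
  then have 2: "real (?K * (\<Sum>u<n. cost r u)) \<le> 4 * real ?K * real m powr e" by simp
  have "total_cost \<le> (csize build_body + 3) * m + ?K * (\<Sum>u<n. cost r u) + 9"
    using 1 unfolding total_cost_def r_def[symmetric] by (simp add: add_mult_distrib)
  then have "real total_cost \<le> real ((csize build_body + 3) * m + ?K * (\<Sum>u<n. cost r u) + 9)"
    by (simp only: of_nat_le_iff)
  also have "\<dots> = real (csize build_body + 3) * real m + real (?K * (\<Sum>u<n. cost r u)) + 9"
    by (simp only: of_nat_add of_nat_mult of_nat_numeral)
  also have "\<dots> \<le> real (csize build_body + 3) * real m powr e + 4 * real ?K * real m powr e + 9"
    using m_le 2 by (intro add_mono mult_left_mono) auto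
  also have "\<dots> = real (csize build_body + 3 + 4 * ?K) * real m powr e + 9"
    by (simp add: algebra_simps)
  also have "\<dots> \<le> real (time_bound k m)"
    unfolding time_bound_def r_def[symmetric] e_def[symmetric]
    by (simp only: of_nat_add of_nat_numeral) (simp add: of_nat_ceiling del: of_nat_add)
  finally show ?thesis by simp
qed

end

text \<open>The word size exponent \<open>k\<close> suffices: \<open>N ^ k\<close> is at least
  \<open>N * N\<close>, hence at least \<open>2 * N\<close>, and at least \<open>2 ^ k\<close>,
  which exceeds \<open>k\<close>. A halted run stays put, so the full time bound yields the same
  point mass, of success probability 1.\<close>

lemma finds_algorithm:
  assumes k: "k \<ge> 3" and q: "\<And>n. q n \<le> 1"
  shows "finds_max_weight_cycle k (algorithm k) k (\<lambda>n m. time_bound k m) q"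
  unfolding finds_max_weight_cycle_def Let_def
proof (intro allI impI)
  fix n :: nat and E w and es :: "(nat \<times> nat) list"
  assume G: "simple_graph {..<n} E" "no_isolated_vertices {..<n} E" "lists_edges es E"
  have card: "card E = length es"
    using G(3) unfolding lists_edges_def by (metis distinct_card length_map)
  define N where "N = n + card E + 2"
  have "2 * N \<le> N * N" unfolding N_def by (intro mult_right_mono) auto
  also have "\<dots> \<le> N ^ k"
    using power_increasing[of 2 k N] k by (simp add: N_def power2_eq_square)
  finally have W1: "n + 2 * length es + 2 < N ^ k" by (simp add: N_def card)
  have "k < 2 ^ k" by (rule less_exp)
  also have "(2 :: nat) ^ k \<le> N ^ k" by (intro power_mono) (auto simp: N_def)
  finally have W2: "k < N ^ k" .
  interpret weighted_graph n E w es k "N ^ k"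
    by standard (use G k W1 W2 in auto)
  obtain t s where t: "t \<le> total_cost" "\<And>K. run (N ^ k) t (algorithm k # K, input) = return_pmf
      (K, s)"
    "correct_output k E w s"
    using hoare_algorithm unfolding hoare_def by blast
  have "t \<le> time_bound k (card E)" using t(1) total_cost_le by (simp add: card m_def)
  then obtain t' where t': "time_bound k (card E) = t + t'" by (metis le_add_diff_inverse)
  have "run (N ^ k) (time_bound k (card E)) ([algorithm k], input_state n es w) = return_pmf ([],
      s)"
    unfolding t' run_add input_def[symmetric] t(2) by (simp add: bind_return_pmf run_halted)
  then show "(\<forall>cf\<in>set_pmf (run ((n + card E + 2) ^ k) (time_bound k (card E))
        ([algorithm k], input_state n es w)). halted cf) \<and>
      q n \<le> measure_pmf.prob (run ((n + card E + 2) ^ k) (time_bound k (card E))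
        ([algorithm k], input_state n es w)) {cf. correct_output k E w (snd cf)}"
    using t(3) q[of n] unfolding N_def by (simp add: halted_def)
qed

lemma time_bound_bigo:
  defines "e \<equiv> \<lambda>k. 2 - 1 / real ((k + 1) div 2)"
  obtains A where "\<And>m. 1 \<le> m \<Longrightarrow> real (time_bound k m) \<le> A * real m powr e k"
proof -
  define B where "B = real (csize build_body + 3 + 4 * vertex_pass_const k ((k + 1) div 2))"
  \<comment> \<open>The 10 consists of the 9 in \<open>time_bound\<close> and 1 for rounding
    up.\<close>
  have "real (time_bound k m) \<le> (B + 10) * real m powr e k" if m: "1 \<le> m" for m
  proof -
    have "1 / real r \<le> 1" for r by (cases r) (simp_all add: field_simps)
    from this[of "(k + 1) div 2"] have "0 \<le> e k" unfolding e_def by linarith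
    then have 1: "1 \<le> real m powr e k" using m by (simp add: ge_one_powr_ge_zero)
    have B: "0 \<le> B * real m powr e k" by (simp add: B_def)
    have "real (time_bound k m) = real_of_int \<lceil>B * real m powr e k\<rceil> + 9"
      using B unfolding time_bound_def B_def[symmetric] e_def by simp
    also have "\<dots> \<le> B * real m powr e k + 1 + 9" by (intro add_right_mono) linarith
    also have "\<dots> \<le> (B + 10) * real m powr e k" using 1 by (simp add: distrib_right)
    finally show ?thesis .
  qed
  then show thesis using that by blast
qed

theorem theorem1p3:
  fixes k :: nat
  assumes "k \<ge> 3"
  shows "(\<forall>c::nat. \<exists>p d. \<exists>T :: nat \<Rightarrow> nat. d \<ge> 1 \<and>
            finds_max_weight_cycle k p d (\<lambda>n m. T m) (\<lambda>n. 1 - 1 / real n ^ c) \<and>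
            (\<lambda>m. real (T m)) \<in> O(\<lambda>m. real m powr (2 - 1 / real_of_int \<lceil>real k / 2\<rceil>)))
       \<and> (\<exists>p d. \<exists>T :: nat \<Rightarrow> nat \<Rightarrow> nat. d \<ge> 1 \<and> deterministic p \<and>
            finds_max_weight_cycle k p d T (\<lambda>n. 1) \<and>
            (\<lambda>(n, m). real (T n m)) \<in> O[at_top \<times>\<^sub>F at_top](\<lambda>(n, m).
               real m powr (2 - 1 / real_of_int \<lceil>real k / 2\<rceil>) * ln (real n)))"
proof -
  have ceil: "real_of_int \<lceil>real k / 2\<rceil> = real ((k + 1) div 2)"
  proof -
    have "\<lceil>real k / 2\<rceil> = int ((k + 1) div 2)"
      by (rule ceiling_unique) (cases "even k"; auto elim!: evenE oddE)+
    then show ?thesis by simp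
  qed
  define e where "e = 2 - 1 / real ((k + 1) div 2)"
  obtain A where A: "\<And>m. 1 \<le> m \<Longrightarrow> real (time_bound k m) \<le> A * real m powr e"
    using time_bound_bigo[of k] unfolding e_def by blast
  have O1: "(\<lambda>m. real (time_bound k m)) \<in> O(\<lambda>m. real m powr e)"
  proof (rule bigoI)
    show "\<forall>\<^sub>F m in sequentially. norm (real (time_bound k m)) \<le> A * norm (real m powr e)"
      using eventually_ge_at_top[of 1] by eventually_elim (use A in auto)
  qed
  have O2: "(\<lambda>(n, m). real (time_bound k m)) \<in> O[at_top \<times>\<^sub>F at_top](\<lambda>(n, m). real m powr e * ln
      (real n))"
  proof (rule bigoI)
    have "\<forall>\<^sub>F x in at_top \<times>\<^sub>F at_top. (3 :: nat) \<le> fst x \<and> (1 :: nat) \<le> snd x"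
      by (rule eventually_prodI) (rule eventually_ge_at_top)+
    then show "\<forall>\<^sub>F x in at_top \<times>\<^sub>F at_top. norm (case x of (n, m) \<Rightarrow> real (time_bound k m)) \<le>
        A * norm (case x of (n, m) \<Rightarrow> real m powr e * ln (real n))"
    proof eventually_elim
      case (elim x)
      obtain n m where x: "x = (n, m)" by (cases x)
      have n: "3 \<le> n" and m: "1 \<le> m" using elim by (auto simp: x)
      \<comment> \<open>The threshold 3 for \<open>n\<close> comes from
        \<open>exp 1 \<le> 3\<close>; from there on the factor \<open>ln (real n)\<close> only
        enlarges the bound.\<close>
      have "1 \<le> ln (real n)"
        using n exp_le by (subst ln_ge_iff) auto
      moreover have "0 \<le> A * real m powr e" using A[OF m] by (rule order_trans[rotated]) simp
      ultimately have "A * real m powr e * 1 \<le> A * real m powr e * ln (real n)"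
        by (intro mult_left_mono)
      then show ?case using A[OF m] \<open>1 \<le> ln (real n)\<close> by (simp add: x abs_mult mult.assoc)
    qed
  qed
  show ?thesis
    unfolding ceil e_def[symmetric]
  proof (intro conjI allI exI)
    show "1 \<le> k" "1 \<le> k" using assms by auto
    show "finds_max_weight_cycle k (algorithm k) k (\<lambda>n. time_bound k) (\<lambda>n. 1 - 1 / real n ^ c)"
        for c
      by (rule finds_algorithm[OF assms]) simp
    show "finds_max_weight_cycle k (algorithm k) k (\<lambda>n. time_bound k) (\<lambda>n. 1)"
      by (rule finds_algorithm[OF assms]) simp
    show "deterministic (algorithm k)" by (rule deterministic_algorithm)
  qed (use O1 O2 in auto)
qed

end
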